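(* Let $A$ be a two-dimensional Artin--Schelter regular $\Bbbk$-algebra which is generated in degree $1$ and not commutative, let $G$ be a finite non-abelian group, and suppose that $A$ has a $G$-grading, compatible with its $\mathbb{N}$-grading, which is inner-faithful. Then there is an isomorphism of $\Bbbk$-algebras $$A \cong \Bbbk\langle u,v\rangle/\langle u^2-v^2\rangle$$ and $G$ has a presentation $G=\langle a,b \mid \mathcal{R}\rangle$ for some set of relations $\mathcal{R}$, one of which is $a^2=b^2$, such that (identifying $A$ with $\Bbbk\langle u,v\rangle/\langle u^2-v^2\rangle$ via this isomorphism) $u$ and $v$ are $G$-homogeneous and the $G$-grading on $A$ satisfies $\deg_G u=a$ and $\deg_G v=b$.
   Context: $\Bbbk$ is an algebraically closed field of characteristic $0$. A $\Bbbk$-algebra $A$ is connected graded if it is $\mathbb{N}$-graded with $A_0=\Bbbk$; write $\Bbbk=A/A_{\geqslant 1}$ for the trivial module. A connected graded algebra $A$ is Artin--Schelter (AS) regular of dimension $d$ if: (1) the left and right injective dimensions of $A$ over itself are both equal to $d<\infty$; (2) $\operatorname{Ext}^i({}_A\Bbbk,{}_AA)=0$ for $i\neq d$ and $\operatorname{Ext}^d({}_A\Bbbk,{}_AA)\cong \Bbbk[\ell]_A$ as graded right $A$-modules for some integer $\ell$, and the symmetric condition holds for $\operatorname{Ext}^i(\Bbbk_A,A_A)$ with the same $\ell$; (3) $A$ has global dimension $d$; (4) $A$ has finite Gelfand--Kirillov dimension. "Two-dimensional" means $d=2$. A $G$-grading on $A$ is a decomposition $A=\bigoplus_{g\in G}A_g$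 with $A_gA_h\subseteq A_{gh}$; $\deg_G x=g$ means $0 \neq x\in A_g$. It is compatible with the $\mathbb{N}$-grading if each $\mathbb{N}$-graded piece $A_n$ is the direct sum of its intersections with the subspaces $A_g$, $g\in G$. A $G$-grading is equivalent to an action of the Hopf algebra $(\Bbbk G)^*$ (the dual of the group algebra, with basis $\{\phi_g\}_{g\in G}$ dual to $G$) making $A$ a module algebra, where $\phi_g$ acts as the projection of $A$ onto $A_g$. An action of a Hopf algebra $H$ on a left module $V$ is inner-faithful if $IV\neq 0$ for every nonzero Hopf ideal $I$ of $H$; the $G$-grading on $A$ is inner-faithful if the corresponding action of $(\Bbbk G)^*$ on $A$ is. *)

theory Defs
  imports
    "HOL-Algebra.Algebra"
    "HOL-Algebra.Algebraic_Closure_Type"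
    "HOL-Computational_Algebra.Polynomial"
    "HOL-Library.Extended_Real"
    "HOL-Library.Extended_Nat"
begin

section \<open>Algebras over a field, gradings, growth\<close>

text \<open>
  The algebra \<open>A\<close> is a type \<open>'a\<close> of class \<^class>\<open>ring_1\<close> together with a scalar multiplication by a field
  \<open>'k\<close>. For the homological notions \<open>A\<close> is turned into a record of \<open>HOL-Algebra\<close> by
  \<^const>\<open>ring_of_type_algebra\<close>.
\<close>

locale k_algebra = vector_space scale
  for scale :: "'k::field \<Rightarrow> 'a::ring_1 \<Rightarrow> 'a" +
  assumes scale_mult_left: "scale c x * y = scale c (x * y)"
    and scale_mult_right: "x * scale c y = scale c (x * y)"

definition decomposes_as :: "'i set \<Rightarrow> ('i \<Rightarrow> 'a::ab_group_add set) \<Rightarrow> 'a \<Rightarrow> ('i \<Rightarrow> 'a) \<Rightarrow> bool" where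
  "decomposes_as I D x f \<longleftrightarrow>
     (\<forall>i\<in>I. f i \<in> D i) \<and> (\<forall>i. i \<notin> I \<longrightarrow> f i = 0) \<and>
     finite {i. f i \<noteq> 0} \<and> x = (\<Sum>i | f i \<noteq> 0. f i)"

definition is_direct_sum ::
    "('k::field \<Rightarrow> 'a::ab_group_add \<Rightarrow> 'a) \<Rightarrow> 'a set \<Rightarrow> 'i set \<Rightarrow> ('i \<Rightarrow> 'a set) \<Rightarrow> bool" where
  "is_direct_sum scale V I D \<longleftrightarrow>
     module.subspace scale V \<and>
     (\<forall>i\<in>I. module.subspace scale (D i) \<and> D i \<subseteq> V) \<and>
     (\<forall>x\<in>V. \<exists>!f. decomposes_as I D x f)"

definition component :: "'i set \<Rightarrow> ('i \<Rightarrow> 'a::ab_group_add set) \<Rightarrow> 'i \<Rightarrow> 'a \<Rightarrow> 'a" where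
  "component I D i x = (THE f. decomposes_as I D x f) i"

definition connected_graded :: "('k::field \<Rightarrow> 'a::ring_1 \<Rightarrow> 'a) \<Rightarrow> (nat \<Rightarrow> 'a set) \<Rightarrow> bool" where
  "connected_graded scale gr \<longleftrightarrow>
     k_algebra scale \<and> is_direct_sum scale UNIV UNIV gr \<and>
     (\<forall>m n. \<forall>x\<in>gr m. \<forall>y\<in>gr n. x * y \<in> gr (m + n)) \<and>
     gr 0 = range (\<lambda>c. scale c 1)"

definition positive_part :: "('k::field \<Rightarrow> 'a::ring_1 \<Rightarrow> 'a) \<Rightarrow> (nat \<Rightarrow> 'a set) \<Rightarrow> 'a set" where
  "positive_part scale gr = module.span scale (\<Union>n\<in>{1..}. gr n)"

definition generated_in_degree_one ::
    "('k::field \<Rightarrow> 'a::ring_1 \<Rightarrow> 'a) \<Rightarrow> (nat \<Rightarrow> 'a set) \<Rightarrow> bool" where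
  "generated_in_degree_one scale gr \<longleftrightarrow>
     module.span scale {prod_list xs | xs. set xs \<subseteq> gr 1} = UNIV"

text \<open>\<open>V\<^sup>0 + V\<^sup>1 + \<dots> + V\<^sup>n\<close>, where \<open>V\<^sup>i\<close> is spanned by the products of \<open>i\<close> elements of \<open>V\<close>.\<close>

definition powers_upto ::
    "('k::field \<Rightarrow> 'a::ring_1 \<Rightarrow> 'a) \<Rightarrow> 'a set \<Rightarrow> nat \<Rightarrow> 'a set" where
  "powers_upto scale V n = module.span scale {prod_list xs | xs. set xs \<subseteq> V \<and> length xs \<le> n}"

definition gk_dim :: "('k::field \<Rightarrow> 'a::ring_1 \<Rightarrow> 'a) \<Rightarrow> ereal" where
  "gk_dim scale =
     (SUP V \<in> {module.span scale S | S. finite S}.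
        limsup (\<lambda>n. ereal (log (real n) (real (vector_space.dim scale (powers_upto scale V n))))))"


section \<open>Modules over a noncommutative ring\<close>

text \<open>
  The locale \<^locale>\<open>Module.module\<close> needs a commutative ring; only its record type is used here (so the
  fields \<open>mult\<close> and \<open>one\<close> of a module carry no meaning). Right modules are left modules over the
  opposite ring.
\<close>

definition opposite_ring :: "'r ring \<Rightarrow> 'r ring" where
  "opposite_ring R = R\<lparr>monoid.mult := (\<lambda>x y. y \<otimes>\<^bsub>R\<^esub> x)\<rparr>"

locale left_module = R?: ring R + M?: abelian_group M
  for R :: "'r ring" (structure) and M :: "('r, 'm) module" (structure) +
  assumes act_closed: "\<lbrakk>a \<in> carrier R; x \<in> carrier M\<rbrakk> \<Longrightarrow> a \<odot>\<^bsub>M\<^esub> x \<in> carrier M"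
    and act_l_distr: "\<lbrakk>a \<in> carrier R; b \<in> carrier R; x \<in> carrier M\<rbrakk>
      \<Longrightarrow> (a \<oplus>\<^bsub>R\<^esub> b) \<odot>\<^bsub>M\<^esub> x = a \<odot>\<^bsub>M\<^esub> x \<oplus>\<^bsub>M\<^esub> b \<odot>\<^bsub>M\<^esub> x"
    and act_r_distr: "\<lbrakk>a \<in> carrier R; x \<in> carrier M; y \<in> carrier M\<rbrakk>
      \<Longrightarrow> a \<odot>\<^bsub>M\<^esub> (x \<oplus>\<^bsub>M\<^esub> y) = a \<odot>\<^bsub>M\<^esub> x \<oplus>\<^bsub>M\<^esub> a \<odot>\<^bsub>M\<^esub> y"
    and act_assoc: "\<lbrakk>a \<in> carrier R; b \<in> carrier R; x \<in> carrier M\<rbrakk>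
      \<Longrightarrow> (a \<otimes>\<^bsub>R\<^esub> b) \<odot>\<^bsub>M\<^esub> x = a \<odot>\<^bsub>M\<^esub> (b \<odot>\<^bsub>M\<^esub> x)"
    and act_one: "x \<in> carrier M \<Longrightarrow> \<one>\<^bsub>R\<^esub> \<odot>\<^bsub>M\<^esub> x = x"

definition hom_module :: "'r ring \<Rightarrow> ('r, 'm) module \<Rightarrow> ('r, 'n) module \<Rightarrow> ('m \<Rightarrow> 'n) set" where
  "hom_module R M N =
     {f \<in> carrier M \<rightarrow>\<^sub>E carrier N.
        (\<forall>x\<in>carrier M. \<forall>y\<in>carrier M. f (x \<oplus>\<^bsub>M\<^esub> y) = f x \<oplus>\<^bsub>N\<^esub> f y) \<and>
        (\<forall>a\<in>carrier R. \<forall>x\<in>carrier M. f (a \<odot>\<^bsub>M\<^esub> x) = a \<odot>\<^bsub>N\<^esub> f x)}"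

definition hom_kernel :: "('r, 'm) module \<Rightarrow> ('r, 'n) module \<Rightarrow> ('m \<Rightarrow> 'n) \<Rightarrow> 'm set" where
  "hom_kernel M N f = {x \<in> carrier M. f x = \<zero>\<^bsub>N\<^esub>}"

definition is_zero_module :: "('r, 'm) module \<Rightarrow> bool" where
  "is_zero_module M \<longleftrightarrow> carrier M = {\<zero>\<^bsub>M\<^esub>}"

definition regular_module :: "'r ring \<Rightarrow> ('r, 'r) module" where
  "regular_module R =
     \<lparr>carrier = carrier R, monoid.mult = (\<otimes>\<^bsub>R\<^esub>), one = \<one>\<^bsub>R\<^esub>, ring.zero = \<zero>\<^bsub>R\<^esub>,
      add = (\<oplus>\<^bsub>R\<^esub>), module.smult = (\<otimes>\<^bsub>R\<^esub>)\<rparr>"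

text \<open>
  The quotient of a module by a submodule \<open>N\<close>, with carrier the cosets of \<open>N\<close>. If \<open>M\<close> is moreover an
  algebra and \<open>N\<close> a two-sided ideal, then this is \<open>M Quot N\<close> as a ring, i.e. the quotient algebra.
\<close>

definition quotient_module :: "('r, 'm) module \<Rightarrow> 'm set \<Rightarrow> ('r, 'm set) module" where
  "quotient_module M N =
     \<lparr>carrier = a_rcosets\<^bsub>M\<^esub> N, monoid.mult = rcoset_mult M N, one = N +>\<^bsub>M\<^esub> \<one>\<^bsub>M\<^esub>,
      ring.zero = N, add = set_add M, module.smult = (\<lambda>a C. \<Union>x\<in>C. N +>\<^bsub>M\<^esub> (a \<odot>\<^bsub>M\<^esub> x))\<rparr>"


section \<open>Projective, injective and global dimension\<close>

text \<open>
  Quantification over all modules has to be restricted to one type, here the type of sets of lists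
  over \<open>R\<close>. Its cardinality is \<open>2\<^sup>\<kappa>\<close> with \<open>\<kappa> = max(|R|, \<aleph>\<^sub>0)\<close>, so nothing is lost: up to isomorphism
  the type contains all left ideals of \<open>R\<close> (hence injectivity is ordinary injectivity, by Baer's
  criterion) and all cyclic modules (hence the global dimension is the ordinary one, by Auslander's
  theorem), and with every module of at most this cardinality it contains a free cover and an
  injective hull of it (hence projectivity is ordinary projectivity, and the resolutions defining
  projective and injective dimensions exist in it).
\<close>

type_synonym 'r small_module = "('r, 'r list set) module"

definition projective_module :: "'r ring \<Rightarrow> 'r small_module \<Rightarrow> bool" where
  "projective_module R P \<longleftrightarrow> left_module R P \<and>
     (\<forall>(M :: 'r small_module) (N :: 'r small_module).
        left_module R M \<longrightarrow> left_module R N \<longrightarrow>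
        (\<forall>g\<in>hom_module R M N. \<forall>f\<in>hom_module R P N.
           g ` carrier M = carrier N \<longrightarrow>
           (\<exists>h\<in>hom_module R P M. \<forall>x\<in>carrier P. g (h x) = f x)))"

definition injective_module :: "'r ring \<Rightarrow> 'r small_module \<Rightarrow> bool" where
  "injective_module R E \<longleftrightarrow> left_module R E \<and>
     (\<forall>(M :: 'r small_module) (N :: 'r small_module).
        left_module R M \<longrightarrow> left_module R N \<longrightarrow>
        (\<forall>g\<in>hom_module R M N. \<forall>f\<in>hom_module R M E.
           inj_on g (carrier M) \<longrightarrow>
           (\<exists>h\<in>hom_module R N E. \<forall>x\<in>carrier M. h (g x) = f x)))"

text \<open>An exact sequence \<open>\<dots> \<rightarrow> P 2 \<rightarrow> P 1 \<rightarrow> P 0 \<rightarrow> M \<rightarrow> 0\<close> with \<open>\<delta> i : P (i + 1) \<rightarrow> P i\<close>.\<close>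

definition projective_resolution ::
    "'r ring \<Rightarrow> ('r, 'm) module \<Rightarrow> (nat \<Rightarrow> 'r small_module) \<Rightarrow>
     (nat \<Rightarrow> 'r list set \<Rightarrow> 'r list set) \<Rightarrow> ('r list set \<Rightarrow> 'm) \<Rightarrow> bool" where
  "projective_resolution R M P \<delta> \<epsilon> \<longleftrightarrow>
     left_module R M \<and> (\<forall>i. projective_module R (P i)) \<and>
     \<epsilon> \<in> hom_module R (P 0) M \<and> (\<forall>i. \<delta> i \<in> hom_module R (P (Suc i)) (P i)) \<and>
     \<epsilon> ` carrier (P 0) = carrier M \<and>
     hom_kernel (P 0) M \<epsilon> = \<delta> 0 ` carrier (P 1) \<and>
     (\<forall>i. hom_kernel (P (Suc i)) (P i) (\<delta> i) = \<delta> (Suc i) ` carrier (P (Suc (Suc i))))"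

text \<open>An exact sequence \<open>0 \<rightarrow> M \<rightarrow> E 0 \<rightarrow> E 1 \<rightarrow> E 2 \<rightarrow> \<dots>\<close> with \<open>\<delta> i : E i \<rightarrow> E (i + 1)\<close>.\<close>

definition injective_resolution ::
    "'r ring \<Rightarrow> ('r, 'm) module \<Rightarrow> (nat \<Rightarrow> 'r small_module) \<Rightarrow>
     (nat \<Rightarrow> 'r list set \<Rightarrow> 'r list set) \<Rightarrow> ('m \<Rightarrow> 'r list set) \<Rightarrow> bool" where
  "injective_resolution R M E \<delta> \<eta> \<longleftrightarrow>
     left_module R M \<and> (\<forall>i. injective_module R (E i)) \<and>
     \<eta> \<in> hom_module R M (E 0) \<and> (\<forall>i. \<delta> i \<in> hom_module R (E i) (E (Suc i))) \<and>
     inj_on \<eta> (carrier M) \<and>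
     hom_kernel (E 0) (E 1) (\<delta> 0) = \<eta> ` carrier M \<and>
     (\<forall>i. hom_kernel (E (Suc i)) (E (Suc (Suc i))) (\<delta> (Suc i)) = \<delta> i ` carrier (E i))"

definition proj_dim :: "'r ring \<Rightarrow> ('r, 'm) module \<Rightarrow> enat" where
  "proj_dim R M =
     (INF n \<in> {n. \<exists>P \<delta> \<epsilon>. projective_resolution R M P \<delta> \<epsilon> \<and> (\<forall>i>n. is_zero_module (P i))}. enat n)"

definition inj_dim :: "'r ring \<Rightarrow> ('r, 'm) module \<Rightarrow> enat" where
  "inj_dim R M =
     (INF n \<in> {n. \<exists>E \<delta> \<eta>. injective_resolution R M E \<delta> \<eta> \<and> (\<forall>i>n. is_zero_module (E i))}. enat n)"

definition left_global_dim :: "'r ring \<Rightarrow> enat" where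
  "left_global_dim R = (SUP M \<in> {M :: 'r small_module. left_module R M}. proj_dim R M)"


section \<open>Graded modules and graded Ext\<close>

definition graded_module ::
    "'r ring \<Rightarrow> (nat \<Rightarrow> 'r set) \<Rightarrow> ('r, 'm) module \<Rightarrow> (int \<Rightarrow> 'm set) \<Rightarrow> bool" where
  "graded_module R gr M Mg \<longleftrightarrow> left_module R M \<and>
     (\<forall>n. additive_subgroup (Mg n) M) \<and>
     (\<forall>x\<in>carrier M. \<exists>!f. (\<forall>n. f n \<in> Mg n) \<and> finite {n. f n \<noteq> \<zero>\<^bsub>M\<^esub>} \<and>
        x = finsum M f {n. f n \<noteq> \<zero>\<^bsub>M\<^esub>}) \<and>
     (\<forall>m n. \<forall>a\<in>gr m. \<forall>x\<in>Mg n. a \<odot>\<^bsub>M\<^esub> x \<in> Mg (int m + n))"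

definition graded_isomorphic ::
    "'r ring \<Rightarrow> ('r, 'm) module \<Rightarrow> (int \<Rightarrow> 'm set) \<Rightarrow> ('r, 'n) module \<Rightarrow> (int \<Rightarrow> 'n set) \<Rightarrow> bool" where
  "graded_isomorphic R M Mg N Ng \<longleftrightarrow>
     (\<exists>\<phi>\<in>hom_module R M N. bij_betw \<phi> (carrier M) (carrier N) \<and> (\<forall>n. \<phi> ` Mg n = Ng n))"

definition shift :: "int \<Rightarrow> (int \<Rightarrow> 'm set) \<Rightarrow> int \<Rightarrow> 'm set" where
  "shift l Mg n = Mg (n + l)"

definition concentrated_in_degree_zero :: "('r, 'm) module \<Rightarrow> int \<Rightarrow> 'm set" where
  "concentrated_in_degree_zero M n = (if n = 0 then carrier M else {\<zero>\<^bsub>M\<^esub>})"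

definition graded_projective_resolution ::
    "'r ring \<Rightarrow> (nat \<Rightarrow> 'r set) \<Rightarrow> ('r, 'm) module \<Rightarrow> (int \<Rightarrow> 'm set) \<Rightarrow>
     (nat \<Rightarrow> 'r small_module) \<Rightarrow> (nat \<Rightarrow> int \<Rightarrow> 'r list set set) \<Rightarrow>
     (nat \<Rightarrow> 'r list set \<Rightarrow> 'r list set) \<Rightarrow> ('r list set \<Rightarrow> 'm) \<Rightarrow> bool" where
  "graded_projective_resolution R gr M Mg P Pg \<delta> \<epsilon> \<longleftrightarrow>
     projective_resolution R M P \<delta> \<epsilon> \<and>
     graded_module R gr M Mg \<and> (\<forall>i. graded_module R gr (P i) (Pg i)) \<and>
     (\<forall>n. \<epsilon> ` Pg 0 n \<subseteq> Mg n) \<and> (\<forall>i n. \<delta> i ` Pg (Suc i) n \<subseteq> Pg i n)"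

text \<open>Homomorphisms \<open>P \<rightarrow> R\<close> of degree \<open>n\<close>; the pieces of \<open>R\<close> in negative degrees are zero.\<close>

definition hom_degree ::
    "'r ring \<Rightarrow> (nat \<Rightarrow> 'r set) \<Rightarrow> ('r, 'm) module \<Rightarrow> (int \<Rightarrow> 'm set) \<Rightarrow> int \<Rightarrow> ('m \<Rightarrow> 'r) set" where
  "hom_degree R gr P Pg n =
     {f \<in> hom_module R P (regular_module R).
        \<forall>m. f ` Pg m \<subseteq> (if m + n < 0 then {\<zero>\<^bsub>R\<^esub>} else gr (nat (m + n)))}"

text \<open>
  The graded dual \<open>\<Oplus>\<^sub>n Hom(P, R)\<^sub>n\<close> of a graded left \<open>R\<close>-module, a graded right \<open>R\<close>-module via
  \<open>(f a)(x) = f(x) a\<close>.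
\<close>

definition graded_dual ::
    "'r ring \<Rightarrow> (nat \<Rightarrow> 'r set) \<Rightarrow> ('r, 'm) module \<Rightarrow> (int \<Rightarrow> 'm set) \<Rightarrow> ('r, 'm \<Rightarrow> 'r) module" where
  "graded_dual R gr P Pg =
     \<lparr>carrier = {f \<in> hom_module R P (regular_module R).
        \<exists>N F. finite N \<and> (\<forall>n\<in>N. F n \<in> hom_degree R gr P Pg n) \<and>
              (\<forall>x\<in>carrier P. f x = finsum R (\<lambda>n. F n x) N)},
      monoid.mult = undefined, one = undefined,
      ring.zero = (\<lambda>x\<in>carrier P. \<zero>\<^bsub>R\<^esub>),
      add = (\<lambda>f g. \<lambda>x\<in>carrier P. f x \<oplus>\<^bsub>R\<^esub> g x),
      module.smult = (\<lambda>a f. \<lambda>x\<in>carrier P. f x \<otimes>\<^bsub>R\<^esub> a)\<rparr>"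

context
  fixes R :: "'r ring" and gr :: "nat \<Rightarrow> 'r set"
    and P :: "nat \<Rightarrow> 'r small_module" and Pg :: "nat \<Rightarrow> int \<Rightarrow> 'r list set set"
    and \<delta> :: "nat \<Rightarrow> 'r list set \<Rightarrow> 'r list set"
begin

definition ext_cocycles :: "nat \<Rightarrow> ('r list set \<Rightarrow> 'r) set" where
  "ext_cocycles i =
     {f \<in> carrier (graded_dual R gr (P i) (Pg i)). \<forall>x\<in>carrier (P (Suc i)). f (\<delta> i x) = \<zero>\<^bsub>R\<^esub>}"

fun ext_coboundaries :: "nat \<Rightarrow> ('r list set \<Rightarrow> 'r) set" where
  "ext_coboundaries 0 = {\<zero>\<^bsub>graded_dual R gr (P 0) (Pg 0)\<^esub>}"
| "ext_coboundaries (Suc i) =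
     (\<lambda>f. compose (carrier (P (Suc i))) f (\<delta> i)) ` carrier (graded_dual R gr (P i) (Pg i))"

text \<open>
  If \<open>P\<close> with differentials \<open>\<delta>\<close> is a graded projective resolution of \<open>M\<close>, this is the right
  \<open>R\<close>-module \<open>Ext\<^sup>i(M, R)\<close>; up to isomorphism of graded modules it does not depend on the resolution.
\<close>

definition ext_module :: "nat \<Rightarrow> ('r, ('r list set \<Rightarrow> 'r) set) module" where
  "ext_module i =
     quotient_module ((graded_dual R gr (P i) (Pg i))\<lparr>carrier := ext_cocycles i\<rparr>) (ext_coboundaries i)"

definition ext_grading :: "nat \<Rightarrow> int \<Rightarrow> ('r list set \<Rightarrow> 'r) set set" where
  "ext_grading i n =
     (\<lambda>f. ext_coboundaries i +>\<^bsub>graded_dual R gr (P i) (Pg i)\<^esub> f) `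
       (ext_cocycles i \<inter> hom_degree R gr (P i) (Pg i) n)"

end


section \<open>Artin--Schelter regular algebras\<close>

text \<open>\<open>Ap\<close> is the ideal of \<open>R\<close> of elements of positive degree.\<close>

definition trivial_module :: "'r ring \<Rightarrow> 'r set \<Rightarrow> ('r, 'r set) module" where
  "trivial_module R Ap = quotient_module (regular_module R) Ap"

definition AS_ext_condition ::
    "'r ring \<Rightarrow> (nat \<Rightarrow> 'r set) \<Rightarrow> 'r set \<Rightarrow> nat \<Rightarrow> int \<Rightarrow> bool" where
  "AS_ext_condition R gr Ap d l \<longleftrightarrow>
     (\<exists>P Pg \<delta> \<epsilon>.
        graded_projective_resolution R gr
          (trivial_module R Ap) (concentrated_in_degree_zero (trivial_module R Ap)) P Pg \<delta> \<epsilon> \<and>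
        (\<forall>i. i \<noteq> d \<longrightarrow> is_zero_module (ext_module R gr P Pg \<delta> i)) \<and>
        graded_isomorphic (opposite_ring R)
          (ext_module R gr P Pg \<delta> d) (ext_grading R gr P Pg \<delta> d)
          (trivial_module (opposite_ring R) Ap)
          (shift l (concentrated_in_degree_zero (trivial_module (opposite_ring R) Ap))))"

definition AS_regular ::
    "('k::field \<Rightarrow> 'a::ring_1 \<Rightarrow> 'a) \<Rightarrow> (nat \<Rightarrow> 'a set) \<Rightarrow> nat \<Rightarrow> bool" where
  "AS_regular scale gr d \<longleftrightarrow>
     (let A = (ring_of_type_algebra :: 'a ring); Aop = opposite_ring A; Ap = positive_part scale gr in
       connected_graded scale gr \<and>
       inj_dim A (regular_module A) = enat d \<and>
       inj_dim Aop (regular_module Aop) = enat d \<and>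
       (\<exists>l. AS_ext_condition A gr Ap d l \<and> AS_ext_condition Aop gr Ap d l) \<and>
       left_global_dim A = enat d \<and> left_global_dim Aop = enat d \<and>
       gk_dim scale < \<infinity>)"


section \<open>Gradings by a finite group and inner-faithfulness\<close>

definition group_grading ::
    "('k::field \<Rightarrow> 'a::ring_1 \<Rightarrow> 'a) \<Rightarrow> ('g, 'c) monoid_scheme \<Rightarrow> ('g \<Rightarrow> 'a set) \<Rightarrow> bool" where
  "group_grading scale G D \<longleftrightarrow>
     is_direct_sum scale UNIV (carrier G) D \<and>
     (\<forall>g\<in>carrier G. \<forall>h\<in>carrier G. \<forall>x\<in>D g. \<forall>y\<in>D h. x * y \<in> D (g \<otimes>\<^bsub>G\<^esub> h))"

definition compatible_gradings ::
    "('k::field \<Rightarrow> 'a::ring_1 \<Rightarrow> 'a) \<Rightarrow> (nat \<Rightarrow> 'a set) \<Rightarrow>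
     ('g, 'c) monoid_scheme \<Rightarrow> ('g \<Rightarrow> 'a set) \<Rightarrow> bool" where
  "compatible_gradings scale gr G D \<longleftrightarrow>
     (\<forall>n. is_direct_sum scale (gr n) (carrier G) (\<lambda>g. gr n \<inter> D g))"

definition has_degree :: "('g \<Rightarrow> 'a::zero set) \<Rightarrow> 'a \<Rightarrow> 'g \<Rightarrow> bool" where
  "has_degree D x g \<longleftrightarrow> x \<noteq> 0 \<and> x \<in> D g"

text \<open>
  For finite \<open>G\<close>, the dual \<open>(kG)\<^sup>*\<close> of the group algebra as the algebra of functions on \<open>G\<close> (extended
  by \<open>0\<close> off the carrier), a functional being given by its values on the basis \<open>G\<close> of \<open>kG\<close>. The
  element \<open>\<phi>\<^sub>g\<close> is the indicator function of \<open>g\<close>.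
\<close>

definition dual_group_algebra :: "('g, 'c) monoid_scheme \<Rightarrow> ('k::field, 'g \<Rightarrow> 'k) module" where
  "dual_group_algebra G =
     \<lparr>carrier = {f. \<forall>x. x \<notin> carrier G \<longrightarrow> f x = 0},
      monoid.mult = (\<lambda>f h x. f x * h x), one = (\<lambda>x. if x \<in> carrier G then 1 else 0),
      ring.zero = (\<lambda>x. 0), add = (\<lambda>f h x. f x + h x), module.smult = (\<lambda>c f x. c * f x)\<rparr>"

text \<open>
  The coalgebra structure and the antipode. The tensor square of \<open>(kG)\<^sup>*\<close> is the space of functions
  on \<open>G \<times> G\<close>, with \<open>f \<otimes> h\<close> the function \<open>(x, y) \<mapsto> f(x) h(y)\<close>; thus
  \<open>\<Delta>(\<phi>\<^sub>g) = \<Sum>\<^sub>x\<^sub>y\<^sub>=\<^sub>g \<phi>\<^sub>x \<otimes> \<phi>\<^sub>y\<close>.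
\<close>

definition dga_comult :: "('g, 'c) monoid_scheme \<Rightarrow> ('g \<Rightarrow> 'k::field) \<Rightarrow> 'g \<times> 'g \<Rightarrow> 'k" where
  "dga_comult G f = (\<lambda>(x, y). if x \<in> carrier G \<and> y \<in> carrier G then f (x \<otimes>\<^bsub>G\<^esub> y) else 0)"

definition dga_counit :: "('g, 'c) monoid_scheme \<Rightarrow> ('g \<Rightarrow> 'k::field) \<Rightarrow> 'k" where
  "dga_counit G f = f \<one>\<^bsub>G\<^esub>"

definition dga_antipode :: "('g, 'c) monoid_scheme \<Rightarrow> ('g \<Rightarrow> 'k::field) \<Rightarrow> 'g \<Rightarrow> 'k" where
  "dga_antipode G f = (\<lambda>x. if x \<in> carrier G then f (inv\<^bsub>G\<^esub> x) else 0)"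

text \<open>The subspace \<open>I \<otimes> H + H \<otimes> I\<close> of \<open>H \<otimes> H\<close> for \<open>H = (kG)\<^sup>*\<close>.\<close>

definition dga_tensor_ideal ::
    "('g, 'c) monoid_scheme \<Rightarrow> ('g \<Rightarrow> 'k::field) set \<Rightarrow> ('g \<times> 'g \<Rightarrow> 'k) set" where
  "dga_tensor_ideal G I =
     {(\<lambda>(x, y). \<Sum>i<n. f i x * h i y) | (n :: nat) f h.
        \<forall>i<n. f i \<in> I \<and> h i \<in> carrier (dual_group_algebra G) \<or>
              f i \<in> carrier (dual_group_algebra G) \<and> h i \<in> I}"

definition hopf_ideal :: "('g, 'c) monoid_scheme \<Rightarrow> ('g \<Rightarrow> 'k::field) set \<Rightarrow> bool" where
  "hopf_ideal G I \<longleftrightarrow>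
     ideal I (dual_group_algebra G) \<and>
     (\<forall>c. \<forall>f\<in>I. c \<odot>\<^bsub>dual_group_algebra G\<^esub> f \<in> I) \<and>
     dga_comult G ` I \<subseteq> dga_tensor_ideal G I \<and>
     (\<forall>f\<in>I. dga_counit G f = 0) \<and>
     dga_antipode G ` I \<subseteq> I"

text \<open>The action of \<open>(kG)\<^sup>*\<close> for which \<open>\<phi>\<^sub>g\<close> is the projection onto the piece of degree \<open>g\<close>.\<close>

definition dga_action ::
    "('k::field \<Rightarrow> 'a::ring_1 \<Rightarrow> 'a) \<Rightarrow> ('g, 'c) monoid_scheme \<Rightarrow> ('g \<Rightarrow> 'a set) \<Rightarrow>
     ('g \<Rightarrow> 'k) \<Rightarrow> 'a \<Rightarrow> 'a" where
  "dga_action scale G D f x = (\<Sum>g\<in>carrier G. scale (f g) (component (carrier G) D g x))"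

definition inner_faithful ::
    "('k::field \<Rightarrow> 'a::ring_1 \<Rightarrow> 'a) \<Rightarrow> ('g, 'c) monoid_scheme \<Rightarrow> ('g \<Rightarrow> 'a set) \<Rightarrow> bool" where
  "inner_faithful scale G D \<longleftrightarrow>
     (\<forall>I :: ('g \<Rightarrow> 'k) set. hopf_ideal G I \<and> I \<noteq> {\<zero>\<^bsub>(dual_group_algebra G :: ('k, 'g \<Rightarrow> 'k) module)\<^esub>} \<longrightarrow>
        (\<exists>f\<in>I. \<exists>x. dga_action scale G D f x \<noteq> 0))"


section \<open>The algebra \<open>k\<langle>u,v\<rangle>/\<langle>u\<^sup>2 - v\<^sup>2\<rangle>\<close>\<close>

text \<open>Noncommutative polynomials are finitely supported functions on words.\<close>

definition free_algebra :: "('k::field, 'x list \<Rightarrow> 'k) module" where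
  "free_algebra =
     \<lparr>carrier = {p. finite {w. p w \<noteq> 0}},
      monoid.mult = (\<lambda>p q w. \<Sum>i\<le>length w. p (take i w) * q (drop i w)),
      one = (\<lambda>w. if w = [] then 1 else 0),
      ring.zero = (\<lambda>w. 0), add = (\<lambda>p q w. p w + q w), module.smult = (\<lambda>c p w. c * p w)\<rparr>"

definition free_var :: "'x \<Rightarrow> 'x list \<Rightarrow> 'k::field" where
  "free_var x = (\<lambda>w. if w = [x] then 1 else 0)"

datatype letter = L1 | L2

definition relation_ideal :: "(letter list \<Rightarrow> 'k::field) set" where
  "relation_ideal =
     Idl\<^bsub>free_algebra\<^esub>
       {free_var L1 \<otimes>\<^bsub>free_algebra\<^esub> free_var L1 \<ominus>\<^bsub>free_algebra\<^esub> free_var L2 \<otimes>\<^bsub>free_algebra\<^esub> free_var L2}"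

definition uv_algebra :: "('k::field, (letter list \<Rightarrow> 'k) set) module" where
  "uv_algebra = quotient_module free_algebra relation_ideal"

definition u_class :: "(letter list \<Rightarrow> 'k::field) set" where
  "u_class = relation_ideal +>\<^bsub>free_algebra\<^esub> free_var L1"

definition v_class :: "(letter list \<Rightarrow> 'k::field) set" where
  "v_class = relation_ideal +>\<^bsub>free_algebra\<^esub> free_var L2"

definition algebra_iso ::
    "('k, 'b) module \<Rightarrow> ('k::field \<Rightarrow> 'a::ring_1 \<Rightarrow> 'a) \<Rightarrow> ('b \<Rightarrow> 'a) set" where
  "algebra_iso B scale =
     {\<phi> \<in> ring_iso B (ring_of_type_algebra :: 'a ring).
        \<forall>c. \<forall>x\<in>carrier B. \<phi> (c \<odot>\<^bsub>B\<^esub> x) = scale c (\<phi> x)}"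


section \<open>Group presentations\<close>

text \<open>Group words: \<open>(x, True)\<close> stands for the generator \<open>x\<close> and \<open>(x, False)\<close> for its inverse.\<close>

type_synonym 'x word = "('x \<times> bool) list"

inductive word_equiv :: "('x word \<times> 'x word) set \<Rightarrow> 'x word \<Rightarrow> 'x word \<Rightarrow> bool"
  for \<R> :: "('x word \<times> 'x word) set" where
  refl: "word_equiv \<R> w w"
| sym: "word_equiv \<R> v w \<Longrightarrow> word_equiv \<R> w v"
| trans: "word_equiv \<R> u v \<Longrightarrow> word_equiv \<R> v w \<Longrightarrow> word_equiv \<R> u w"
| cancel: "word_equiv \<R> (p @ [(x, e), (x, \<not> e)] @ q) (p @ q)"
| relation: "(r, s) \<in> \<R> \<Longrightarrow> word_equiv \<R> (p @ r @ q) (p @ s @ q)"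

definition word_class :: "('x word \<times> 'x word) set \<Rightarrow> 'x word \<Rightarrow> 'x word set" where
  "word_class \<R> w = {v. word_equiv \<R> w v}"

definition presented_group :: "('x word \<times> 'x word) set \<Rightarrow> 'x word set monoid" where
  "presented_group \<R> =
     \<lparr>carrier = range (word_class \<R>),
      monoid.mult = (\<lambda>C C'. \<Union>x\<in>C. \<Union>y\<in>C'. word_class \<R> (x @ y)), one = word_class \<R> []\<rparr>"

definition has_presentation ::
    "('g, 'c) monoid_scheme \<Rightarrow> ('x \<Rightarrow> 'g) \<Rightarrow> ('x word \<times> 'x word) set \<Rightarrow> bool" where
  "has_presentation G gens \<R> \<longleftrightarrow>
     (\<exists>\<psi>\<in>iso (presented_group \<R>) G. \<forall>x. \<psi> (word_class \<R> [(x, True)]) = gens x)"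

end

theory Submission
  imports Defs "HOL-Library.Poly_Mapping"
begin

text \<open>
  Let \<open>V\<close> be the space of elements of degree one of \<open>A\<close>, choose a basis \<open>B\<close> of \<open>V\<close> and let \<open>K\<close> be the
  kernel of \<open>A \<otimes> V \<rightarrow> A\<close>, the left module of relations. The proof first shows that \<open>A\<close> is
  \<open>k\<langle>x, y\<rangle>/\<langle>p x + q y\<rangle>\<close> where \<open>p\<close> and \<open>q\<close> are again a basis of \<open>V\<close>, and then looks at the group
  degrees of the terms of the relation.

  \<^bold>\<open>One nondegenerate relation.\<close> As \<open>A\<close> has global dimension two, every map from \<open>K\<close> to the trivial
  module lifts to \<open>A\<close> (\<open>lift_relation_functional\<close>). Hence an element of minimal degree of \<open>K\<close> splits off
  a free summand, and a second such summand would make \<open>Ext\<^sup>2(k, A)\<close> at least two-dimensional, since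
  the maps \<open>K \<rightarrow> A\<close> that are zero in \<open>Ext\<^sup>2\<close> extend to \<open>A \<otimes> V\<close> and so take values in \<open>A\<^sub>+\<close>. So \<open>K\<close> is
  free on one relation \<open>r = \<Sum> r\<^sub>b \<otimes> b\<close> (\<open>relations_cyclic\<close>). Since \<open>A\<^sub>+\<close> annihilates \<open>Ext\<^sup>2\<close>, each element
  of \<open>V\<close> has the form \<open>\<Sum> r\<^sub>b g\<^sub>b\<close>; therefore the \<open>r\<^sub>b\<close> have degree one and span \<open>V\<close>
  (\<open>relation_nondegenerate\<close>). The resolutions in the hypotheses are arbitrary; they are compared by
  hand with \<open>A \<otimes> V \<rightarrow> A \<rightarrow> k\<close>, whose terms are free.

  \<^bold>\<open>Two generators.\<close> Nondegeneracy implies that multiplication by a nonzero element of \<open>V\<close> on the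
  right is injective (\<open>right_regular\<close>). If there were no relation, or three generators, two
  of the generators would generate a free algebra, contradicting finite Gelfand-Kirillov dimension;
  with fewer than two generators \<open>A\<close> would be commutative (\<open>quadratic_relation\<close>).

  \<^bold>\<open>Group degrees.\<close> The basis can be chosen homogeneous for \<open>G\<close>, say \<open>x\<close> and \<open>y\<close> of degrees \<open>a\<close> and \<open>b\<close>.
  The functions on \<open>G\<close> that vanish on the subgroup generated by \<open>a\<close> and \<open>b\<close> form a Hopf ideal that
  annihilates \<open>A\<close>, so \<open>a\<close> and \<open>b\<close> generate \<open>G\<close> (\<open>inner_faithful_support\<close>) and do not commute. Hence
  \<open>a b\<close> and \<open>b a\<close> differ from each other and from \<open>a\<^sup>2\<close> and \<open>b\<^sup>2\<close>, and the homogeneous components of the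
  relation in these degrees are multiples of \<open>x y\<close> and \<open>y x\<close>, which are nonzero by regularity. So the relation is
  \<open>p\<^sub>1 x\<^sup>2 + q\<^sub>2 y\<^sup>2 = 0\<close>, nondegeneracy makes both coefficients nonzero, \<open>a\<^sup>2 = b\<^sup>2\<close>, and rescaling \<open>y\<close> gives
  \<open>u\<^sup>2 = v\<^sup>2\<close>. That this relation defines \<open>A\<close> is \<open>uv_algebra_iso\<close>.
\<close>

section \<open>Modules with carriers in arbitrary types\<close>

abbreviation type_ring :: "'a::ring_1 ring" where
  "type_ring \<equiv> ring_of_type_algebra"

lemma type_ring_simps [simp]:
  "carrier (type_ring :: 'a::ring_1 ring) = UNIV"
  "x \<otimes>\<^bsub>(type_ring :: 'a ring)\<^esub> y = x * y"
  "\<one>\<^bsub>(type_ring :: 'a ring)\<^esub> = 1"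
  "\<zero>\<^bsub>(type_ring :: 'a ring)\<^esub> = 0"
  "x \<oplus>\<^bsub>(type_ring :: 'a ring)\<^esub> y = x + y"
  by (simp_all add: ring_of_type_algebra_def)

lemma ring_type_ring: "ring (type_ring :: 'a::ring_1 ring)"
proof (rule ringI)
  show "abelian_group (type_ring :: 'a ring)"
    by (rule abelian_groupI) (auto simp: add.assoc add.commute intro: exI[of _ "- x" for x] 
        left_minus)
  show "Group.monoid (type_ring :: 'a ring)"
    by (rule Group.monoid.intro) (auto simp: mult.assoc)
qed (auto simp: distrib_left distrib_right)

text \<open>
  Modules whose carrier is a subset of a type of class \<^class>\<open>ab_group_add\<close>. The algebra itself, its ideals and
  the free modules over it have this form, so that sums in them are ordinary sums.
\<close>

definition type_module :: "'m::ab_group_add set \<Rightarrow> ('r \<Rightarrow> 'm \<Rightarrow> 'm) \<Rightarrow> ('r, 'm) module" where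
  "type_module S act =
     \<lparr>carrier = S, monoid.mult = undefined, one = undefined, ring.zero = 0, add = (+),
      module.smult = act\<rparr>"

lemma type_module_simps [simp]:
  "carrier (type_module S act) = S"
  "\<zero>\<^bsub>type_module S act\<^esub> = 0"
  "x \<oplus>\<^bsub>type_module S act\<^esub> y = x + y"
  "a \<odot>\<^bsub>type_module S act\<^esub> x = act a x"
  by (simp_all add: type_module_def)

locale type_action =
  fixes S :: "'m::ab_group_add set" and act :: "'r::ring_1 \<Rightarrow> 'm \<Rightarrow> 'm"
  assumes zero_mem: "0 \<in> S" and add_mem: "\<lbrakk>x \<in> S; y \<in> S\<rbrakk> \<Longrightarrow> x + y \<in> S"
    and minus_mem: "x \<in> S \<Longrightarrow> - x \<in> S"
    and act_mem: "x \<in> S \<Longrightarrow> act a x \<in> S"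
    and act_add_left: "x \<in> S \<Longrightarrow> act (a + b) x = act a x + act b x"
    and act_add_right: "\<lbrakk>x \<in> S; y \<in> S\<rbrakk> \<Longrightarrow> act a (x + y) = act a x + act a y"
    and act_mult: "x \<in> S \<Longrightarrow> act (a * b) x = act a (act b x)"
    and act_1: "x \<in> S \<Longrightarrow> act 1 x = x"
begin

lemma left_module_type_module: "left_module type_ring (type_module S act)"
proof -
  have "abelian_group (type_module S act)"
    by (rule abelian_groupI)
      (auto simp: add.assoc add.commute zero_mem add_mem 
        intro: bexI[of _ "- x" for x] minus_mem left_minus)
  then show ?thesis
    unfolding left_module_def left_module_axioms_def
    by (auto simp: ring_type_ring act_mem act_add_left act_add_right act_mult act_1)
qed

end

text \<open>Linear maps into a group given by a type; unlike in \<^const>\<open>hom_module\<close>, the values off the carrier are arbitrary.\<close>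

definition linear_map ::
    "('r, 'p) module \<Rightarrow> ('r \<Rightarrow> 'm \<Rightarrow> 'm) \<Rightarrow> ('p \<Rightarrow> 'm::ab_group_add) \<Rightarrow> bool" where
  "linear_map P act h \<longleftrightarrow>
     (\<forall>x\<in>carrier P. \<forall>y\<in>carrier P. h (x \<oplus>\<^bsub>P\<^esub> y) = h x + h y) \<and>
     (\<forall>a. \<forall>x\<in>carrier P. h (a \<odot>\<^bsub>P\<^esub> x) = act a (h x))"

lemma linear_mapD:
  assumes "linear_map P act h"
  shows "\<lbrakk>x \<in> carrier P; y \<in> carrier P\<rbrakk> \<Longrightarrow> h (x \<oplus>\<^bsub>P\<^esub> y) = h x + h y"
    and "x \<in> carrier P \<Longrightarrow> h (a \<odot>\<^bsub>P\<^esub> x) = act a (h x)"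
  using assms by (auto simp: linear_map_def)

lemma hom_module_into_type_module:
  "h \<in> hom_module type_ring P (type_module S act) \<longleftrightarrow>
     h \<in> carrier P \<rightarrow>\<^sub>E S \<and> linear_map P act h"
  by (auto simp: hom_module_def linear_map_def)

lemma linear_map_zero:
  assumes "abelian_group P" "linear_map P act h"
  shows "h \<zero>\<^bsub>P\<^esub> = 0"
proof -
  interpret abelian_group P by fact
  have "h (\<zero>\<^bsub>P\<^esub> \<oplus>\<^bsub>P\<^esub> \<zero>\<^bsub>P\<^esub>) = h \<zero>\<^bsub>P\<^esub> + h \<zero>\<^bsub>P\<^esub>"
    using linear_mapD(1)[OF assms(2) zero_closed zero_closed] .
  then show ?thesis by simp
qed

lemma linear_map_finsum:
  assumes "abelian_group P" "linear_map P act h" "finite I" "\<And>i. i \<in> I \<Longrightarrow> f i \<in> carrier P"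
  shows "h (finsum P f I) = (\<Sum>i\<in>I. h (f i))"
proof -
  interpret abelian_group P by fact
  show ?thesis using assms(3,4)
    by (induction I rule: finite_induct)
      (auto simp: linear_map_zero[OF assms(1,2)] linear_mapD[OF assms(2)] finsum_insert finsum_closed)
qed

lemma hom_moduleD:
  assumes "f \<in> hom_module R M N"
  shows "x \<in> carrier M \<Longrightarrow> f x \<in> carrier N"
    "\<lbrakk>x \<in> carrier M; y \<in> carrier M\<rbrakk> \<Longrightarrow> f (x \<oplus>\<^bsub>M\<^esub> y) = f x \<oplus>\<^bsub>N\<^esub> f y"
    "\<lbrakk>a \<in> carrier R; x \<in> carrier M\<rbrakk> \<Longrightarrow> f (a \<odot>\<^bsub>M\<^esub> x) = a \<odot>\<^bsub>N\<^esub> f x"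
  using assms by (auto simp: hom_module_def)

lemma hom_module_zero:
  assumes "abelian_group M" "abelian_group N" "f \<in> hom_module R M N"
  shows "f \<zero>\<^bsub>M\<^esub> = \<zero>\<^bsub>N\<^esub>"
proof -
  interpret M: abelian_group M by fact
  interpret N: abelian_group N by fact
  have "f (\<zero>\<^bsub>M\<^esub> \<oplus>\<^bsub>M\<^esub> \<zero>\<^bsub>M\<^esub>) = f \<zero>\<^bsub>M\<^esub> \<oplus>\<^bsub>N\<^esub> f \<zero>\<^bsub>M\<^esub>"
    using hom_moduleD(2)[OF assms(3) M.zero_closed M.zero_closed] .
  moreover have "f \<zero>\<^bsub>M\<^esub> \<in> carrier N" using hom_moduleD(1)[OF assms(3)] by simp
  ultimately show ?thesis by (metis M.r_zero M.zero_closed N.add.l_cancel_one)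
qed

lemma hom_module_finsum:
  assumes "abelian_group M" "abelian_group N" "f \<in> hom_module R M N" "finite I"
    "\<And>i. i \<in> I \<Longrightarrow> g i \<in> carrier M"
  shows "f (finsum M g I) = finsum N (\<lambda>i. f (g i)) I"
proof -
  interpret M: abelian_group M by fact
  interpret N: abelian_group N by fact
  show ?thesis using assms(4,5)
    by (induction I rule: finite_induct)
      (auto simp: hom_module_zero[OF assms(1-3)] hom_moduleD[OF assms(3)]
        M.finsum_insert M.finsum_closed N.finsum_insert Pi_iff)
qed

lemma regular_module_simps [simp]:
  "carrier (regular_module R) = carrier R" "\<zero>\<^bsub>regular_module R\<^esub> = \<zero>\<^bsub>R\<^esub>"
  "x \<oplus>\<^bsub>regular_module R\<^esub> y = x \<oplus>\<^bsub>R\<^esub> y" "a \<odot>\<^bsub>regular_module R\<^esub> x = a \<otimes>\<^bsub>R\<^esub> x"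
  by (simp_all add: regular_module_def)

lemma opposite_ring_simps [simp]:
  "carrier (opposite_ring R) = carrier R" "\<zero>\<^bsub>opposite_ring R\<^esub> = \<zero>\<^bsub>R\<^esub>"
  "x \<oplus>\<^bsub>opposite_ring R\<^esub> y = x \<oplus>\<^bsub>R\<^esub> y" "a \<otimes>\<^bsub>opposite_ring R\<^esub> x = x \<otimes>\<^bsub>R\<^esub> a"
  by (simp_all add: opposite_ring_def)

definition transport_module :: "('m \<Rightarrow> 'n) \<Rightarrow> ('r, 'm) module \<Rightarrow> ('r, 'n) module" where
  "transport_module e M = (let dec = inv_into (carrier M) e in
     \<lparr>carrier = e ` carrier M, monoid.mult = undefined, one = undefined, ring.zero = e \<zero>\<^bsub>M\<^esub>,
      add = (\<lambda>x y. e (dec x \<oplus>\<^bsub>M\<^esub> dec y)), module.smult = (\<lambda>a x. e (a \<odot>\<^bsub>M\<^esub> dec x))\<rparr>)"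

lemma transport_module_simps:
  assumes "inj_on e (carrier M)"
  shows "carrier (transport_module e M) = e ` carrier M"
    "\<zero>\<^bsub>transport_module e M\<^esub> = e \<zero>\<^bsub>M\<^esub>"
    "\<lbrakk>x \<in> carrier M; y \<in> carrier M\<rbrakk> \<Longrightarrow> e x \<oplus>\<^bsub>transport_module e M\<^esub> e y = e (x \<oplus>\<^bsub>M\<^esub> y)"
    "x \<in> carrier M \<Longrightarrow> a \<odot>\<^bsub>transport_module e M\<^esub> e x = e (a \<odot>\<^bsub>M\<^esub> x)"
  using assms by (simp_all add: transport_module_def Let_def)

lemma left_module_transport:
  assumes M: "left_module R M" and inj: "inj_on e (carrier M)"
  shows "left_module R (transport_module e M)"
proof -
  interpret left_module R M by fact
  note [simp] = transport_module_simps[OF inj]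
  have "abelian_group (transport_module e M)"
  proof (rule abelian_groupI)
    show "\<exists>y\<in>carrier (transport_module e M). y \<oplus>\<^bsub>transport_module e M\<^esub> x = \<zero>\<^bsub>transport_module e M\<^esub>"
      if "x \<in> carrier (transport_module e M)" for x
    proof -
      from that obtain z where "x = e z" "z \<in> carrier M" by auto
      then show ?thesis by (intro bexI[of _ "e (\<ominus>\<^bsub>M\<^esub> z)"]) (auto simp: M.l_neg)
    qed
  qed (auto simp: M.a_ac)
  then show ?thesis
    unfolding left_module_def left_module_axioms_def
    using act_closed act_l_distr act_r_distr act_assoc act_one
    by (auto simp: R.ring_axioms)
qed

text \<open>
  Projectivity is stated for modules in one fixed type only. Modules in any other type can be
  transported along an injection into it.
\<close>

lemma projective_lift:
  fixes M :: "('r, 'm) module" and N :: "('r, 'n) module"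
    and eM :: "'m \<Rightarrow> 'r list set" and eN :: "'n \<Rightarrow> 'r list set"
  assumes P: "projective_module R P" and M: "left_module R M" and N: "left_module R N"
    and eM: "inj_on eM (carrier M)" and eN: "inj_on eN (carrier N)"
    and g: "g \<in> hom_module R M N" and f: "f \<in> hom_module R P N"
    and surj: "g ` carrier M = carrier N"
  obtains h where "h \<in> hom_module R P M" "\<And>x. x \<in> carrier P \<Longrightarrow> g (h x) = f x"
proof -
  interpret P: left_module R P using P by (simp add: projective_module_def)
  interpret M: left_module R M by fact
  interpret N: left_module R N by fact
  let ?TM = "transport_module eM M" and ?TN = "transport_module eN N"
  let ?dM = "inv_into (carrier M) eM"
  note [simp] = transport_module_simps[OF eM] transport_module_simps[OF eN]
    hom_moduleD[OF g] hom_moduleD[OF f]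
  let ?g = "\<lambda>y\<in>carrier ?TM. eN (g (?dM y))" and ?f = "\<lambda>x\<in>carrier P. eN (f x)"
  have "?g \<in> hom_module R ?TM ?TN"
    using eM by (auto simp: hom_module_def M.act_closed)
  note gT = this
  have fT: "?f \<in> hom_module R P ?TN"
    by (auto simp: hom_module_def P.act_closed)
  have "?g ` carrier ?TM = (\<lambda>x. eN (g x)) ` carrier M"
    unfolding transport_module_simps(1)[OF eM] image_image
    by (rule image_cong) (simp_all add: eM)
  then have surjT: "?g ` carrier ?TM = carrier ?TN"
    by (metis image_image surj transport_module_simps(1)[OF eN])
  from P[unfolded projective_module_def, THEN conjunct2, rule_format,
      OF left_module_transport[OF M eM] left_module_transport[OF N eN] gT fT surjT]
  obtain h where h: "h \<in> hom_module R P ?TM" "\<And>x. x \<in> carrier P \<Longrightarrow> ?g (h x) = ?f x"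
    by blast
  have h_in: "h x \<in> eM ` carrier M" if "x \<in> carrier P" for x
    using hom_moduleD(1)[OF h(1) that] by simp
  define h' where "h' = (\<lambda>x\<in>carrier P. ?dM (h x))"
  have h': "h' x \<in> carrier M" "h x = eM (h' x)" if "x \<in> carrier P" for x
    using inv_into_into[OF h_in[OF that]] f_inv_into_f[OF h_in[OF that]] that
    by (simp_all add: h'_def)
  have h'_eq: "h' x = y" if "x \<in> carrier P" "h x = eM y" "y \<in> carrier M" for x y
    using that h'[OF that(1)] by (intro inj_onD[OF eM]) simp_all
  have "h' \<in> hom_module R P M"
  proof -
    have "h' (x \<oplus>\<^bsub>P\<^esub> y) = h' x \<oplus>\<^bsub>M\<^esub> h' y" if "x \<in> carrier P" "y \<in> carrier P" for x y
      by (rule h'_eq) (simp_all add: that hom_moduleD(2)[OF h(1) that]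
          h'(1) h'(2)[OF that(1)] h'(2)[OF that(2)])
    moreover have "h' (a \<odot>\<^bsub>P\<^esub> x) = a \<odot>\<^bsub>M\<^esub> h' x" if "a \<in> carrier R" "x \<in> carrier P" for a x
      by (rule h'_eq) (simp_all add: that hom_moduleD(3)[OF h(1) that]
          h'(1) h'(2)[OF that(2)] P.act_closed M.act_closed)
    moreover have "h' \<in> carrier P \<rightarrow>\<^sub>E carrier M"
      by (rule PiE_I) (use h'(1) in simp, simp add: h'_def)
    ultimately show ?thesis by (auto simp: hom_module_def)
  qed
  moreover have "g (h' x) = f x" if "x \<in> carrier P" for x
  proof -
    have "eN (g (h' x)) = eN (f x)"
      using h(2)[OF that] that by (simp add: h'[OF that] eM)
    then show ?thesis
      by (rule inj_onD[OF eN]) (simp_all add: h'(1)[OF that] that)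
  qed
  ultimately show thesis by (rule that)
qed

text \<open>
  The form in which projectivity is used: the modules \<open>S\<close> and \<open>T\<close> live in types that embed into sets of
  lists over the ring, and the lift is a plain function.
\<close>

lemma projective_lift_type:
  fixes eM :: "'m::ab_group_add \<Rightarrow> 'r::ring_1 list set" and eN :: "'n::ab_group_add \<Rightarrow> 'r list set"
    and P :: "'r small_module" and actM :: "'r \<Rightarrow> 'm \<Rightarrow> 'm" and actN :: "'r \<Rightarrow> 'n \<Rightarrow> 'n"
  assumes P: "projective_module type_ring P" and M: "type_action S actM" and N: "type_action T actN"
    and "inj eM" and "inj eN"
    and g: "\<And>x. x \<in> S \<Longrightarrow> g x \<in> T" "\<And>x y. x \<in> S \<Longrightarrow> y \<in> S \<Longrightarrow> g (x + y) = g x + g y"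
      "\<And>a x. x \<in> S \<Longrightarrow> g (actM a x) = actN a (g x)" "\<And>y. y \<in> T \<Longrightarrow> \<exists>x\<in>S. g x = y"
    and f: "linear_map P actN f" "\<And>x. x \<in> carrier P \<Longrightarrow> f x \<in> T"
  obtains h where "linear_map P actM h" "\<And>x. x \<in> carrier P \<Longrightarrow> h x \<in> S"
    "\<And>x. x \<in> carrier P \<Longrightarrow> g (h x) = f x"
proof -
  interpret P: left_module type_ring P using P by (simp add: projective_module_def)
  interpret M: type_action S actM by fact
  interpret N: type_action T actN by fact
  let ?M = "type_module S actM" and ?N = "type_module T actN"
  have gh: "restrict g S \<in> hom_module type_ring ?M ?N"
    using g by (auto simp: hom_module_def M.add_mem M.act_mem)
  have fh: "restrict f (carrier P) \<in> hom_module type_ring P ?N"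
    using f by (auto simp: hom_module_def linear_map_def P.act_closed)
  have "restrict g S ` carrier ?M = carrier ?N"
    using g(1,4) by force
  then obtain h where h: "h \<in> hom_module type_ring P ?M"
      "\<And>x. x \<in> carrier P \<Longrightarrow> restrict g S (h x) = restrict f (carrier P) x"
    using projective_lift[OF P M.left_module_type_module N.left_module_type_module _ _ gh fh, where eM = eM and eN = eN]
      assms(4,5) by (metis inj_on_subset subset_UNIV)
  have "linear_map P actM h" and hS: "\<And>x. x \<in> carrier P \<Longrightarrow> h x \<in> S"
    using h(1) unfolding hom_module_into_type_module by auto
  with h(2) show thesis by (intro that) auto
qed

section \<open>Direct sums and connected graded algebras\<close>

lemma decomposes_as_superset:
  assumes "decomposes_as I D x f" "finite N" "{i. f i \<noteq> 0} \<subseteq> N"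
  shows "x = sum f N"
  using assms by (auto simp: decomposes_as_def intro: sum.mono_neutral_left)

text \<open>
  The decompositions by degree and by group degree are instances of this.
\<close>

locale direct_sum = vector_space scale
  for scale :: "'k::field \<Rightarrow> 'a::ab_group_add \<Rightarrow> 'a" +
  fixes I :: "'i set" and D :: "'i \<Rightarrow> 'a set"
  assumes is_direct_sum: "is_direct_sum scale UNIV I D"
begin

abbreviation "part \<equiv> component I D"

lemma subspace_D: "i \<in> I \<Longrightarrow> subspace (D i)"
  using is_direct_sum by (auto simp: is_direct_sum_def)

lemma decomposes_part: "decomposes_as I D x (\<lambda>i. part i x)"
proof -
  have "\<exists>!f. decomposes_as I D x f" using is_direct_sum by (auto simp: is_direct_sum_def)
  from theI'[OF this] show ?thesis by (simp add: component_def)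
qed

lemma part_in: "i \<in> I \<Longrightarrow> part i x \<in> D i"
  and part_outside: "i \<notin> I \<Longrightarrow> part i x = 0"
  and finite_part: "finite {i. part i x \<noteq> 0}"
  using decomposes_part[of x] by (auto simp: decomposes_as_def)

lemma sum_part: "finite N \<Longrightarrow> {i. part i x \<noteq> 0} \<subseteq> N \<Longrightarrow> (\<Sum>i\<in>N. part i x) = x"
  using decomposes_as_superset[OF decomposes_part] by metis

lemma part_eqI:
  assumes "finite N" "\<And>i. i \<in> I \<Longrightarrow> f i \<in> D i" "\<And>i. i \<notin> I \<Longrightarrow> f i = 0" "\<And>i. i \<notin> N \<Longrightarrow> f i = 0"
    "x = sum f N"
  shows "part i x = f i"
proof -
  have sub: "{i. f i \<noteq> 0} \<subseteq> N" using assms(4) by auto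
  then have "sum f N = (\<Sum>i | f i \<noteq> 0. f i)"
    by (intro sum.mono_neutral_right) (auto simp: assms(1))
  then have "decomposes_as I D x f"
    using assms sub finite_subset[OF sub] by (auto simp: decomposes_as_def)
  moreover have "\<exists>!f. decomposes_as I D x f"
    using is_direct_sum by (auto simp: is_direct_sum_def)
  ultimately have "f = (\<lambda>i. part i x)" using decomposes_part[of x] by blast
  then show ?thesis by simp
qed

lemma part_homogeneous: "j \<in> I \<Longrightarrow> x \<in> D j \<Longrightarrow> part i x = (if i = j then x else 0)"
  by (rule part_eqI[of "{j}"]) (auto simp: subspace_0[OF subspace_D])

lemma part_add: "part i (x + y) = part i x + part i y"
proof (rule part_eqI)
  let ?N = "{i. part i x \<noteq> 0} \<union> {i. part i y \<noteq> 0}"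
  show fin: "finite ?N" by (simp add: finite_part)
  show "x + y = (\<Sum>i\<in>?N. part i x + part i y)"
    using sum_part[OF fin, of x] sum_part[OF fin, of y] by (simp add: sum.distrib)
qed (auto simp: part_in part_outside subspace_add[OF subspace_D])

lemma part_scale: "part i (scale c x) = scale c (part i x)"
proof (rule part_eqI)
  let ?N = "{i. part i x \<noteq> 0}"
  show fin: "finite ?N" by (rule finite_part)
  show "scale c x = (\<Sum>i\<in>?N. scale c (part i x))"
    using sum_part[OF fin, of x] by (simp add: scale_sum_right[symmetric])
qed (auto simp: part_in part_outside subspace_scale[OF subspace_D])

lemma part_zero: "part i 0 = 0"
  using part_scale[of i 0 0] by simp

end

locale connected_graded_algebra =
  fixes scale :: "'k::field \<Rightarrow> 'a::ring_1 \<Rightarrow> 'a" and gr :: "nat \<Rightarrow> 'a set"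
  assumes connected_graded: "connected_graded scale gr"

sublocale connected_graded_algebra \<subseteq> k_algebra scale
  using connected_graded by (simp add: connected_graded_def)

sublocale connected_graded_algebra \<subseteq> grading: direct_sum scale UNIV gr
  by unfold_locales (use connected_graded in \<open>simp add: connected_graded_def\<close>)

context connected_graded_algebra
begin

lemma gr_mult: "\<lbrakk>x \<in> gr m; y \<in> gr n\<rbrakk> \<Longrightarrow> x * y \<in> gr (m + n)"
  using connected_graded by (auto simp: connected_graded_def)

lemma gr_0: "gr 0 = range (\<lambda>c. scale c 1)"
  using connected_graded by (auto simp: connected_graded_def)

lemma gr_subspace: "subspace (gr n)"
  using connected_graded by (auto simp: connected_graded_def is_direct_sum_def)

lemma one_gr: "1 \<in> gr 0"
  unfolding gr_0 by (rule image_eqI[of _ _ 1]) auto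

lemma gr_0_commute: "c \<in> gr 0 \<Longrightarrow> c * x = x * c"
  unfolding gr_0 by (auto simp: scale_mult_left scale_mult_right)

definition proj :: "nat \<Rightarrow> 'a \<Rightarrow> 'a" where
  "proj n x = component UNIV gr n x"

lemma proj_in_gr: "proj n x \<in> gr n"
  and finite_proj: "finite {n. proj n x \<noteq> 0}"
  and sum_proj: "(\<Sum>n | proj n x \<noteq> 0. proj n x) = x"
  and proj_add: "proj n (x + y) = proj n x + proj n y"
  and proj_0 [simp]: "proj n 0 = 0"
  by (simp_all add: proj_def grading.part_in grading.finite_part grading.sum_part
      grading.part_add grading.part_zero)

lemma proj_eqI:
  assumes "finite N" "\<And>n. f n \<in> gr n" "\<And>n. n \<notin> N \<Longrightarrow> f n = 0" "x = sum f N"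
  shows "proj n x = f n"
  unfolding proj_def by (rule grading.part_eqI[of N]) (use assms in simp_all)

lemma proj_gr: "x \<in> gr m \<Longrightarrow> proj n x = (if n = m then x else 0)"
  unfolding proj_def by (rule grading.part_homogeneous) simp_all

lemma proj_uminus: "proj n (- x) = - proj n x"
  using proj_add[of n x "- x"] by (simp add: eq_neg_iff_add_eq_0 add.commute)

lemma proj_diff: "proj n (x - y) = proj n x - proj n y"
  using proj_add[of n x "- y"] by (simp add: proj_uminus)

lemma proj_sum: "proj n (sum f I) = (\<Sum>i\<in>I. proj n (f i))"
  by (induction I rule: infinite_finite_induct) (auto simp: proj_add)

lemma proj_mult_left:
  assumes "a \<in> gr j"
  shows "proj n (a * x) = (if j \<le> n then a * proj (n - j) x else 0)"
proof (rule proj_eqI)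
  let ?N = "{n. proj n x \<noteq> 0}" and ?f = "\<lambda>n. if j \<le> n then a * proj (n - j) x else 0"
  show "finite ((+) j ` ?N)" by (simp add: finite_proj)
  show "?f n \<in> gr n" for n
    using gr_mult[OF assms proj_in_gr[of "n - j" x]] by (auto simp: subspace_0[OF gr_subspace])
  show "?f n = 0" if "n \<notin> (+) j ` ?N" for n
    using that by (cases "j \<le> n") (auto simp: image_iff, metis le_add_diff_inverse mult_zero_right)
  have "a * x = a * (\<Sum>n\<in>?N. proj n x)" by (simp only: sum_proj)
  also have "\<dots> = (\<Sum>n\<in>?N. a * proj n x)" by (simp add: sum_distrib_left)
  also have "\<dots> = sum ?f ((+) j ` ?N)"
    by (subst sum.reindex) (auto simp: inj_on_def)
  finally show "a * x = sum ?f ((+) j ` ?N)" .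
qed

lemma proj_mult_right:
  assumes "a \<in> gr j"
  shows "proj n (x * a) = (if j \<le> n then proj (n - j) x * a else 0)"
proof (rule proj_eqI)
  let ?N = "{n. proj n x \<noteq> 0}" and ?f = "\<lambda>n. if j \<le> n then proj (n - j) x * a else 0"
  show "finite ((+) j ` ?N)" by (simp add: finite_proj)
  show "?f n \<in> gr n" for n
    using gr_mult[OF proj_in_gr[of "n - j" x] assms] by (auto simp: subspace_0[OF gr_subspace])
  show "?f n = 0" if "n \<notin> (+) j ` ?N" for n
    using that by (cases "j \<le> n") (auto simp: image_iff, metis le_add_diff_inverse mult_zero_left)
  have "x * a = (\<Sum>n\<in>?N. proj n x) * a" by (simp only: sum_proj)
  also have "\<dots> = (\<Sum>n\<in>?N. proj n x * a)" by (simp add: sum_distrib_right)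
  also have "\<dots> = sum ?f ((+) j ` ?N)"
    by (subst sum.reindex) (auto simp: inj_on_def)
  finally show "x * a = sum ?f ((+) j ` ?N)" .
qed

text \<open>
  Additive properties need to be checked on homogeneous elements only; most multiplicative
  identities below are proved by this, because the projections are easy to compute on products
  with a homogeneous factor.
\<close>

lemma graded_induct [consumes 0, case_names add homogeneous]:
  assumes "\<And>x y. P x \<Longrightarrow> P y \<Longrightarrow> P (x + y)" "\<And>n x. x \<in> gr n \<Longrightarrow> P x"
  shows "P x"
proof -
  have "P (\<Sum>n\<in>N. proj n x)" if "finite N" for N
    using that
    by (induction N rule: finite_induct)
      (auto intro: assms proj_in_gr assms(2)[OF subspace_0[OF gr_subspace]])
  from this[OF finite_proj[of x]] show ?thesis by (simp add: sum_proj)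
qed

lemma proj_0_mult: "proj 0 (x * y) = proj 0 x * proj 0 y"
proof (induction x rule: graded_induct)
  case (homogeneous n x)
  then show ?case by (auto simp: proj_mult_left proj_gr)
qed (auto simp: distrib_right proj_add)

lemma positive_part_eq: "positive_part scale gr = {x. proj 0 x = 0}"
proof (intro equalityI subsetI)
  fix x assume "x \<in> positive_part scale gr"
  then have "x \<in> span (\<Union>n\<in>{1..}. gr n)" by (simp add: positive_part_def)
  moreover have "subspace {x. proj 0 x = 0}"
  proof (rule subspaceI)
    fix c x assume "x \<in> {x. proj 0 x = 0}"
    moreover have "scale c x = scale c 1 * x" by (simp add: scale_mult_left)
    ultimately show "scale c x \<in> {x. proj 0 x = 0}" by (simp add: proj_0_mult)
  qed (auto simp: proj_add)
  moreover have "(\<Union>n\<in>{1..}. gr n) \<subseteq> {x. proj 0 x = 0}" by (auto simp: proj_gr)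
  ultimately show "x \<in> {x. proj 0 x = 0}" using span_minimal by blast
next
  fix x assume "x \<in> {x. proj 0 x = 0}"
  then have "(\<Sum>n | proj n x \<noteq> 0. proj n x) \<in> positive_part scale gr"
    unfolding positive_part_def
    by (intro span_sum span_base) (metis (mono_tags, lifting) UN_I atLeast_iff less_one
      mem_Collect_eq not_le proj_in_gr)
  then show "x \<in> positive_part scale gr" by (simp add: sum_proj)
qed

definition residue_class :: "'a \<Rightarrow> 'a set" where
  "residue_class l = {y. proj 0 y = proj 0 l}"

text \<open>
  The trivial left and right modules are \<open>A/A\<^sub>+\<close>, with elements the fibres of the augmentation \<open>proj 0\<close>.
\<close>

lemma trivial_module_simps:
  assumes R: "R = type_ring \<or> R = opposite_ring type_ring"
  defines "T \<equiv> trivial_module R (positive_part scale gr)"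
  shows "carrier T = range residue_class" "\<zero>\<^bsub>T\<^esub> = residue_class 0"
    "residue_class l \<oplus>\<^bsub>T\<^esub> residue_class m = residue_class (l + m)"
    "a \<odot>\<^bsub>T\<^esub> residue_class l = residue_class (a \<otimes>\<^bsub>R\<^esub> l)"
proof -
  let ?Ap = "positive_part scale gr"
  have ops: "carrier R = UNIV" "x \<oplus>\<^bsub>R\<^esub> y = x + y" for x y using R by auto
  have coset: "?Ap +>\<^bsub>regular_module R\<^esub> l = residue_class l" for l
  proof (intro equalityI subsetI)
    fix y assume "y \<in> residue_class l"
    then have "y - l \<in> ?Ap" by (simp add: positive_part_eq residue_class_def proj_diff)
    then show "y \<in> ?Ap +>\<^bsub>regular_module R\<^esub> l"
      by (auto simp: a_r_coset_def' ops intro!: bexI[of _ "y - l"])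
  qed (auto simp: a_r_coset_def' ops residue_class_def positive_part_eq proj_add)
  show "carrier T = range residue_class"
    by (auto simp: T_def trivial_module_def quotient_module_def A_RCOSETS_def' coset ops)
  show "\<zero>\<^bsub>T\<^esub> = residue_class 0"
    by (auto simp: T_def trivial_module_def quotient_module_def residue_class_def positive_part_eq)
  have "residue_class l \<oplus>\<^bsub>T\<^esub> residue_class m = (\<Union>x\<in>residue_class l. \<Union>y\<in>residue_class m. {x + y})"
    by (simp add: T_def trivial_module_def quotient_module_def set_add_def' ops)
  also have "\<dots> = residue_class (l + m)"
  proof (intro equalityI subsetI)
    fix z assume "z \<in> residue_class (l + m)"
    then have "z - l \<in> residue_class m" by (simp add: residue_class_def proj_add proj_diff)
    then show "z \<in> (\<Union>x\<in>residue_class l. \<Union>y\<in>residue_class m. {x + y})"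
      by (intro UN_I[of l] UN_I[of "z - l"]) (simp_all add: residue_class_def)
  qed (auto simp: residue_class_def proj_add)
  finally show "residue_class l \<oplus>\<^bsub>T\<^esub> residue_class m = residue_class (l + m)" .
  have "a \<odot>\<^bsub>T\<^esub> residue_class l = (\<Union>x\<in>residue_class l. residue_class (a \<otimes>\<^bsub>R\<^esub> x))"
    by (simp add: T_def trivial_module_def quotient_module_def coset)
  also have "\<dots> = residue_class (a \<otimes>\<^bsub>R\<^esub> l)"
    using R by (auto simp: residue_class_def proj_0_mult)
  finally show "a \<odot>\<^bsub>T\<^esub> residue_class l = residue_class (a \<otimes>\<^bsub>R\<^esub> l)" .
qed

text \<open>
  Graded modules are graded by integers, so the projections of \<open>A\<close> are extended by zero to negative degrees.
\<close>

definition iproj :: "int \<Rightarrow> 'a \<Rightarrow> 'a" where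
  "iproj n x = (if n < 0 then 0 else proj (nat n) x)"

lemma iproj_0 [simp]: "iproj n 0 = 0"
  and iproj_add: "iproj n (x + y) = iproj n x + iproj n y"
  and iproj_diff: "iproj n (x - y) = iproj n x - iproj n y"
  and iproj_sum: "iproj n (sum f I) = (\<Sum>i\<in>I. iproj n (f i))"
  by (auto simp: iproj_def proj_add proj_diff proj_sum)

lemma iproj_zero_degree: "iproj 0 x = proj 0 x"
  by (simp add: iproj_def)

lemma iproj_of_nat: "iproj (int n) x = proj n x"
  by (simp add: iproj_def)

lemma iproj_mult_left: "a \<in> gr j \<Longrightarrow> iproj n (a * x) = a * iproj (n - int j) x"
  by (auto simp: iproj_def proj_mult_left nat_diff_distrib nat_le_iff le_nat_iff)

lemma iproj_mult_right: "a \<in> gr j \<Longrightarrow> iproj n (x * a) = iproj (n - int j) x * a"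
  by (auto simp: iproj_def proj_mult_right nat_diff_distrib nat_le_iff le_nat_iff)

lemma iproj_iproj: "iproj m (iproj n x) = (if m = n then iproj n x else 0)"
  by (auto simp: iproj_def proj_gr[OF proj_in_gr])

lemma gr_iff_iproj: "x \<in> gr n \<longleftrightarrow> iproj (int n) x = x"
  by (metis iproj_of_nat proj_gr proj_in_gr)

lemma iproj_finite: "finite {n. iproj n x \<noteq> 0}"
proof (rule finite_subset)
  show "{n. iproj n x \<noteq> 0} \<subseteq> int ` {n. proj n x \<noteq> 0}"
    by (auto simp: iproj_def image_iff split: if_splits intro!: exI[of _ "nat n" for n])
qed (simp add: finite_proj)

lemma sum_iproj:
  assumes "finite N" "{n. iproj n x \<noteq> 0} \<subseteq> N"
  shows "(\<Sum>n\<in>N. iproj n x) = x"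
proof -
  have "(\<Sum>n\<in>N. iproj n x) = (\<Sum>n\<in>int ` {n. proj n x \<noteq> 0}. iproj n x)"
  proof (rule sum.mono_neutral_right[OF assms(1)])
    show "int ` {n. proj n x \<noteq> 0} \<subseteq> N" using assms(2) by (auto simp: iproj_of_nat)
    show "\<forall>i\<in>N - int ` {n. proj n x \<noteq> 0}. iproj i x = 0"
      by (auto simp: iproj_def image_iff) (metis int_nat_eq linorder_not_less)
  qed
  also have "\<dots> = x" by (subst sum.reindex) (auto simp: iproj_of_nat sum_proj)
  finally show ?thesis .
qed

end

section \<open>Free modules\<close>

abbreviation "lookup \<equiv> Poly_Mapping.lookup"
abbreviation "keys \<equiv> Poly_Mapping.keys"

text \<open>
  The free module on a set is realised by finitely supported functions. Since its basis will consist
  of elements of the ring, it embeds into sets of lists over the ring, where projectivity applies.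
\<close>

definition free_act :: "'r::ring_1 \<Rightarrow> ('b \<Rightarrow>\<^sub>0 'r) \<Rightarrow> ('b \<Rightarrow>\<^sub>0 'r)" where
  "free_act a k = Poly_Mapping.map ((*) a) k"

lemma lookup_free_act [simp]: "lookup (free_act a k) b = a * lookup k b"
  by (simp add: free_act_def Poly_Mapping.map.rep_eq when_def)

definition free_on :: "'b set \<Rightarrow> ('b \<Rightarrow>\<^sub>0 'r::zero) set" where
  "free_on B = {k. keys k \<subseteq> B}"

lemma free_onD: "k \<in> free_on B \<Longrightarrow> b \<notin> B \<Longrightarrow> lookup k b = 0"
  by (auto simp: free_on_def in_keys_iff)

lemma free_onI: "(\<And>b. b \<notin> B \<Longrightarrow> lookup k b = 0) \<Longrightarrow> k \<in> free_on B"
  by (auto simp: free_on_def in_keys_iff)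

lemma type_action_free: "type_action (free_on B) free_act"
  by unfold_locales
    (auto intro!: free_onI poly_mapping_eqI simp: free_onD lookup_add algebra_simps)

definition free_eval :: "('b \<Rightarrow> 'r::ring_1) \<Rightarrow> ('b \<Rightarrow>\<^sub>0 'r) \<Rightarrow> 'r" where
  "free_eval G k = (\<Sum>b\<in>keys k. lookup k b * G b)"

lemma free_eval_superset:
  "finite T \<Longrightarrow> keys k \<subseteq> T \<Longrightarrow> free_eval G k = (\<Sum>b\<in>T. lookup k b * G b)"
  unfolding free_eval_def by (rule sum.mono_neutral_left) (auto simp: in_keys_iff)

lemma free_eval_add: "free_eval G (k + l) = free_eval G k + free_eval G l"
proof -
  let ?T = "keys k \<union> keys l"
  have "free_eval G (k + l) = (\<Sum>b\<in>?T. lookup (k + l) b * G b)"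
    by (rule free_eval_superset) (auto simp: keys_add)
  also have "\<dots> = (\<Sum>b\<in>?T. lookup k b * G b) + (\<Sum>b\<in>?T. lookup l b * G b)"
    by (simp add: lookup_add distrib_right sum.distrib)
  also have "\<dots> = free_eval G k + free_eval G l"
    by (simp add: free_eval_superset[of ?T])
  finally show ?thesis .
qed

lemma free_eval_act: "free_eval G (free_act a k) = a * free_eval G k"
proof -
  have "free_eval G (free_act a k) = (\<Sum>b\<in>keys k. lookup (free_act a k) b * G b)"
    by (rule free_eval_superset) (auto simp: in_keys_iff)
  then show ?thesis by (simp add: free_eval_def sum_distrib_left mult.assoc)
qed

lemma free_eval_zero [simp]: "free_eval G 0 = 0"
  by (simp add: free_eval_def)

lemma free_eval_single [simp]: "free_eval G (Poly_Mapping.single b a) = a * G b"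
  by (simp add: free_eval_def)

lemma free_eval_diff: "free_eval G (k - l) = free_eval G k - free_eval G l"
  using free_eval_add[of G "k - l" l] by simp

lemma single_in_free_on: "b \<in> B \<Longrightarrow> Poly_Mapping.single b a \<in> free_on B"
  by (auto simp: free_on_def)

lemma free_sum_single: "k = (\<Sum>b\<in>keys k. free_act (lookup k b) (Poly_Mapping.single b 1))"
proof (rule poly_mapping_eqI)
  fix c
  have "lookup (\<Sum>b\<in>keys k. free_act (lookup k b) (Poly_Mapping.single b 1)) c =
      (\<Sum>b\<in>keys k. if b = c then lookup k c else 0)"
    unfolding lookup_sum by (rule sum.cong) (auto simp: lookup_single when_def)
  then show "lookup k c = lookup (\<Sum>b\<in>keys k. free_act (lookup k b) (Poly_Mapping.single b 1)) c"
    by (auto simp: in_keys_iff)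
qed

definition encode_elem :: "'r \<Rightarrow> 'r list set" where
  "encode_elem a = {[a]}"

definition encode_free :: "('r \<Rightarrow>\<^sub>0 'r::zero) \<Rightarrow> 'r list set" where
  "encode_free k = range (\<lambda>b. [b, lookup k b])"

lemma inj_encode_elem: "inj encode_elem"
  by (auto simp: inj_def encode_elem_def)

lemma inj_encode_free: "inj encode_free"
proof (rule injI)
  fix k l :: "'a \<Rightarrow>\<^sub>0 'a" assume eq: "encode_free k = encode_free l"
  show "k = l"
  proof (rule poly_mapping_eqI)
    fix b
    have "[b, lookup k b] \<in> encode_free l" using eq by (auto simp: encode_free_def)
    then show "lookup k b = lookup l b" by (auto simp: encode_free_def)
  qed
qed

text \<open>
  The image of \<open>k\<close> under the linear map from the free module that sends the basis element \<open>b\<close> to \<open>p b\<close>.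
\<close>

definition combination :: "('r::ring_1, 'p) module \<Rightarrow> ('b \<Rightarrow> 'p) \<Rightarrow> ('b \<Rightarrow>\<^sub>0 'r) \<Rightarrow> 'p" where
  "combination P p k = finsum P (\<lambda>b. lookup k b \<odot>\<^bsub>P\<^esub> p b) (keys k)"

context
  fixes P :: "('r::ring_1, 'p) module"
  assumes P: "left_module type_ring P"
begin

interpretation left_module type_ring P by (fact P)

lemma smult_zero_left: "x \<in> carrier P \<Longrightarrow> 0 \<odot>\<^bsub>P\<^esub> x = \<zero>\<^bsub>P\<^esub>"
proof -
  assume x: "x \<in> carrier P"
  have "0 \<odot>\<^bsub>P\<^esub> x \<oplus>\<^bsub>P\<^esub> 0 \<odot>\<^bsub>P\<^esub> x = 0 \<odot>\<^bsub>P\<^esub> x"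
    using act_l_distr[of 0 0 x] x by simp
  then show ?thesis
    using act_closed[of 0 x] x by (simp add: M.add.l_cancel_one)
qed

lemma smult_finsum:
  assumes "finite I" "\<And>i. i \<in> I \<Longrightarrow> f i \<in> carrier P"
  shows "a \<odot>\<^bsub>P\<^esub> finsum P f I = finsum P (\<lambda>i. a \<odot>\<^bsub>P\<^esub> f i) I"
proof -
  have a0: "a \<odot>\<^bsub>P\<^esub> \<zero>\<^bsub>P\<^esub> = \<zero>\<^bsub>P\<^esub>"
  proof -
    have "a \<odot>\<^bsub>P\<^esub> \<zero>\<^bsub>P\<^esub> \<oplus>\<^bsub>P\<^esub> a \<odot>\<^bsub>P\<^esub> \<zero>\<^bsub>P\<^esub> = a \<odot>\<^bsub>P\<^esub> \<zero>\<^bsub>P\<^esub>"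
      using act_r_distr[of a "\<zero>\<^bsub>P\<^esub>" "\<zero>\<^bsub>P\<^esub>"] by simp
    then show ?thesis
      using act_closed[of a "\<zero>\<^bsub>P\<^esub>"] by (simp add: M.add.l_cancel_one)
  qed
  show ?thesis using assms
    by (induction I rule: finite_induct)
      (simp_all add: a0 act_r_distr act_closed Pi_iff)
qed

lemma sum_smult:
  assumes "finite I" "x \<in> carrier P"
  shows "finsum P (\<lambda>i. f i \<odot>\<^bsub>P\<^esub> x) I = sum f I \<odot>\<^bsub>P\<^esub> x"
  using assms(1)
proof (induction I rule: finite_induct)
  case (insert i I)
  then show ?case
    using act_l_distr[of "f i" "sum f I" x] by (simp add: act_closed assms(2) Pi_iff)
qed (simp add: smult_zero_left assms(2))

context
  fixes p :: "'b \<Rightarrow> 'p" and B :: "'b set"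
  assumes p: "\<And>b. b \<in> B \<Longrightarrow> p b \<in> carrier P"
begin

lemma combination_superset:
  assumes "finite T" "keys k \<subseteq> T" "T \<subseteq> B"
  shows "combination P p k = finsum P (\<lambda>b. lookup k b \<odot>\<^bsub>P\<^esub> p b) T"
  unfolding combination_def
proof (rule M.add.finprod_mono_neutral_cong_left)
  show "lookup k b \<odot>\<^bsub>P\<^esub> p b = \<zero>\<^bsub>P\<^esub>" if "b \<in> T - keys k" for b
  proof -
    have "p b \<in> carrier P" using that assms(3) p by auto
    moreover have "lookup k b = 0" using that by (simp add: in_keys_iff)
    ultimately show ?thesis by (simp add: smult_zero_left)
  qed
qed (use assms p in \<open>auto simp: act_closed\<close>)

lemma combination_closed: "k \<in> free_on B \<Longrightarrow> combination P p k \<in> carrier P"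
  unfolding combination_def
  by (intro M.finsum_closed) (auto intro!: act_closed p simp: free_on_def)

lemma combination_add:
  assumes "k \<in> free_on B" "l \<in> free_on B"
  shows "combination P p (k + l) = combination P p k \<oplus>\<^bsub>P\<^esub> combination P p l"
proof -
  let ?T = "keys k \<union> keys l"
  have T: "?T \<subseteq> B" using assms by (auto simp: free_on_def)
  have "combination P p (k + l) = finsum P (\<lambda>b. lookup (k + l) b \<odot>\<^bsub>P\<^esub> p b) ?T"
    using T by (intro combination_superset) (auto simp: Poly_Mapping.keys_add)
  also have "\<dots> = finsum P (\<lambda>b. lookup k b \<odot>\<^bsub>P\<^esub> p b \<oplus>\<^bsub>P\<^esub> lookup l b \<odot>\<^bsub>P\<^esub> p b) ?T"
    using T p act_l_distr act_closed
    by (intro M.finsum_cong') (auto simp: lookup_add subset_iff)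
  also have "\<dots> = finsum P (\<lambda>b. lookup k b \<odot>\<^bsub>P\<^esub> p b) ?T \<oplus>\<^bsub>P\<^esub> finsum P (\<lambda>b. lookup l b \<odot>\<^bsub>P\<^esub> p b) ?T"
    using T p by (intro M.finsum_addf) (auto intro!: act_closed)
  finally show ?thesis using T by (simp add: combination_superset[of ?T])
qed

lemma combination_act:
  assumes "k \<in> free_on B"
  shows "combination P p (free_act a k) = a \<odot>\<^bsub>P\<^esub> combination P p k"
proof -
  have T: "keys k \<subseteq> B" using assms by (auto simp: free_on_def)
  have "combination P p (free_act a k) = finsum P (\<lambda>b. lookup (free_act a k) b \<odot>\<^bsub>P\<^esub> p b) (keys k)"
    using T by (intro combination_superset) (auto simp: in_keys_iff)
  also have "\<dots> = finsum P (\<lambda>b. a \<odot>\<^bsub>P\<^esub> (lookup k b \<odot>\<^bsub>P\<^esub> p b)) (keys k)"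
    using T p act_assoc act_closed by (intro M.finsum_cong') (auto simp: subset_iff)
  also have "\<dots> = a \<odot>\<^bsub>P\<^esub> combination P p k"
    unfolding combination_def using T p by (subst smult_finsum) (auto intro!: act_closed)
  finally show ?thesis .
qed

lemma linear_map_combination:
  assumes "linear_map P act h" "k \<in> free_on B"
  shows "h (combination P p k) = (\<Sum>b\<in>keys k. act (lookup k b) (h (p b)))"
proof -
  have T: "keys k \<subseteq> B" using assms by (auto simp: free_on_def)
  have "h (combination P p k) = (\<Sum>b\<in>keys k. h (lookup k b \<odot>\<^bsub>P\<^esub> p b))"
    unfolding combination_def using T p
    by (intro linear_map_finsum[OF M.abelian_group_axioms assms(1)]) (auto intro!: act_closed)
  then show ?thesis
    using T p linear_mapD(2)[OF assms(1)] by (simp add: subset_iff)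
qed

lemma hom_module_combination:
  assumes N: "left_module type_ring N" and h: "h \<in> hom_module type_ring P N" and "k \<in> free_on B"
  shows "h (combination P p k) = combination N (\<lambda>b. h (p b)) k"
proof -
  interpret N: left_module type_ring N by fact
  have T: "keys k \<subseteq> B" using assms by (auto simp: free_on_def)
  have "h (combination P p k) = finsum N (\<lambda>b. h (lookup k b \<odot>\<^bsub>P\<^esub> p b)) (keys k)"
    unfolding combination_def using T p
    by (intro hom_module_finsum[OF M.abelian_group_axioms N.M.abelian_group_axioms h])
      (auto intro!: act_closed)
  also have "\<dots> = combination N (\<lambda>b. h (p b)) k"
    unfolding combination_def using T p hom_moduleD[OF h]
    by (intro N.M.finsum_cong') (auto intro!: N.act_closed)
  finally show ?thesis .
qed

end

end

section \<open>The module of relations of a graded algebra\<close>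

text \<open>
  \<open>B\<close> is a basis of the generating space \<open>V = gr 1\<close>. The free module \<open>F\<close> on \<open>B\<close> is \<open>A \<otimes> V\<close>, and
  \<open>F \<rightarrow> A \<rightarrow> k \<rightarrow> 0\<close> is the beginning of the minimal resolution of the trivial module. Its next kernel
  \<open>K\<close> is the module of relations: an algebra with generators \<open>B\<close> is determined by \<open>K\<close>.
\<close>

locale generated_algebra = connected_graded_algebra scale gr
  for scale :: "'k::field \<Rightarrow> 'a::ring_1 \<Rightarrow> 'a" and gr +
  fixes B :: "'a set"
  assumes B_gr: "B \<subseteq> gr 1" and independent_B: "independent B" and span_B: "span B = gr 1"
    and generated: "generated_in_degree_one scale gr"
begin

abbreviation "F \<equiv> free_on B :: ('a \<Rightarrow>\<^sub>0 'a) set"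

sublocale free: type_action F free_act
  by (rule type_action_free)

definition d :: "('a \<Rightarrow>\<^sub>0 'a) \<Rightarrow> 'a" where
  "d = free_eval (\<lambda>b. b)"

definition K :: "('a \<Rightarrow>\<^sub>0 'a) set" where
  "K = {k \<in> F. d k = 0}"

lemma d_add: "d (k + l) = d k + d l" and d_diff: "d (k - l) = d k - d l"
  and d_act: "d (free_act a k) = a * d k" and d_zero [simp]: "d 0 = 0"
  and d_single [simp]: "d (Poly_Mapping.single b a) = a * b"
  by (simp_all add: d_def free_eval_add free_eval_diff free_eval_act)

lemma free_act_zero [simp]: "free_act a 0 = 0" "free_act 0 k = 0"
  by (simp_all add: poly_mapping_eqI)

lemma F_diff: "k \<in> F \<Longrightarrow> l \<in> F \<Longrightarrow> k - l \<in> F"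
  using free.add_mem[of k "- l"] free.minus_mem[of l] by simp

lemma type_action_K: "type_action K free_act"
  by unfold_locales
    (auto simp: K_def free.zero_mem free.add_mem free.minus_mem free.act_mem d_add d_act
      free.act_add_left free.act_add_right free.act_mult free.act_1
      d_diff[of 0, simplified])

sublocale K: type_action K free_act
  by (rule type_action_K)

lemma K_diff: "k \<in> K \<Longrightarrow> l \<in> K \<Longrightarrow> k - l \<in> K"
  by (auto simp: K_def F_diff d_diff)

lemma proj_0_d: "k \<in> F \<Longrightarrow> proj 0 (d k) = 0"
proof -
  assume "k \<in> F"
  have "proj 0 b = 0" if "b \<in> keys k" for b
  proof -
    have "b \<in> gr 1" using that \<open>k \<in> F\<close> B_gr by (auto simp: free_on_def)
    then show ?thesis by (simp add: proj_gr)
  qed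
  then show ?thesis by (simp add: d_def free_eval_def proj_sum proj_0_mult)
qed

text \<open>
  Exactness of \<open>F \<rightarrow> A \<rightarrow> k\<close>: the elements \<open>c + d k\<close> with \<open>c\<close> a scalar form a subspace that contains all
  products of elements of \<open>V\<close>, by splitting off the last factor.
\<close>

lemma augmentation_ideal_eq: 
  assumes "proj 0 x = 0" 
  obtains k where "k \<in> F" "d k = x"
proof -
  let ?T = "{c + d k | c k. c \<in> gr 0 \<and> k \<in> F}"
  have act: "a * v \<in> ?T" if v: "v \<in> gr 1" for a v
  proof -
    from v have "v \<in> span B" by (simp add: span_B)
    then have "\<exists>k\<in>F. d k = a * v"
    proof (induction v rule: span_induct_alt)
      case base
      show ?case using free.zero_mem by (intro bexI[of _ 0]) auto
    next
      case (step c b y)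
      then obtain k where k: "k \<in> F" "d k = a * y" by blast
      have "a * (scale c b + y) = d (Poly_Mapping.single b (scale c a) + k)"
        by (simp add: d_add k distrib_left scale_mult_left scale_mult_right)
      then show ?case
        using k step.hyps by (metis free.add_mem single_in_free_on)
    qed
    then show ?thesis using subspace_0[OF gr_subspace[of 0]] by force
  qed
  have "subspace ?T"
  proof (rule subspaceI)
    show "0 \<in> ?T" using subspace_0[OF gr_subspace[of 0]] free.zero_mem by force
    fix x y assume "x \<in> ?T" "y \<in> ?T"
    then obtain c k c' k' where "x = c + d k" "y = c' + d k'" "c \<in> gr 0" "c' \<in> gr 0" "k \<in> F" "k' \<in> F"
      by auto
    then show "x + y \<in> ?T"
      using subspace_add[OF gr_subspace, of c 0 c'] free.add_mem[of k k']
      by (auto intro!: exI[of _ "c + c'"] exI[of _ "k + k'"] simp: d_add)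
  next
    fix a x assume "x \<in> ?T"
    then obtain c k where "x = c + d k" "c \<in> gr 0" "k \<in> F" by auto
    then show "scale a x \<in> ?T"
      using subspace_scale[OF gr_subspace, of c 0 a] free.act_mem[of k "scale a 1"]
      by (auto intro!: exI[of _ "scale a c"] exI[of _ "free_act (scale a 1) k"]
          simp: d_act scale_right_distrib scale_mult_left)
  qed
  moreover have "{prod_list xs | xs. set xs \<subseteq> gr 1} \<subseteq> ?T"
  proof (rule subsetI)
    fix x assume "x \<in> {prod_list xs | xs. set xs \<subseteq> gr 1}"
    then obtain xs where x: "x = prod_list xs" and "set xs \<subseteq> gr 1" by auto
    then show "x \<in> ?T"
    proof (cases xs rule: rev_cases)
      case Nil
      show ?thesis unfolding x Nil
        by (intro CollectI exI[of _ 1] exI[of _ "0 :: 'a \<Rightarrow>\<^sub>0 'a"]) (simp add: one_gr free.zero_mem)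
    next
      case (snoc ys y)
      with \<open>set xs \<subseteq> gr 1\<close> have "y \<in> gr 1" by simp
      from act[OF this, of "prod_list ys"] show ?thesis unfolding x snoc by simp
    qed
  qed
  ultimately have "span {prod_list xs | xs. set xs \<subseteq> gr 1} \<subseteq> ?T"
    by (intro span_minimal)
  moreover have "x \<in> span {prod_list xs | xs. set xs \<subseteq> gr 1}"
    using generated unfolding generated_in_degree_one_def by simp
  ultimately have "x \<in> ?T" by (rule subsetD)
  then obtain c k where ck: "x = c + d k" "c \<in> gr 0" "k \<in> F"
    by (elim CollectE exE conjE) (rule that)
  have "proj 0 x = proj 0 c + proj 0 (d k)" unfolding ck(1) by (rule proj_add)
  also have "\<dots> = c" using proj_0_d[OF ck(3)] proj_gr[OF ck(2), of 0] by simp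
  finally have "d k = x" using assms ck(1) by simp
  with ck(3) show thesis by (rule that)
qed

text \<open>
  The basis of \<open>F\<close> has degree one, whence the shift of degrees.
\<close>

definition fproj :: "int \<Rightarrow> ('a \<Rightarrow>\<^sub>0 'a) \<Rightarrow> ('a \<Rightarrow>\<^sub>0 'a)" where
  "fproj n k = Poly_Mapping.map (iproj (n - 1)) k"

lemma lookup_fproj [simp]: "lookup (fproj n k) b = iproj (n - 1) (lookup k b)"
  by (simp add: fproj_def Poly_Mapping.map.rep_eq when_def)

lemma fproj_F: "k \<in> F \<Longrightarrow> fproj n k \<in> F"
  by (auto intro!: free_onI simp: free_onD)

lemma fproj_0 [simp]: "fproj n 0 = 0"
  by (rule poly_mapping_eqI) simp

lemma fproj_add: "fproj n (k + l) = fproj n k + fproj n l"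
  by (rule poly_mapping_eqI) (simp add: lookup_add iproj_add)

lemma fproj_diff: "fproj n (k - l) = fproj n k - fproj n l"
  by (rule poly_mapping_eqI) (simp add: lookup_minus iproj_diff)

lemma fproj_act: "a \<in> gr j \<Longrightarrow> fproj n (free_act a k) = free_act a (fproj (n - int j) k)"
  by (rule poly_mapping_eqI) (simp add: iproj_mult_left algebra_simps)

lemma fproj_fproj: "fproj m (fproj n k) = (if m = n then fproj n k else 0)"
  by (rule poly_mapping_eqI) (simp add: iproj_iproj)

lemma d_fproj:
  assumes "k \<in> F"
  shows "d (fproj n k) = iproj n (d k)"
proof -
  have "d (fproj n k) = (\<Sum>b\<in>keys k. lookup (fproj n k) b * b)"
    unfolding d_def by (rule free_eval_superset) (auto simp: in_keys_iff)
  also have "\<dots> = (\<Sum>b\<in>keys k. iproj n (lookup k b * b))"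
  proof (rule sum.cong)
    fix b assume "b \<in> keys k"
    then have "b \<in> gr 1" using assms B_gr by (auto simp: free_on_def)
    then show "lookup (fproj n k) b * b = iproj n (lookup k b * b)"
      by (simp add: iproj_mult_right)
  qed simp
  finally show ?thesis by (simp add: d_def free_eval_def iproj_sum)
qed

lemma fproj_K: "k \<in> K \<Longrightarrow> fproj n k \<in> K"
  by (simp add: K_def fproj_F d_fproj)

lemma fproj_finite: "finite {n. fproj n k \<noteq> 0}"
proof (rule finite_subset)
  show "{n. fproj n k \<noteq> 0} \<subseteq> (\<Union>b\<in>keys k. (\<lambda>n. n + 1) ` {n. iproj n (lookup k b) \<noteq> 0})"
  proof
    fix n assume "n \<in> {n. fproj n k \<noteq> 0}"
    then obtain b where "lookup (fproj n k) b \<noteq> 0"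
      by (metis (mono_tags, lifting) lookup_zero mem_Collect_eq poly_mapping_eqI)
    then have b: "iproj (n - 1) (lookup k b) \<noteq> 0" by simp
    then have "b \<in> keys k" by (auto simp: in_keys_iff)
    moreover have "n \<in> (\<lambda>n. n + 1) ` {n. iproj n (lookup k b) \<noteq> 0}"
      using b by (intro image_eqI[of _ _ "n - 1"]) auto
    ultimately show "n \<in> (\<Union>b\<in>keys k. (\<lambda>n. n + 1) ` {n. iproj n (lookup k b) \<noteq> 0})" by blast
  qed
qed (auto simp: iproj_finite)

lemma sum_fproj: "(\<Sum>n | fproj n k \<noteq> 0. fproj n k) = k"
proof (rule poly_mapping_eqI)
  fix b
  let ?N = "{n. fproj n k \<noteq> 0}"
  have "lookup (sum (\<lambda>n. fproj n k) ?N) b = (\<Sum>n\<in>?N. iproj (n - 1) (lookup k b))"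
    by (simp add: lookup_sum)
  also have "\<dots> = (\<Sum>n\<in>(\<lambda>n. n - 1) ` ?N. iproj n (lookup k b))"
    by (subst sum.reindex) (auto simp: inj_on_def)
  also have "\<dots> = lookup k b"
  proof (rule sum_iproj)
    show "{n. iproj n (lookup k b) \<noteq> 0} \<subseteq> (\<lambda>n. n - 1) ` ?N"
    proof
      fix n assume "n \<in> {n. iproj n (lookup k b) \<noteq> 0}"
      then have "lookup (fproj (n + 1) k) b \<noteq> 0" by simp
      then have "fproj (n + 1) k \<noteq> 0" by (metis lookup_zero)
      then show "n \<in> (\<lambda>n. n - 1) ` ?N" by (intro image_eqI[of _ _ "n + 1"]) auto
    qed
  qed (simp add: fproj_finite)
  finally show "lookup (sum (\<lambda>n. fproj n k) ?N) b = lookup k b" .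
qed

text \<open>
  The component of degree one of a relation is a linear relation among the elements of \<open>B\<close> with
  scalar coefficients, and \<open>B\<close> is independent. This is the minimality of the resolution: \<open>K \<subseteq> A\<^sub>+ F\<close>.
\<close>

lemma K_degree_zero_coefficients:
  assumes "k \<in> K"
  shows "proj 0 (lookup k b) = 0"
proof -
  have F: "k \<in> F" and dk: "d k = 0" using assms by (auto simp: K_def)
  define c where "c b = (SOME c. proj 0 (lookup k b) = scale c 1)" for b
  have c: "proj 0 (lookup k b) = scale (c b) 1" for b
    unfolding c_def
    by (rule someI_ex) (use proj_in_gr[of 0 "lookup k b"] in \<open>auto simp: gr_0\<close>)
  have "0 = d (fproj 1 k)" using d_fproj[OF F, of 1] dk by simp
  also have "\<dots> = (\<Sum>b\<in>keys k. lookup (fproj 1 k) b * b)"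
    unfolding d_def by (rule free_eval_superset) (auto simp: in_keys_iff)
  also have "\<dots> = (\<Sum>b\<in>keys k. scale (c b) b)"
    by (simp add: iproj_zero_degree c scale_mult_left)
  finally have eq: "(\<Sum>b\<in>keys k. scale (c b) b) = 0" by simp
  have "b \<in> keys k \<Longrightarrow> c b = 0"
    using independentD[OF independent_B _ _ eq] F by (auto simp: free_on_def)
  then show ?thesis using c[of b] by (cases "b \<in> keys k") (auto simp: in_keys_iff)
qed

lemma K_fproj_small:
  assumes "k \<in> K" "n \<le> 1"
  shows "fproj n k = 0"
proof (rule poly_mapping_eqI)
  fix b
  show "lookup (fproj n k) b = lookup 0 b"
    using K_degree_zero_coefficients[OF assms(1), of b] assms(2)
    by (cases "n = 1") (auto simp: iproj_def)
qed

definition trivial_act :: "'a \<Rightarrow> 'a \<Rightarrow> 'a" where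
  "trivial_act a c = proj 0 a * c"

lemma type_action_trivial: "type_action (gr 0) trivial_act"
proof
  show "0 \<in> gr 0" by (rule subspace_0[OF gr_subspace])
  fix a b x assume x: "x \<in> gr 0"
  show "trivial_act a x \<in> gr 0"
    using gr_mult[OF proj_in_gr[of 0 a] x] by (simp add: trivial_act_def)
  show "- x \<in> gr 0" by (rule subspace_neg[OF gr_subspace x])
  show "trivial_act (a + b) x = trivial_act a x + trivial_act b x"
    by (simp add: trivial_act_def proj_add distrib_right)
  show "trivial_act (a * b) x = trivial_act a (trivial_act b x)"
    by (simp add: trivial_act_def proj_0_mult mult.assoc)
  show "trivial_act 1 x = x"
    by (simp add: trivial_act_def proj_gr[OF one_gr])
  fix y assume y: "y \<in> gr 0"
  show "x + y \<in> gr 0" by (rule subspace_add[OF gr_subspace x y])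
  show "trivial_act a (x + y) = trivial_act a x + trivial_act a y"
    by (simp add: trivial_act_def distrib_left)
qed

lemma type_action_UNIV: "type_action UNIV ((*) :: 'a \<Rightarrow> 'a \<Rightarrow> 'a)"
  by unfold_locales (simp_all add: distrib_left distrib_right mult.assoc)

lemma type_action_augmentation: "type_action {x. proj 0 x = 0} ((*) :: 'a \<Rightarrow> 'a \<Rightarrow> 'a)"
  by unfold_locales
    (simp_all add: distrib_left distrib_right mult.assoc proj_add proj_0_mult proj_uminus)

end

section \<open>Comparing projective resolutions of the trivial module\<close>

text \<open>
  A projective resolution of the trivial module, where the latter is realised as \<open>gr 0\<close>.
\<close>

locale trivial_resolution = generated_algebra scale gr B
  for scale :: "'k::field \<Rightarrow> 'a::ring_1 \<Rightarrow> 'a" and gr B +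
  fixes P :: "nat \<Rightarrow> 'a small_module" and \<delta> :: "nat \<Rightarrow> 'a list set \<Rightarrow> 'a list set"
    and \<epsilon> :: "'a list set \<Rightarrow> 'a"
  assumes projective: "projective_module type_ring (P i)"
    and differential: "\<delta> i \<in> hom_module type_ring (P (Suc i)) (P i)"
    and \<epsilon>_linear: "linear_map (P 0) trivial_act \<epsilon>" and \<epsilon>_image: "\<epsilon> ` carrier (P 0) = gr 0"
    and exact_0: "hom_kernel (P 0) (type_module (gr 0) trivial_act) \<epsilon> = \<delta> 0 ` carrier (P 1)"
    and exact_Suc: "hom_kernel (P (Suc i)) (P i) (\<delta> i) = \<delta> (Suc i) ` carrier (P (Suc (Suc i)))"
begin

lemma left_module_P: "left_module type_ring (P i)"
  using projective[of i] by (simp add: projective_module_def)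

lemma \<delta>_closed: "x \<in> carrier (P (Suc i)) \<Longrightarrow> \<delta> i x \<in> carrier (P i)"
  by (rule hom_moduleD(1)[OF differential])

lemma abelian_group_P: "abelian_group (P i)"
  using left_module_P by (simp add: left_module_def)

lemma \<epsilon>_\<delta>: "x \<in> carrier (P 1) \<Longrightarrow> \<epsilon> (\<delta> 0 x) = 0"
  using exact_0 by (auto simp: hom_kernel_def)

lemma \<delta>_\<delta>: "x \<in> carrier (P (Suc (Suc i))) \<Longrightarrow> \<delta> i (\<delta> (Suc i) x) = \<zero>\<^bsub>P i\<^esub>"
  using exact_Suc[of i] by (auto simp: hom_kernel_def)

text \<open>
  The comparison map from the resolution to \<open>F \<rightarrow> A \<rightarrow> k\<close>: first lift through \<open>A \<rightarrow> k\<close>, then through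
  \<open>F \<rightarrow> A\<^sub>+\<close>.
\<close>

lemma chain_map_to_free:
  obtains \<beta>0 \<beta>1 where "linear_map (P 0) (*) \<beta>0" "\<And>x. x \<in> carrier (P 0) \<Longrightarrow> proj 0 (\<beta>0 x) = \<epsilon> x"
    "linear_map (P 1) free_act \<beta>1" "\<And>x. x \<in> carrier (P 1) \<Longrightarrow> \<beta>1 x \<in> F"
    "\<And>x. x \<in> carrier (P 1) \<Longrightarrow> d (\<beta>1 x) = \<beta>0 (\<delta> 0 x)"
proof -
  have eps_in: "\<epsilon> x \<in> gr 0" if "x \<in> carrier (P 0)" for x
    using \<epsilon>_image that by blast
  have surj0: "\<exists>x\<in>UNIV. proj 0 x = y" if "y \<in> gr 0" for y
    using proj_gr[OF that, of 0] by auto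
  obtain \<beta>0 where \<beta>0: "linear_map (P 0) (*) \<beta>0" "\<And>x. x \<in> carrier (P 0) \<Longrightarrow> proj 0 (\<beta>0 x) = \<epsilon> x"
    by (rule projective_lift_type[OF projective[of 0] type_action_UNIV type_action_trivial
          inj_encode_elem inj_encode_elem, where g = "proj 0" and f = \<epsilon>])
      (use \<epsilon>_linear eps_in surj0 in
        \<open>auto simp: proj_add proj_0_mult trivial_act_def proj_in_gr\<close>)
  have lin: "linear_map (P 1) (*) (\<lambda>x. \<beta>0 (\<delta> 0 x))"
    unfolding linear_map_def
  proof (intro conjI ballI allI)
    fix x a assume x: "x \<in> carrier (P 1)"
    then have x': "x \<in> carrier (P (Suc 0))" by simp
    show "\<beta>0 (\<delta> 0 (a \<odot>\<^bsub>P 1\<^esub> x)) = a * \<beta>0 (\<delta> 0 x)"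
      using hom_moduleD(3)[OF differential[of 0] _ x', of a] linear_mapD(2)[OF \<beta>0(1) \<delta>_closed[OF x'], of a]
      by simp
    fix y assume "y \<in> carrier (P 1)"
    then have y: "y \<in> carrier (P (Suc 0))" by simp
    show "\<beta>0 (\<delta> 0 (x \<oplus>\<^bsub>P 1\<^esub> y)) = \<beta>0 (\<delta> 0 x) + \<beta>0 (\<delta> 0 y)"
      using hom_moduleD(2)[OF differential[of 0] x' y] linear_mapD(1)[OF \<beta>0(1) \<delta>_closed[OF x'] \<delta>_closed[OF y]]
      by simp
  qed
  have in_ideal: "\<beta>0 (\<delta> 0 x) \<in> {x. proj 0 x = 0}" if "x \<in> carrier (P 1)" for x
    using \<beta>0(2)[of "\<delta> 0 x"] \<delta>_closed[of x 0] \<epsilon>_\<delta>[OF that] that by simp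
  have surj1: "\<exists>k\<in>F. d k = y" if "y \<in> {x. proj 0 x = 0}" for y
    using augmentation_ideal_eq[of y] that by auto
  obtain \<beta>1 where "linear_map (P 1) free_act \<beta>1" "\<And>x. x \<in> carrier (P 1) \<Longrightarrow> \<beta>1 x \<in> F"
    "\<And>x. x \<in> carrier (P 1) \<Longrightarrow> d (\<beta>1 x) = \<beta>0 (\<delta> 0 x)"
    by (rule projective_lift_type[OF projective[of 1] type_action_free type_action_augmentation
          inj_encode_free inj_encode_elem, where g = d and f = "\<lambda>x. \<beta>0 (\<delta> 0 x)"])
      (use lin in_ideal surj1 in \<open>auto simp: proj_0_d d_add d_act\<close>)
  with \<beta>0 show thesis by (rule that)
qed

lemma generator_preimage:
  assumes e: "e \<in> carrier (P 0)" and b: "b \<in> B"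
  obtains p where "p \<in> carrier (P 1)" "\<delta> 0 p = b \<odot>\<^bsub>P 0\<^esub> e"
proof -
  interpret P0: left_module type_ring "P 0" by (rule left_module_P)
  have "proj 0 b = 0" using b B_gr by (auto simp: proj_gr[of b 1])
  then have "\<epsilon> (b \<odot>\<^bsub>P 0\<^esub> e) = 0"
    using linear_mapD(2)[OF \<epsilon>_linear e] by (simp add: trivial_act_def)
  then have "b \<odot>\<^bsub>P 0\<^esub> e \<in> hom_kernel (P 0) (type_module (gr 0) trivial_act) \<epsilon>"
    using P0.act_closed[of b e] e by (simp add: hom_kernel_def)
  then show thesis using that unfolding exact_0 by auto
qed

text \<open>
  The comparison map in the other direction sends \<open>1\<close> to \<open>e\<close> and the basis element \<open>b\<close> to \<open>p b\<close>. It
  is a chain map, so it sends relations to cycles, which are boundaries.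
\<close>

lemma combination_relation:
  assumes e: "e \<in> carrier (P 0)" and p: "\<And>b. b \<in> B \<Longrightarrow> p b \<in> carrier (P 1)"
    and dp: "\<And>b. b \<in> B \<Longrightarrow> \<delta> 0 (p b) = b \<odot>\<^bsub>P 0\<^esub> e" and k: "k \<in> K"
  obtains q where "q \<in> carrier (P 2)" "\<delta> 1 q = combination (P 1) p k"
proof -
  interpret P0: left_module type_ring "P 0" by (rule left_module_P)
  have kF: "k \<in> F" and dk: "d k = 0" using k by (auto simp: K_def)
  have T: "keys k \<subseteq> B" using kF by (simp add: free_on_def)
  have "\<delta> 0 (combination (P 1) p k) = combination (P 0) (\<lambda>b. \<delta> 0 (p b)) k"
    using hom_module_combination[OF left_module_P, of B p 1 "P 0" "\<delta> 0" k] p differential[of 0] kF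
      left_module_P by simp
  also have "\<dots> = finsum (P 0) (\<lambda>b. (lookup k b * b) \<odot>\<^bsub>P 0\<^esub> e) (keys k)"
    unfolding combination_def
  proof (rule P0.M.finsum_cong')
    fix b assume "b \<in> keys k"
    then have "b \<in> B" using T by auto
    then show "lookup k b \<odot>\<^bsub>P 0\<^esub> \<delta> 0 (p b) = (lookup k b * b) \<odot>\<^bsub>P 0\<^esub> e"
      using P0.act_assoc[of "lookup k b" b e] e dp by simp
  qed (use e P0.act_closed in auto)
  also have "\<dots> = d k \<odot>\<^bsub>P 0\<^esub> e"
    using sum_smult[OF left_module_P finite_keys e, of "\<lambda>b. lookup k b * b" k]
    by (simp add: d_def free_eval_def)
  also have "\<dots> = \<zero>\<^bsub>P 0\<^esub>"
    using smult_zero_left[OF left_module_P e] by (simp add: dk)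
  finally have "combination (P 1) p k \<in> hom_kernel (P (Suc 0)) (P 0) (\<delta> 0)"
    using combination_closed[OF left_module_P p kF] by (simp add: hom_kernel_def)
  then show thesis
    using that unfolding exact_Suc by (auto simp: numeral_2_eq_2)
qed

end

text \<open>
  If \<open>P 3\<close> vanishes then \<open>Ext\<^sup>3\<close> of the trivial module into any module vanishes, in particular
  \<open>Ext\<^sup>1(K, A\<^sub>+) = 0\<close>. Hence linear maps from \<open>K\<close> to the trivial module lift to \<open>A\<close>; this is how the
  projectivity of \<open>K\<close> enters the proof.
\<close>

locale short_trivial_resolution = trivial_resolution scale gr B P \<delta> \<epsilon>
  for scale :: "'k::field \<Rightarrow> 'a::ring_1 \<Rightarrow> 'a" and gr B P \<delta> \<epsilon> +
  assumes short: "is_zero_module (P 3)"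
begin

lemma \<delta>1_inj:
  assumes "x \<in> carrier (P 2)" "y \<in> carrier (P 2)" "\<delta> 1 x = \<delta> 1 y"
  shows "x = y"
proof -
  interpret P1: abelian_group "P 1" by (rule abelian_group_P)
  interpret P2: abelian_group "P 2" by (rule abelian_group_P)
  interpret P3: abelian_group "P 3" by (rule abelian_group_P)
  have h1: "\<delta> 1 \<in> hom_module type_ring (P 2) (P 1)"
    using differential[of 1] by (simp add: numeral_2_eq_2)
  have h2: "\<delta> 2 \<in> hom_module type_ring (P 3) (P 2)"
    using differential[of 2] by (simp add: numeral_2_eq_2 numeral_3_eq_3)
  have "hom_kernel (P 2) (P 1) (\<delta> 1) = \<delta> 2 ` carrier (P 3)"
    using exact_Suc[of 1] by (simp add: numeral_2_eq_2 numeral_3_eq_3)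
  also have "\<dots> = {\<zero>\<^bsub>P 2\<^esub>}"
    using hom_module_zero[OF abelian_group_P abelian_group_P h2] short
    by (simp add: is_zero_module_def)
  finally have ker: "z = \<zero>\<^bsub>P 2\<^esub>" if "z \<in> carrier (P 2)" "\<delta> 1 z = \<zero>\<^bsub>P 1\<^esub>" for z
    using that by (auto simp: hom_kernel_def)
  let ?my = "\<ominus>\<^bsub>P 2\<^esub> y"
  have my: "?my \<in> carrier (P 2)" using assms by simp
  have "\<delta> 1 (x \<oplus>\<^bsub>P 2\<^esub> ?my) = \<delta> 1 x \<oplus>\<^bsub>P 1\<^esub> \<delta> 1 ?my"
    by (rule hom_moduleD(2)[OF h1 assms(1) my])
  also have "\<dots> = \<delta> 1 (y \<oplus>\<^bsub>P 2\<^esub> ?my)"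
    unfolding assms(3) by (rule hom_moduleD(2)[OF h1 assms(2) my, symmetric])
  also have "\<dots> = \<zero>\<^bsub>P 1\<^esub>"
    using hom_module_zero[OF abelian_group_P abelian_group_P h1] assms(2) by (simp add: P2.r_neg)
  finally have "x \<oplus>\<^bsub>P 2\<^esub> ?my = \<zero>\<^bsub>P 2\<^esub>"
    using ker[of "x \<oplus>\<^bsub>P 2\<^esub> ?my"] assms(1) my by simp
  then show ?thesis
    using assms(1,2) by (metis P2.minus_equality P2.minus_minus my P2.a_comm)
qed

text \<open>
  Let \<open>\<alpha>\<close> and \<open>\<beta>\<close> be comparison maps from \<open>F \<rightarrow> A\<close> to the resolution and back. Since \<open>P 2\<close> is
  projective, the restriction of \<open>\<phi>\<close> to \<open>P 2\<close> along \<open>\<beta>\<close> lifts to a map \<open>\<psi>\<close> into \<open>A\<close>; the map wanted is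
  \<open>\<psi> \<circ> \<alpha>\<close>. It lifts \<open>\<phi>\<close> because \<open>\<beta> \<circ> \<alpha>\<close> is homotopic to the identity, so that on relations it
  differs from the identity by elements of \<open>A\<^sub>+ K\<close>, where \<open>\<phi>\<close> vanishes.
\<close>

lemma lift_relation_functional:
  assumes \<phi>_add: "\<And>k l. k \<in> K \<Longrightarrow> l \<in> K \<Longrightarrow> \<phi> (k + l) = \<phi> k + \<phi> l"
    and \<phi>_act: "\<And>a k. k \<in> K \<Longrightarrow> \<phi> (free_act a k) = proj 0 a * \<phi> k"
    and \<phi>_gr: "\<And>k. k \<in> K \<Longrightarrow> \<phi> k \<in> gr 0"
  obtains \<psi> where "\<And>k l. k \<in> K \<Longrightarrow> l \<in> K \<Longrightarrow> \<psi> (k + l) = \<psi> k + \<psi> l"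
    "\<And>a k. k \<in> K \<Longrightarrow> \<psi> (free_act a k) = a * \<psi> k"
    "\<And>k. k \<in> K \<Longrightarrow> proj 0 (\<psi> k) = \<phi> k"
proof -
  interpret P1: left_module type_ring "P 1" by (rule left_module_P)
  interpret P2: left_module type_ring "P 2" by (rule left_module_P)
  have h1: "\<delta> 1 \<in> hom_module type_ring (P 2) (P 1)"
    using differential[of 1] by (simp add: numeral_2_eq_2)
  note \<delta>1 = hom_moduleD[OF h1]
  obtain \<beta>0 \<beta>1 where \<beta>0: "linear_map (P 0) (*) \<beta>0" "\<And>x. x \<in> carrier (P 0) \<Longrightarrow> proj 0 (\<beta>0 x) = \<epsilon> x"
    and \<beta>1: "linear_map (P 1) free_act \<beta>1" "\<And>x. x \<in> carrier (P 1) \<Longrightarrow> \<beta>1 x \<in> F"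
      "\<And>x. x \<in> carrier (P 1) \<Longrightarrow> d (\<beta>1 x) = \<beta>0 (\<delta> 0 x)"
    using chain_map_to_free by metis
  obtain e where e: "e \<in> carrier (P 0)" "\<epsilon> e = 1"
    using \<epsilon>_image one_gr by (metis imageE)
  have "\<forall>b\<in>B. \<exists>p. p \<in> carrier (P 1) \<and> \<delta> 0 p = b \<odot>\<^bsub>P 0\<^esub> e"
    using generator_preimage[OF e(1)] by metis
  then obtain p where p: "\<And>b. b \<in> B \<Longrightarrow> p b \<in> carrier (P 1)"
    and dp: "\<And>b. b \<in> B \<Longrightarrow> \<delta> 0 (p b) = b \<odot>\<^bsub>P 0\<^esub> e"
    by metis
  have "\<forall>k\<in>K. \<exists>q. q \<in> carrier (P 2) \<and> \<delta> 1 q = combination (P 1) p k"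
    using combination_relation[OF e(1) p dp] by metis
  then obtain \<alpha> where \<alpha>: "\<And>k. k \<in> K \<Longrightarrow> \<alpha> k \<in> carrier (P 2)"
    and \<delta>\<alpha>: "\<And>k. k \<in> K \<Longrightarrow> \<delta> 1 (\<alpha> k) = combination (P 1) p k"
    by metis
  have KF: "k \<in> F" if "k \<in> K" for k using that by (simp add: K_def)
  note comb_add = combination_add[OF left_module_P, of B p 1] 
    and comb_act = combination_act[OF left_module_P, of B p 1]
  have \<alpha>_add: "\<alpha> (k + l) = \<alpha> k \<oplus>\<^bsub>P 2\<^esub> \<alpha> l" if k: "k \<in> K" and l: "l \<in> K" for k l
  proof (rule \<delta>1_inj)
    show "\<delta> 1 (\<alpha> (k + l)) = \<delta> 1 (\<alpha> k \<oplus>\<^bsub>P 2\<^esub> \<alpha> l)"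
      unfolding \<delta>1(2)[OF \<alpha>[OF k] \<alpha>[OF l]] \<delta>\<alpha>[OF k] \<delta>\<alpha>[OF l] \<delta>\<alpha>[OF K.add_mem[OF k l]]
      by (rule comb_add[OF p KF[OF k] KF[OF l]])
  qed (use \<alpha> k l K.add_mem in auto)
  have \<alpha>_act: "\<alpha> (free_act a k) = a \<odot>\<^bsub>P 2\<^esub> \<alpha> k" if k: "k \<in> K" for a k
  proof (rule \<delta>1_inj)
    have "\<delta> 1 (a \<odot>\<^bsub>P 2\<^esub> \<alpha> k) = a \<odot>\<^bsub>P 1\<^esub> \<delta> 1 (\<alpha> k)" by (rule \<delta>1(3)[OF _ \<alpha>[OF k]]) simp
    then show "\<delta> 1 (\<alpha> (free_act a k)) = \<delta> 1 (a \<odot>\<^bsub>P 2\<^esub> \<alpha> k)"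
      using comb_act[OF p KF[OF k], of a] by (simp only: \<delta>\<alpha>[OF k] \<delta>\<alpha>[OF K.act_mem[OF k]])
    show "a \<odot>\<^bsub>P 2\<^esub> \<alpha> k \<in> carrier (P 2)" using P2.act_closed \<alpha>[OF k] by simp
  qed (use \<alpha> k K.act_mem in auto)
  have \<beta>1\<delta>1: "\<beta>1 (\<delta> 1 q) \<in> K" if q: "q \<in> carrier (P 2)" for q
  proof -
    have q1: "\<delta> 1 q \<in> carrier (P 1)" by (rule \<delta>1(1)[OF q])
    have "\<delta> 0 (\<delta> 1 q) = \<zero>\<^bsub>P 0\<^esub>" using \<delta>_\<delta>[of q 0] q by (simp add: numeral_2_eq_2)
    then have "d (\<beta>1 (\<delta> 1 q)) = 0"
      using \<beta>1(3)[OF q1] linear_map_zero[OF abelian_group_P \<beta>0(1)] by simp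
    then show ?thesis using \<beta>1(2)[OF q1] by (simp add: K_def)
  qed
  have lin: "linear_map (P 2) trivial_act (\<lambda>q. \<phi> (\<beta>1 (\<delta> 1 q)))"
    unfolding linear_map_def
  proof (intro conjI ballI allI)
    fix x a assume x: "x \<in> carrier (P 2)"
    have "\<beta>1 (\<delta> 1 (a \<odot>\<^bsub>P 2\<^esub> x)) = free_act a (\<beta>1 (\<delta> 1 x))"
      using \<delta>1(3)[OF _ x, of a] linear_mapD(2)[OF \<beta>1(1) \<delta>1(1)[OF x], of a] by simp
    then show "\<phi> (\<beta>1 (\<delta> 1 (a \<odot>\<^bsub>P 2\<^esub> x))) = trivial_act a (\<phi> (\<beta>1 (\<delta> 1 x)))"
      using \<phi>_act[OF \<beta>1\<delta>1[OF x]] by (simp add: trivial_act_def)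
    fix y assume y: "y \<in> carrier (P 2)"
    have "\<beta>1 (\<delta> 1 (x \<oplus>\<^bsub>P 2\<^esub> y)) = \<beta>1 (\<delta> 1 x) + \<beta>1 (\<delta> 1 y)"
      using \<delta>1(2)[OF x y] linear_mapD(1)[OF \<beta>1(1) \<delta>1(1)[OF x] \<delta>1(1)[OF y]] by simp
    then show "\<phi> (\<beta>1 (\<delta> 1 (x \<oplus>\<^bsub>P 2\<^esub> y))) = \<phi> (\<beta>1 (\<delta> 1 x)) + \<phi> (\<beta>1 (\<delta> 1 y))"
      using \<phi>_add[OF \<beta>1\<delta>1[OF x] \<beta>1\<delta>1[OF y]] by simp
  qed
  have surj0: "\<exists>x\<in>UNIV. proj 0 x = y" if "y \<in> gr 0" for y
    using proj_gr[OF that, of 0] by auto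
  have in_gr: "\<phi> (\<beta>1 (\<delta> 1 x)) \<in> gr 0" if "x \<in> carrier (P 2)" for x
    by (rule \<phi>_gr[OF \<beta>1\<delta>1[OF that]])
  obtain \<psi> where \<psi>: "linear_map (P 2) (*) \<psi>"
      "\<And>x. x \<in> carrier (P 2) \<Longrightarrow> proj 0 (\<psi> x) = \<phi> (\<beta>1 (\<delta> 1 x))"
    by (rule projective_lift_type[OF projective[of 2] type_action_UNIV type_action_trivial
          inj_encode_elem inj_encode_elem, where g = "proj 0" and f = "\<lambda>q. \<phi> (\<beta>1 (\<delta> 1 q))"])
      (use lin in_gr surj0 in
        \<open>auto simp: proj_add proj_0_mult trivial_act_def proj_in_gr\<close>)
  show thesis
  proof
    fix k l assume k: "k \<in> K" and l: "l \<in> K"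
    show "\<psi> (\<alpha> (k + l)) = \<psi> (\<alpha> k) + \<psi> (\<alpha> l)"
      unfolding \<alpha>_add[OF k l] by (rule linear_mapD(1)[OF \<psi>(1) \<alpha>[OF k] \<alpha>[OF l]])
  next
    fix a k assume k: "k \<in> K"
    show "\<psi> (\<alpha> (free_act a k)) = a * \<psi> (\<alpha> k)"
      unfolding \<alpha>_act[OF k] by (rule linear_mapD(2)[OF \<psi>(1) \<alpha>[OF k]])
  next
    fix k assume k: "k \<in> K"
    have T: "keys k \<subseteq> B" and dk: "d k = 0" using k by (auto simp: K_def free_on_def)
    \<comment> \<open>the homotopy: \<open>h\<close> is its value at \<open>1\<close>, and \<open>w b\<close> its value at the basis element \<open>b\<close>\<close>
    have "proj 0 (\<beta>0 e - 1) = 0" using \<beta>0(2)[OF e(1)] e(2) by (simp add: proj_diff proj_gr[OF one_gr])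
    then obtain h where h: "h \<in> F" "d h = \<beta>0 e - 1" by (rule augmentation_ideal_eq)
    define w where "w b = \<beta>1 (p b) - Poly_Mapping.single b 1 - free_act b h" for b
    have w: "w b \<in> K" if b: "b \<in> B" for b
    proof -
      have "d (\<beta>1 (p b)) = b * \<beta>0 e"
        using \<beta>1(3)[OF p[OF b]] dp[OF b] linear_mapD(2)[OF \<beta>0(1) e(1), of b] by simp
      then have "d (w b) = 0" by (simp add: w_def d_diff d_act h(2) right_diff_distrib)
      moreover have "w b \<in> F"
        unfolding w_def by (intro F_diff \<beta>1(2) p b single_in_free_on free.act_mem h(1))
      ultimately show ?thesis by (simp add: K_def)
    qed
    let ?s = "\<Sum>b\<in>keys k. free_act (lookup k b) (w b)"
    have "\<beta>1 (\<delta> 1 (\<alpha> k)) = (\<Sum>b\<in>keys k. free_act (lookup k b) (\<beta>1 (p b)))"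
      unfolding \<delta>\<alpha>[OF k] using linear_map_combination[OF left_module_P p \<beta>1(1) KF[OF k]] .
    also have "\<dots> = (\<Sum>b\<in>keys k. free_act (lookup k b) (Poly_Mapping.single b 1)
        + free_act (lookup k b * b) h + free_act (lookup k b) (w b))"
      by (rule sum.cong[OF HOL.refl], rule poly_mapping_eqI) (simp add: w_def lookup_add lookup_minus algebra_simps)
    also have "\<dots> = k + (\<Sum>b\<in>keys k. free_act (lookup k b * b) h) + ?s"
      by (simp add: sum.distrib free_sum_single[symmetric])
    also have "(\<Sum>b\<in>keys k. free_act (lookup k b * b) h) = free_act (d k) h"
      by (rule poly_mapping_eqI) (simp add: lookup_sum d_def free_eval_def sum_distrib_right)
    finally have eq: "\<beta>1 (\<delta> 1 (\<alpha> k)) = k + ?s" by (simp add: dk)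
    have "(\<Sum>b\<in>I. free_act (lookup k b) (w b)) \<in> K \<and> \<phi> (\<Sum>b\<in>I. free_act (lookup k b) (w b)) = 0"
      if "finite I" "I \<subseteq> keys k" for I
      using that
    proof (induction I rule: finite_induct)
      case empty
      show ?case using K.zero_mem \<phi>_add[of 0 0] by simp
    next
      case (insert b I)
      have wb: "w b \<in> K" using insert.prems T by (intro w) auto
      have "\<phi> (free_act (lookup k b) (w b)) = 0"
        using \<phi>_act[OF wb] K_degree_zero_coefficients[OF k] by simp
      moreover have "free_act (lookup k b) (w b) \<in> K" by (rule K.act_mem[OF wb])
      ultimately show ?case using insert K.add_mem \<phi>_add by simp
    qed
    from this[of "keys k"] have "?s \<in> K" "\<phi> ?s = 0" by simp_all
    then have "\<phi> (\<beta>1 (\<delta> 1 (\<alpha> k))) = \<phi> k"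
      unfolding eq using \<phi>_add[OF k] by simp
    then show "proj 0 (\<psi> (\<alpha> k)) = \<phi> k" using \<psi>(2)[OF \<alpha>[OF k]] by simp
  qed
qed

end

section \<open>Homogeneous components of linear maps\<close>

locale graded_left_module = connected_graded_algebra scale gr
  for scale :: "'k::field \<Rightarrow> 'a::ring_1 \<Rightarrow> 'a" and gr +
  fixes M :: "('a, 'm) module" and Mg :: "int \<Rightarrow> 'm set"
  assumes graded: "graded_module type_ring gr M Mg"
begin

sublocale M: left_module type_ring M
  using graded by (simp add: graded_module_def)

lemma Mg_sub: "x \<in> Mg n \<Longrightarrow> x \<in> carrier M"
  using graded additive_subgroup.a_subset[of "Mg n" M] by (auto simp: graded_module_def)

lemma Mg_zero: "\<zero>\<^bsub>M\<^esub> \<in> Mg n"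
  using graded additive_subgroup.zero_closed[of "Mg n" M] by (auto simp: graded_module_def)

lemma Mg_add: "\<lbrakk>x \<in> Mg n; y \<in> Mg n\<rbrakk> \<Longrightarrow> x \<oplus>\<^bsub>M\<^esub> y \<in> Mg n"
  using graded additive_subgroup.a_closed[of "Mg n" M] by (auto simp: graded_module_def)

lemma Mg_act: "\<lbrakk>a \<in> gr j; x \<in> Mg n\<rbrakk> \<Longrightarrow> a \<odot>\<^bsub>M\<^esub> x \<in> Mg (int j + n)"
  using graded by (auto simp: graded_module_def)

definition decomposition :: "'m \<Rightarrow> (int \<Rightarrow> 'm) \<Rightarrow> bool" where
  "decomposition x f \<longleftrightarrow> (\<forall>n. f n \<in> Mg n) \<and> finite {n. f n \<noteq> \<zero>\<^bsub>M\<^esub>} \<and>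
     x = finsum M f {n. f n \<noteq> \<zero>\<^bsub>M\<^esub>}"

definition hcomp :: "int \<Rightarrow> 'm \<Rightarrow> 'm" where
  "hcomp n x = (THE f. decomposition x f) n"

lemma ex1_decomposition: "x \<in> carrier M \<Longrightarrow> \<exists>!f. decomposition x f"
  using graded unfolding graded_module_def decomposition_def by blast

lemma decomposition_hcomp: "x \<in> carrier M \<Longrightarrow> decomposition x (\<lambda>n. hcomp n x)"
  using theI'[OF ex1_decomposition] by (simp add: hcomp_def)

lemma hcomp_Mg: "x \<in> carrier M \<Longrightarrow> hcomp n x \<in> Mg n"
  and hcomp_finite: "x \<in> carrier M \<Longrightarrow> finite {n. hcomp n x \<noteq> \<zero>\<^bsub>M\<^esub>}"
  and finsum_hcomp: "x \<in> carrier M \<Longrightarrow> finsum M (\<lambda>n. hcomp n x) {n. hcomp n x \<noteq> \<zero>\<^bsub>M\<^esub>} = x"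
  using decomposition_hcomp[of x] by (auto simp: decomposition_def)

lemma hcomp_closed: "x \<in> carrier M \<Longrightarrow> hcomp n x \<in> carrier M"
  by (rule Mg_sub[OF hcomp_Mg])

lemma finsum_support:
  assumes "finite I" "\<And>n. f n \<in> carrier M" "\<And>n. n \<notin> I \<Longrightarrow> f n = \<zero>\<^bsub>M\<^esub>"
  shows "finsum M f {n. f n \<noteq> \<zero>\<^bsub>M\<^esub>} = finsum M f I"
  using assms by (intro M.M.add.finprod_mono_neutral_cong_left) auto

lemma hcomp_eqI:
  assumes I: "finite I" "\<And>n. f n \<in> Mg n" "\<And>n. n \<notin> I \<Longrightarrow> f n = \<zero>\<^bsub>M\<^esub>" "x = finsum M f I"
  shows "hcomp n x = f n"
proof -
  have fin: "finite {n. f n \<noteq> \<zero>\<^bsub>M\<^esub>}" by (rule finite_subset[OF _ I(1)]) (use I(3) in blast)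
  have "x \<in> carrier M" unfolding I(4) using Mg_sub[OF I(2)] by (intro M.M.finsum_closed) auto
  moreover have "decomposition x f"
    using I fin finsum_support[OF I(1) Mg_sub[OF I(2)] I(3)] by (simp add: decomposition_def)
  ultimately have "f = (\<lambda>n. hcomp n x)" using ex1_decomposition decomposition_hcomp by blast
  then show ?thesis by simp
qed

lemma hcomp_superset:
  assumes "x \<in> carrier M" "finite I" "{n. hcomp n x \<noteq> \<zero>\<^bsub>M\<^esub>} \<subseteq> I"
  shows "finsum M (\<lambda>n. hcomp n x) I = x"
proof -
  have "hcomp n x = \<zero>\<^bsub>M\<^esub>" if "n \<notin> I" for n using assms(3) that by blast
  with finsum_support[OF assms(2), of "\<lambda>n. hcomp n x"] hcomp_closed[OF assms(1)]
  have "finsum M (\<lambda>n. hcomp n x) {n. hcomp n x \<noteq> \<zero>\<^bsub>M\<^esub>} = finsum M (\<lambda>n. hcomp n x) I" .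
  then show ?thesis by (simp add: finsum_hcomp[OF assms(1)])
qed

lemma hcomp_homogeneous: "x \<in> Mg m \<Longrightarrow> hcomp n x = (if n = m then x else \<zero>\<^bsub>M\<^esub>)"
  by (rule hcomp_eqI[of "{m}"]) (simp_all add: Mg_zero Mg_sub)

lemma hcomp_add:
  assumes x: "x \<in> carrier M" and y: "y \<in> carrier M"
  shows "hcomp n (x \<oplus>\<^bsub>M\<^esub> y) = hcomp n x \<oplus>\<^bsub>M\<^esub> hcomp n y"
proof (rule hcomp_eqI)
  let ?I = "{n. hcomp n x \<noteq> \<zero>\<^bsub>M\<^esub>} \<union> {n. hcomp n y \<noteq> \<zero>\<^bsub>M\<^esub>}"
  show fin: "finite ?I" using hcomp_finite x y by simp
  show "x \<oplus>\<^bsub>M\<^esub> y = finsum M (\<lambda>n. hcomp n x \<oplus>\<^bsub>M\<^esub> hcomp n y) ?I"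
    using hcomp_closed[OF x] hcomp_closed[OF y] hcomp_superset[OF x fin] hcomp_superset[OF y fin]
    by (subst M.M.finsum_addf) auto
qed (use Mg_add hcomp_Mg x y in auto)

lemma hcomp_act:
  assumes a: "a \<in> gr j" and x: "x \<in> carrier M"
  shows "hcomp n (a \<odot>\<^bsub>M\<^esub> x) = a \<odot>\<^bsub>M\<^esub> hcomp (n - int j) x"
proof (rule hcomp_eqI)
  let ?I = "{n. hcomp n x \<noteq> \<zero>\<^bsub>M\<^esub>}" and ?s = "\<lambda>n. n + int j"
  have a0: "a \<odot>\<^bsub>M\<^esub> \<zero>\<^bsub>M\<^esub> = \<zero>\<^bsub>M\<^esub>"
    using smult_finsum[OF M.left_module_axioms, of "{}" _ a] by simp
  show "finite (?s ` ?I)" using hcomp_finite[OF x] by simp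
  show "a \<odot>\<^bsub>M\<^esub> hcomp (n - int j) x \<in> Mg n" for n
    using Mg_act[OF a hcomp_Mg[OF x, of "n - int j"]] by simp
  show "a \<odot>\<^bsub>M\<^esub> hcomp (n - int j) x = \<zero>\<^bsub>M\<^esub>" if "n \<notin> ?s ` ?I" for n
  proof -
    have "hcomp (n - int j) x = \<zero>\<^bsub>M\<^esub>"
      using that by (metis (mono_tags, lifting) diff_add_cancel image_eqI mem_Collect_eq)
    then show ?thesis by (simp add: a0)
  qed
  have "finsum M (\<lambda>n. a \<odot>\<^bsub>M\<^esub> hcomp (n - int j) x) (?s ` ?I) =
      finsum M (\<lambda>n. a \<odot>\<^bsub>M\<^esub> hcomp n x) ?I"
    using hcomp_closed[OF x] by (subst M.M.add.finprod_reindex) (auto simp: M.act_closed)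
  also have "\<dots> = a \<odot>\<^bsub>M\<^esub> x"
    using smult_finsum[OF M.left_module_axioms hcomp_finite[OF x], of "\<lambda>n. hcomp n x" a]
      hcomp_closed[OF x] by (simp add: finsum_hcomp[OF x])
  finally show "a \<odot>\<^bsub>M\<^esub> x = finsum M (\<lambda>n. a \<odot>\<^bsub>M\<^esub> hcomp (n - int j) x) (?s ` ?I)" by simp
qed

lemma linear_map_hcomp:
  assumes "linear_map M act h" "x \<in> carrier M" "finite I" "{n. hcomp n x \<noteq> \<zero>\<^bsub>M\<^esub>} \<subseteq> I"
  shows "(\<Sum>n\<in>I. h (hcomp n x)) = h x"
  using linear_map_finsum[OF M.M.abelian_group_axioms assms(1,3), of "\<lambda>n. hcomp n x"]
    hcomp_closed[OF assms(2)] hcomp_superset[OF assms(2-4)] by simp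

text \<open>The component of degree \<open>s\<close> of a linear map, where \<open>q\<close> are the projections of the target.\<close>

definition hom_component ::
    "(int \<Rightarrow> 'n \<Rightarrow> 'n) \<Rightarrow> int \<Rightarrow> ('m \<Rightarrow> 'n::ab_group_add) \<Rightarrow> 'm \<Rightarrow> 'n" where
  "hom_component q s h x = (\<Sum>n | hcomp n x \<noteq> \<zero>\<^bsub>M\<^esub>. q (n + s) (h (hcomp n x)))"

context
  fixes act :: "'a \<Rightarrow> 'n::ab_group_add \<Rightarrow> 'n" and q :: "int \<Rightarrow> 'n \<Rightarrow> 'n" and h :: "'m \<Rightarrow> 'n"
  assumes h: "linear_map M act h"
    and act_left: "\<And>a b y. act (a + b) y = act a y + act b y"
    and act_right: "\<And>a y z. act a (y + z) = act a y + act a z"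
    and q_add: "\<And>n y z. q n (y + z) = q n y + q n z"
    and q_act: "\<And>a j n y. a \<in> gr j \<Longrightarrow> q n (act a y) = act a (q (n - int j) y)"
begin

lemma q_zero: "q n 0 = 0"
  using q_add[of n 0 0] by simp

lemma hom_component_superset:
  assumes "x \<in> carrier M" "finite I" "{n. hcomp n x \<noteq> \<zero>\<^bsub>M\<^esub>} \<subseteq> I"
  shows "hom_component q s h x = (\<Sum>n\<in>I. q (n + s) (h (hcomp n x)))"
  unfolding hom_component_def
  using linear_map_zero[OF M.M.abelian_group_axioms h] assms
  by (intro sum.mono_neutral_left) (auto simp: q_zero)

lemma hom_component_add:
  assumes x: "x \<in> carrier M" and y: "y \<in> carrier M"
  shows "hom_component q s h (x \<oplus>\<^bsub>M\<^esub> y) = hom_component q s h x + hom_component q s h y"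
proof -
  let ?I = "{n. hcomp n x \<noteq> \<zero>\<^bsub>M\<^esub>} \<union> {n. hcomp n y \<noteq> \<zero>\<^bsub>M\<^esub>}"
  have fin: "finite ?I" using hcomp_finite x y by simp
  have "hom_component q s h (x \<oplus>\<^bsub>M\<^esub> y) = (\<Sum>n\<in>?I. q (n + s) (h (hcomp n (x \<oplus>\<^bsub>M\<^esub> y))))"
    using x y fin by (intro hom_component_superset) (auto simp: hcomp_add)
  also have "\<dots> = (\<Sum>n\<in>?I. q (n + s) (h (hcomp n x))) + (\<Sum>n\<in>?I. q (n + s) (h (hcomp n y)))"
    using hcomp_closed[OF x] hcomp_closed[OF y] x y
    by (simp add: hcomp_add linear_mapD(1)[OF h] q_add sum.distrib)
  also have "\<dots> = hom_component q s h x + hom_component q s h y"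
    using hom_component_superset[OF x fin] hom_component_superset[OF y fin] by auto
  finally show ?thesis .
qed

lemma linear_map_hom_component: "linear_map M act (hom_component q s h)"
proof -
  have act0: "act a 0 = 0" for a using act_right[of a 0 0] by simp
  have act_sum: "act a (sum f I) = (\<Sum>i\<in>I. act a (f i))" for a f and I :: "int set"
    by (induction I rule: infinite_finite_induct) (auto simp: act0 act_right)
  have "\<forall>x\<in>carrier M. hom_component q s h (a \<odot>\<^bsub>M\<^esub> x) = act a (hom_component q s h x)" for a
  proof (induction a rule: graded_induct)
    case (add a b)
    then show ?case
      using M.act_closed by (simp add: M.act_l_distr[of a b, simplified] hom_component_add act_left)
  next
    case (homogeneous j a)
    show ?case
    proof
      fix x assume x: "x \<in> carrier M"
      let ?I = "{n. hcomp n x \<noteq> \<zero>\<^bsub>M\<^esub>}" and ?s = "\<lambda>n. n + int j"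
      have a0: "a \<odot>\<^bsub>M\<^esub> \<zero>\<^bsub>M\<^esub> = \<zero>\<^bsub>M\<^esub>"
        using smult_finsum[OF M.left_module_axioms, of "{}" _ a] by simp
      have ax: "a \<odot>\<^bsub>M\<^esub> x \<in> carrier M" using M.act_closed x by simp
      have sub: "{n. hcomp n (a \<odot>\<^bsub>M\<^esub> x) \<noteq> \<zero>\<^bsub>M\<^esub>} \<subseteq> ?s ` ?I"
      proof
        fix n assume "n \<in> {n. hcomp n (a \<odot>\<^bsub>M\<^esub> x) \<noteq> \<zero>\<^bsub>M\<^esub>}"
        then have "n - int j \<in> ?I" using a0 by (auto simp: hcomp_act[OF homogeneous x])
        then show "n \<in> ?s ` ?I" by (intro image_eqI[of _ _ "n - int j"]) auto
      qed
      have "hom_component q s h (a \<odot>\<^bsub>M\<^esub> x) =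
          (\<Sum>n\<in>?s ` ?I. q (n + s) (h (hcomp n (a \<odot>\<^bsub>M\<^esub> x))))"
        using hcomp_finite[OF x] by (intro hom_component_superset[OF ax _ sub]) auto
      also have "\<dots> = (\<Sum>n\<in>?I. q (n + int j + s) (act a (h (hcomp n x))))"
        using hcomp_closed[OF x]
        by (subst sum.reindex) (auto simp: hcomp_act[OF homogeneous x] linear_mapD(2)[OF h])
      also have "\<dots> = (\<Sum>n\<in>?I. act a (q (n + s) (h (hcomp n x))))"
        by (simp add: q_act[OF homogeneous] algebra_simps)
      finally show "hom_component q s h (a \<odot>\<^bsub>M\<^esub> x) = act a (hom_component q s h x)"
        by (simp add: hom_component_def act_sum)
    qed
  qed
  then show ?thesis by (simp add: linear_map_def hom_component_add)
qed

lemma hom_component_homogeneous: "x \<in> Mg n \<Longrightarrow> hom_component q s h x = q (n + s) (h x)"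
  by (subst hom_component_superset[of _ "{n}"])
    (auto simp: Mg_sub hcomp_homogeneous split: if_splits)

end

end

lemma graded_hom_hcomp:
  assumes "graded_left_module scale gr M Mg" "graded_left_module scale gr N Ng"
    and f: "f \<in> hom_module type_ring M N" and fg: "\<And>n. f ` Mg n \<subseteq> Ng n" and x: "x \<in> carrier M"
  shows "f (graded_left_module.hcomp M Mg n x) = graded_left_module.hcomp N Ng n (f x)"
proof -
  interpret M: graded_left_module scale gr M Mg by fact
  interpret N: graded_left_module scale gr N Ng by fact
  let ?I = "{n. M.hcomp n x \<noteq> \<zero>\<^bsub>M\<^esub>}"
  have "N.hcomp n (f x) = f (M.hcomp n x)"
  proof (rule N.hcomp_eqI)
    show fin: "finite ?I" by (rule M.hcomp_finite[OF x])
    show "f (M.hcomp n x) \<in> Ng n" for n using fg M.hcomp_Mg[OF x] by blast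
    show "f (M.hcomp n x) = \<zero>\<^bsub>N\<^esub>" if "n \<notin> ?I" for n
      using that hom_module_zero[OF M.M.M.abelian_group_axioms N.M.M.abelian_group_axioms f] by simp
    have "f x = f (finsum M (\<lambda>n. M.hcomp n x) ?I)" by (simp only: M.finsum_hcomp[OF x])
    then show "f x = finsum N (\<lambda>n. f (M.hcomp n x)) ?I"
      using hom_module_finsum[OF M.M.M.abelian_group_axioms N.M.M.abelian_group_axioms f fin]
        M.hcomp_closed[OF x] by simp
  qed
  then show ?thesis by simp
qed

lemma finsum_type_module:
  assumes "type_action S act" "finite I" "\<And>i. i \<in> I \<Longrightarrow> f i \<in> S"
  shows "finsum (type_module S act) f I = sum f I"
proof -
  interpret type_action S act by fact
  interpret left_module type_ring "type_module S act" by (rule left_module_type_module)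
  show ?thesis using assms(2,3)
    by (induction I rule: finite_induct) (simp_all add: Pi_iff)
qed

context generated_algebra
begin

definition Kg :: "int \<Rightarrow> ('a \<Rightarrow>\<^sub>0 'a) set" where
  "Kg n = {k \<in> K. fproj n k = k}"

lemma fproj_Kg: "k \<in> K \<Longrightarrow> fproj n k \<in> Kg n"
  by (simp add: Kg_def fproj_K fproj_fproj)

lemma fproj_sum: "fproj n (sum f I) = (\<Sum>i\<in>I. fproj n (f i))"
  by (induction I rule: infinite_finite_induct) (auto simp: fproj_add)

lemma fproj_uminus: "fproj n (- k) = - fproj n k"
  using fproj_add[of n k "- k"] by (simp add: eq_neg_iff_add_eq_0 add.commute)

text \<open>
  The module of relations is a graded module, so that components of linear maps on \<open>K\<close> are covered by
  the general construction.
\<close>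

lemma graded_left_module_K: "graded_left_module scale gr (type_module K free_act) Kg"
proof (unfold_locales, unfold graded_module_def, intro conjI allI ballI impI)
  show lm: "left_module type_ring (type_module K free_act)"
    by (rule K.left_module_type_module)
  interpret K: left_module type_ring "type_module K free_act" by (rule lm)
  fix n
  show "additive_subgroup (Kg n) (type_module K free_act)"
  proof (rule additive_subgroup.intro, rule K.M.add.subgroupI)
    show "Kg n \<noteq> {}" using K.zero_mem by (auto simp: Kg_def)
    fix k assume k: "k \<in> Kg n"
    then have "\<ominus>\<^bsub>type_module K free_act\<^esub> k = - k"
      by (intro K.M.minus_equality) (auto simp: Kg_def K.minus_mem)
    with k show "\<ominus>\<^bsub>type_module K free_act\<^esub> k \<in> Kg n"
      by (simp add: Kg_def K.minus_mem fproj_uminus)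
  qed (auto simp: Kg_def fproj_add K.add_mem)
next
  fix k assume "k \<in> carrier (type_module K free_act)"
  then have k: "k \<in> K" by simp
  have fs: "finsum (type_module K free_act) f I = sum f I" if "\<forall>n. f n \<in> Kg n" "finite I" for f I
    using that by (intro finsum_type_module[OF type_action_K]) (auto simp: Kg_def)
  show "\<exists>!f. (\<forall>n. f n \<in> Kg n) \<and> finite {n. f n \<noteq> \<zero>\<^bsub>type_module K free_act\<^esub>} \<and>
      k = finsum (type_module K free_act) f {n. f n \<noteq> \<zero>\<^bsub>type_module K free_act\<^esub>}"
  proof (rule ex1I[of _ "\<lambda>n. fproj n k"])
    show "(\<forall>n. fproj n k \<in> Kg n) \<and> finite {n. fproj n k \<noteq> \<zero>\<^bsub>type_module K free_act\<^esub>} \<and>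
      k = finsum (type_module K free_act) (\<lambda>n. fproj n k) {n. fproj n k \<noteq> \<zero>\<^bsub>type_module K free_act\<^esub>}"
      using fproj_Kg[OF k] fproj_finite[of k] sum_fproj[of k] by (simp add: fs)
    fix f assume f: "(\<forall>n. f n \<in> Kg n) \<and> finite {n. f n \<noteq> \<zero>\<^bsub>type_module K free_act\<^esub>} \<and>
      k = finsum (type_module K free_act) f {n. f n \<noteq> \<zero>\<^bsub>type_module K free_act\<^esub>}"
    let ?I = "{n. f n \<noteq> 0}"
    have fin: "finite ?I" and "k = sum f ?I" using f by (auto simp: fs)
    then have "fproj m k = (\<Sum>n\<in>?I. fproj m (f n))" for m by (simp add: fproj_sum)
    also have "(\<Sum>n\<in>?I. fproj m (f n)) = (\<Sum>n\<in>?I. if m = n then f n else 0)" for m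
    proof (rule sum.cong[OF HOL.refl])
      fix n
      have "fproj n (f n) = f n" using f by (simp add: Kg_def)
      then show "fproj m (f n) = (if m = n then f n else 0)" using fproj_fproj[of m n "f n"] by simp
    qed
    finally have "fproj m k = f m" for m using fin by simp
    then show "f = (\<lambda>n. fproj n k)" by auto
  qed
next
  fix m n a k assume "a \<in> gr m" "k \<in> Kg n"
  then show "a \<odot>\<^bsub>type_module K free_act\<^esub> k \<in> Kg (int m + n)"
    by (simp add: Kg_def K.act_mem fproj_act)
qed

lemma relation_hom_component:
  assumes "\<And>k l. k \<in> K \<Longrightarrow> l \<in> K \<Longrightarrow> \<psi> (k + l) = \<psi> k + \<psi> l"
    and "\<And>a k. k \<in> K \<Longrightarrow> \<psi> (free_act a k) = a * \<psi> k"
  obtains \<psi>' where "\<And>k l. k \<in> K \<Longrightarrow> l \<in> K \<Longrightarrow> \<psi>' (k + l) = \<psi>' k + \<psi>' l"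
    "\<And>a k. k \<in> K \<Longrightarrow> \<psi>' (free_act a k) = a * \<psi>' k"
    "\<And>n k. k \<in> Kg n \<Longrightarrow> \<psi>' k = iproj (n + s) (\<psi> k)"
proof -
  interpret K: graded_left_module scale gr "type_module K free_act" Kg
    by (rule graded_left_module_K)
  have lin: "linear_map (type_module K free_act) (*) \<psi>"
    using assms by (auto simp: linear_map_def)
  have "linear_map (type_module K free_act) (*) (K.hom_component iproj s \<psi>)"
    by (rule K.linear_map_hom_component[OF lin])
      (auto simp: distrib_left distrib_right iproj_add iproj_mult_left)
  moreover have "K.hom_component iproj s \<psi> k = iproj (n + s) (\<psi> k)" if "k \<in> Kg n" for k n
    using that by (rule K.hom_component_homogeneous[OF lin, rotated -1])
      (auto simp: distrib_left distrib_right iproj_add iproj_mult_left)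
  ultimately show thesis
    by (intro that[of "K.hom_component iproj s \<psi>"]) (auto simp: linear_map_def)
qed

end

section \<open>The second Ext group\<close>

lemma hom_regular_module_iff:
  "f \<in> hom_module type_ring P (regular_module type_ring) \<longleftrightarrow>
     f \<in> extensional (carrier P) \<and> linear_map P (*) f"
  by (auto simp: hom_module_def linear_map_def PiE_def)

lemma finsum_type_ring:
  fixes f :: "'i \<Rightarrow> 'a::ring_1"
  shows "finite I \<Longrightarrow> finsum type_ring f I = sum f I"
proof -
  interpret ring "type_ring :: 'a ring" by (rule ring_type_ring)
  show "finite I \<Longrightarrow> finsum type_ring f I = sum f I"
    by (induction I rule: finite_induct) (simp_all add: Pi_iff)
qed

context graded_left_module
begin

text \<open>
  The case distinction on the sign of the degree disappears when it is expressed by projections.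
\<close>

lemma hom_degree_iff:
  "f \<in> hom_degree type_ring gr M Mg n \<longleftrightarrow>
     f \<in> extensional (carrier M) \<and> linear_map M (*) f \<and>
     (\<forall>m. \<forall>x\<in>Mg m. iproj (m + n) (f x) = f x)"
proof -
  have "f ` Mg m \<subseteq> (if m + n < 0 then {\<zero>\<^bsub>type_ring\<^esub>} else gr (nat (m + n))) \<longleftrightarrow>
      (\<forall>x\<in>Mg m. iproj (m + n) (f x) = f x)" for m
    by (auto simp: image_subset_iff iproj_def proj_gr) (metis proj_in_gr)
  then show ?thesis unfolding hom_degree_def by (simp add: hom_regular_module_iff)
qed

lemma hom_degree_add:
  assumes "f \<in> hom_degree type_ring gr M Mg n" "g \<in> hom_degree type_ring gr M Mg n"
  shows "(\<lambda>x\<in>carrier M. f x + g x) \<in> hom_degree type_ring gr M Mg n"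
proof -
  have "iproj (m + n) ((\<lambda>x\<in>carrier M. f x + g x) x) = (\<lambda>x\<in>carrier M. f x + g x) x"
    if "x \<in> Mg m" for x m
    using assms that Mg_sub[OF that] by (simp add: hom_degree_iff iproj_add)
  moreover have "linear_map M (*) (\<lambda>x\<in>carrier M. f x + g x)"
    using assms M.act_closed by (simp add: hom_degree_iff linear_map_def distrib_left)
  ultimately show ?thesis by (simp add: hom_degree_iff)
qed

lemma hom_degree_zero: "(\<lambda>x\<in>carrier M. 0) \<in> hom_degree type_ring gr M Mg n"
  using M.act_closed Mg_sub by (auto simp: hom_degree_iff linear_map_def)

lemma hom_degree_mult:
  assumes "f \<in> hom_degree type_ring gr M Mg n" "a \<in> gr j"
  shows "(\<lambda>x\<in>carrier M. f x * a) \<in> hom_degree type_ring gr M Mg (n + int j)"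
proof -
  have "iproj (m + (n + int j)) ((\<lambda>x\<in>carrier M. f x * a) x) = (\<lambda>x\<in>carrier M. f x * a) x"
    if "x \<in> Mg m" for x m
    using assms that Mg_sub[OF that] by (simp add: hom_degree_iff iproj_mult_right algebra_simps)
  moreover have "linear_map M (*) (\<lambda>x\<in>carrier M. f x * a)"
    using assms M.act_closed by (simp add: hom_degree_iff linear_map_def distrib_right mult.assoc)
  ultimately show ?thesis by (simp add: hom_degree_iff)
qed

lemma graded_dualE:
  assumes "f \<in> carrier (graded_dual type_ring gr M Mg)"
  obtains N H where "finite N" "\<And>n. H n \<in> hom_degree type_ring gr M Mg n"
    "\<And>x. x \<in> carrier M \<Longrightarrow> f x = (\<Sum>n\<in>N. H n x)" "linear_map M (*) f"
proof -
  obtain N H where NH: "finite N" "\<forall>n\<in>N. H n \<in> hom_degree type_ring gr M Mg n"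
    "\<forall>x\<in>carrier M. f x = finsum type_ring (\<lambda>n. H n x) N"
    and f: "linear_map M (*) f"
    using assms by (auto simp: graded_dual_def hom_regular_module_iff)
  show thesis
  proof (rule that)
    show "(if n \<in> N then H n else (\<lambda>x\<in>carrier M. 0)) \<in> hom_degree type_ring gr M Mg n" for n
      using NH(2) hom_degree_zero by simp
    show "f x = (\<Sum>n\<in>N. (if n \<in> N then H n else (\<lambda>x\<in>carrier M. 0)) x)" if "x \<in> carrier M" for x
      using NH(1,3) that by (simp add: finsum_type_ring)
  qed (fact NH(1) f)+
qed

lemma graded_dualI:
  assumes "f \<in> extensional (carrier M)" "linear_map M (*) f" "finite N"
    "\<And>n. H n \<in> hom_degree type_ring gr M Mg n" 
    "\<And>x. x \<in> carrier M \<Longrightarrow> f x = (\<Sum>n\<in>N. H n x)"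
  shows "f \<in> carrier (graded_dual type_ring gr M Mg)"
proof -
  have "f \<in> hom_module type_ring M (regular_module type_ring)"
    using assms(1,2) by (simp add: hom_regular_module_iff)
  moreover have "\<forall>x\<in>carrier M. f x = finsum type_ring (\<lambda>n. H n x) N"
    using assms(3,5) by (simp add: finsum_type_ring)
  ultimately show ?thesis
    using assms(3,4) unfolding graded_dual_def by auto
qed

lemma graded_dual_zero: "(\<lambda>x\<in>carrier M. 0) \<in> carrier (graded_dual type_ring gr M Mg)"
  using M.act_closed hom_degree_zero
  by (intro graded_dualI[where N = "{}" and H = "\<lambda>_. \<lambda>x\<in>carrier M. 0"])
    (simp_all add: linear_map_def)

lemma graded_dual_add:
  assumes "f \<in> carrier (graded_dual type_ring gr M Mg)" "g \<in> carrier (graded_dual type_ring gr M Mg)"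
  shows "(\<lambda>x\<in>carrier M. f x + g x) \<in> carrier (graded_dual type_ring gr M Mg)"
proof -
  obtain N H where f: "finite N" "\<And>n. H n \<in> hom_degree type_ring gr M Mg n"
      "\<And>x. x \<in> carrier M \<Longrightarrow> f x = (\<Sum>n\<in>N. H n x)" "linear_map M (*) f"
    by (rule graded_dualE[OF assms(1)]) (rule that)
  obtain N' H' where g: "finite N'" "\<And>n. H' n \<in> hom_degree type_ring gr M Mg n"
      "\<And>x. x \<in> carrier M \<Longrightarrow> g x = (\<Sum>n\<in>N'. H' n x)" "linear_map M (*) g"
    by (rule graded_dualE[OF assms(2)]) (rule that)
  let ?z = "\<lambda>x\<in>carrier M. 0 :: 'a"
  let ?H = "\<lambda>n. \<lambda>x\<in>carrier M. (if n \<in> N then H n else ?z) x + (if n \<in> N' then H' n else ?z) x"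
  have "?H n \<in> hom_degree type_ring gr M Mg n" for n
    using f(2) g(2) hom_degree_zero by (intro hom_degree_add) simp_all
  moreover have "f x + g x = (\<Sum>n\<in>N \<union> N'. ?H n x)" if x: "x \<in> carrier M" for x
  proof -
    have "(\<Sum>n\<in>N \<union> N'. ?H n x) = (\<Sum>n\<in>N \<union> N'. if n \<in> N then H n x else 0) +
        (\<Sum>n\<in>N \<union> N'. if n \<in> N' then H' n x else 0)"
      using x by (simp add: sum.distrib if_distrib[of "\<lambda>f. f x"] cong: if_cong)
    also have "(\<Sum>n\<in>N \<union> N'. if n \<in> N then H n x else 0) = f x"
      using f(1) g(1) by (simp add: sum.If_cases Int_absorb1 f(3)[OF x])
    also have "(\<Sum>n\<in>N \<union> N'. if n \<in> N' then H' n x else 0) = g x"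
      using f(1) g(1) by (simp add: sum.If_cases Int_absorb1 g(3)[OF x])
    finally show ?thesis by simp
  qed
  moreover have "linear_map M (*) (\<lambda>x\<in>carrier M. f x + g x)"
    using f(4) g(4) M.act_closed by (simp add: linear_map_def distrib_left)
  ultimately show ?thesis
    using f(1) g(1) by (intro graded_dualI[where N = "N \<union> N'" and H = ?H]) simp_all
qed

lemma graded_dual_mult:
  assumes "f \<in> carrier (graded_dual type_ring gr M Mg)" "a \<in> gr j"
  shows "(\<lambda>x\<in>carrier M. f x * a) \<in> carrier (graded_dual type_ring gr M Mg)"
proof -
  obtain N H where f: "finite N" "\<And>n. H n \<in> hom_degree type_ring gr M Mg n"
      "\<And>x. x \<in> carrier M \<Longrightarrow> f x = (\<Sum>n\<in>N. H n x)" "linear_map M (*) f"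
    by (rule graded_dualE[OF assms(1)]) (rule that)
  let ?H = "\<lambda>n. \<lambda>x\<in>carrier M. H (n - int j) x * a"
  have "?H n \<in> hom_degree type_ring gr M Mg n" for n
    using hom_degree_mult[OF f(2)[of "n - int j"] assms(2)] by simp
  moreover have "f x * a = (\<Sum>n\<in>(\<lambda>n. n + int j) ` N. ?H n x)" if "x \<in> carrier M" for x
    using that by (subst sum.reindex) (auto simp: f(3) sum_distrib_right)
  moreover have "linear_map M (*) (\<lambda>x\<in>carrier M. f x * a)"
    using f(4) M.act_closed by (simp add: linear_map_def distrib_right mult.assoc)
  ultimately show ?thesis
    using f(1) by (intro graded_dualI[where N = "(\<lambda>n. n + int j) ` N" and H = ?H]) simp_all
qed

lemma graded_dual_degree:
  assumes "f \<in> hom_degree type_ring gr M Mg s"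
  shows "f \<in> carrier (graded_dual type_ring gr M Mg)"
proof -
  let ?H = "\<lambda>n. if n = s then f else (\<lambda>x\<in>carrier M. 0)"
  have "?H n \<in> hom_degree type_ring gr M Mg n" for n using assms hom_degree_zero by simp
  moreover have "f \<in> extensional (carrier M)" "linear_map M (*) f"
    using assms unfolding hom_degree_iff by blast+
  ultimately show ?thesis
    by (intro graded_dualI[where N = "{s}" and H = ?H]) simp_all
qed

end

text \<open>
  If \<open>Ext\<^sup>2\<close> is isomorphic to the trivial right module then the class of a cocycle \<open>c\<close> has a coordinate
  \<open>\<Lambda> c\<close>, and the coordinate of the class of \<open>c a\<close> is \<open>\<Lambda> c a\<close> modulo \<open>A\<^sub>+\<close>. So cocycles with the same
  coordinate modulo \<open>A\<^sub>+\<close> differ by a coboundary \<open>g \<circ> \<delta> 1\<close>. Only homogeneous multipliers are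
  considered, since multiplication by them preserves the graded dual termwise.
\<close>

lemma (in connected_graded_algebra) ext_two_cocycles:
  assumes gP: "\<And>i. graded_left_module scale gr (P i) (Pg i)"
    and \<delta>: "\<delta> 1 \<in> hom_module type_ring (P 2) (P 1)" "\<delta> 2 \<in> hom_module type_ring (P 3) (P 2)"
    and iso: "graded_isomorphic (opposite_ring type_ring) (ext_module type_ring gr P Pg \<delta> 2) Eg
      (trivial_module (opposite_ring type_ring) (positive_part scale gr)) Tg"
  obtains \<Lambda> where "\<And>c1 c2 a1 a2 j1 j2. \<lbrakk>c1 \<in> ext_cocycles type_ring gr P Pg \<delta> 2;
      c2 \<in> ext_cocycles type_ring gr P Pg \<delta> 2; a1 \<in> gr j1; a2 \<in> gr j2;
      proj 0 (\<Lambda> c1 * a1) = proj 0 (\<Lambda> c2 * a2)\<rbrakk> \<Longrightarrow>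
    \<exists>g. linear_map (P 1) (*) g \<and> (\<forall>x\<in>carrier (P 2). c1 x * a1 = g (\<delta> 1 x) + c2 x * a2)"
proof -
  interpret P1: graded_left_module scale gr "P 1" "Pg 1" by (rule gP)
  interpret P2: graded_left_module scale gr "P 2" "Pg 2" by (rule gP)
  let ?Z = "ext_cocycles type_ring gr P Pg \<delta> 2" and ?N = "ext_coboundaries type_ring gr P Pg \<delta> 2"
  let ?M = "(graded_dual type_ring gr (P 2) (Pg 2))\<lparr>carrier := ?Z\<rparr>"
  let ?E = "ext_module type_ring gr P Pg \<delta> 2"
  let ?Ap = "positive_part scale gr"
  let ?T = "trivial_module (opposite_ring type_ring) ?Ap"
  have N: "?N = (\<lambda>f. compose (carrier (P 2)) f (\<delta> 1)) ` carrier (graded_dual type_ring gr (P 1) (Pg 1))"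
    by (simp add: numeral_2_eq_2)
  have Z: "c \<in> ?Z \<longleftrightarrow> c \<in> carrier (graded_dual type_ring gr (P 2) (Pg 2)) \<and>
      (\<forall>x\<in>carrier (P 3). c (\<delta> 2 x) = 0)" for c
    by (simp add: ext_cocycles_def numeral_2_eq_2 numeral_3_eq_3)
  \<comment> \<open>the classes of cocycles as sets of functions\<close>
  define cos where "cos c = {(\<lambda>x\<in>carrier (P 2). n x + c x) | n. n \<in> ?N}" for c
  have coset: "?N +>\<^bsub>?M\<^esub> c = cos c" for c
    by (auto simp: a_r_coset_def' cos_def graded_dual_def)
  have ext_carrier: "carrier ?E = cos ` ?Z"
    by (auto simp: ext_module_def quotient_module_def A_RCOSETS_def' coset)
  have mult_Z: "(\<lambda>x\<in>carrier (P 2). c x * a) \<in> ?Z" if "c \<in> ?Z" "a \<in> gr j" for c a j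
    using that P2.graded_dual_mult[of c a j] hom_moduleD(1)[OF \<delta>(2)] by (auto simp: Z)
  have zero_N: "(\<lambda>x\<in>carrier (P 2). 0) \<in> ?N"
    unfolding N
  proof (rule image_eqI[OF _ P1.graded_dual_zero])
    show "(\<lambda>x\<in>carrier (P 2). 0) = compose (carrier (P 2)) (\<lambda>x\<in>carrier (P 1). 0) (\<delta> 1)"
      using hom_moduleD(1)[OF \<delta>(1)] by (auto simp: compose_def fun_eq_iff)
  qed
  have add_N: "(\<lambda>x\<in>carrier (P 2). n x + n' x) \<in> ?N" if nn': "n \<in> ?N" "n' \<in> ?N" for n n'
  proof -
    obtain f f' where f: "f \<in> carrier (graded_dual type_ring gr (P 1) (Pg 1))"
        "n = compose (carrier (P 2)) f (\<delta> 1)"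
      and f': "f' \<in> carrier (graded_dual type_ring gr (P 1) (Pg 1))"
        "n' = compose (carrier (P 2)) f' (\<delta> 1)"
      using nn' unfolding N by auto
    show ?thesis unfolding N
    proof (rule image_eqI[OF _ P1.graded_dual_add[OF f(1) f'(1)]])
      show "(\<lambda>x\<in>carrier (P 2). n x + n' x) =
          compose (carrier (P 2)) (\<lambda>x\<in>carrier (P 1). f x + f' x) (\<delta> 1)"
        using hom_moduleD(1)[OF \<delta>(1)] by (auto simp: compose_def fun_eq_iff f f')
    qed
  qed
  have mult_N: "(\<lambda>x\<in>carrier (P 2). n x * a) \<in> ?N" if na: "n \<in> ?N" "a \<in> gr j" for n a j
  proof -
    obtain f where f: "f \<in> carrier (graded_dual type_ring gr (P 1) (Pg 1))"
        "n = compose (carrier (P 2)) f (\<delta> 1)"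
      using na unfolding N by auto
    show ?thesis unfolding N
    proof (rule image_eqI[OF _ P1.graded_dual_mult[OF f(1) na(2)]])
      show "(\<lambda>x\<in>carrier (P 2). n x * a) =
          compose (carrier (P 2)) (\<lambda>x\<in>carrier (P 1). f x * a) (\<delta> 1)"
        using hom_moduleD(1)[OF \<delta>(1)] by (auto simp: compose_def fun_eq_iff f)
    qed
  qed
  have smult_E: "a \<odot>\<^bsub>?E\<^esub> cos c = cos (\<lambda>x\<in>carrier (P 2). c x * a)"
    if "a \<in> gr j" for a c j
  proof -
    have "a \<odot>\<^bsub>?E\<^esub> cos c = (\<Union>x\<in>cos c. cos (\<lambda>y\<in>carrier (P 2). x y * a))"
      by (simp add: ext_module_def quotient_module_def coset) (simp add: graded_dual_def)
    also have "\<dots> = cos (\<lambda>x\<in>carrier (P 2). c x * a)" (is "?L = ?R")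
    proof (intro equalityI subsetI)
      fix y assume "y \<in> ?L"
      then obtain n n' where n: "n \<in> ?N" "n' \<in> ?N" 
        and y: "y = (\<lambda>z\<in>carrier (P 2). n' z + (n z + c z) * a)"
        by (auto simp: cos_def cong: restrict_cong)
      have "y = (\<lambda>z\<in>carrier (P 2). (\<lambda>z\<in>carrier (P 2). n' z + (\<lambda>z\<in>carrier (P 2). n z * a) z) z +
          (\<lambda>x\<in>carrier (P 2). c x * a) z)"
        unfolding y by (auto simp: fun_eq_iff algebra_simps)
      moreover have "(\<lambda>z\<in>carrier (P 2). n' z + (\<lambda>z\<in>carrier (P 2). n z * a) z) \<in> ?N"
        by (rule add_N[OF n(2) mult_N[OF n(1) that]])
      ultimately show "y \<in> ?R" unfolding cos_def by blast
    next
      fix y assume "y \<in> ?R"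
      then obtain n where n: "n \<in> ?N" and y: "y = (\<lambda>z\<in>carrier (P 2). n z + c z * a)"
        by (auto simp: cos_def cong: restrict_cong)
      let ?x = "\<lambda>z\<in>carrier (P 2). (\<lambda>x\<in>carrier (P 2). 0) z + c z"
      have "?x \<in> cos c" unfolding cos_def using zero_N by blast
      moreover have "y = (\<lambda>z\<in>carrier (P 2). n z + (\<lambda>y\<in>carrier (P 2). ?x y * a) z)"
        unfolding y by (auto simp: fun_eq_iff)
      ultimately show "y \<in> ?L" using n unfolding cos_def by blast
    qed
    finally show ?thesis .
  qed
  note T = trivial_module_simps[OF disjI2[OF HOL.refl]]
  obtain \<phi> where \<phi>: "\<phi> \<in> hom_module (opposite_ring type_ring) ?E ?T" "inj_on \<phi> (carrier ?E)"
    using iso unfolding graded_isomorphic_def bij_betw_def by blast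
  have "\<exists>l. \<phi> (cos c) = residue_class l" if "c \<in> ?Z" for c
    using hom_moduleD(1)[OF \<phi>(1), of "cos c"] that by (auto simp: ext_carrier T)
  then obtain \<Lambda> where \<Lambda>: "\<And>c. c \<in> ?Z \<Longrightarrow> \<phi> (cos c) = residue_class (\<Lambda> c)" by metis
  show thesis
  proof (rule that)
    fix c1 c2 a1 a2 j1 j2
    assume c: "c1 \<in> ?Z" "c2 \<in> ?Z" and a: "a1 \<in> gr j1" "a2 \<in> gr j2"
      and eq: "proj 0 (\<Lambda> c1 * a1) = proj 0 (\<Lambda> c2 * a2)"
    let ?c1 = "\<lambda>x\<in>carrier (P 2). c1 x * a1" and ?c2 = "\<lambda>x\<in>carrier (P 2). c2 x * a2"
    have val: "\<phi> (cos (\<lambda>x\<in>carrier (P 2). c x * a)) = residue_class (\<Lambda> c * a)"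
      if "c \<in> ?Z" "a \<in> gr j" for c a j
    proof -
      have "\<phi> (cos (\<lambda>x\<in>carrier (P 2). c x * a)) = a \<odot>\<^bsub>?T\<^esub> \<phi> (cos c)"
        using hom_moduleD(3)[OF \<phi>(1), of a "cos c"] that by (simp add: ext_carrier smult_E[OF that(2)])
      then show ?thesis by (simp add: \<Lambda>[OF that(1)] T)
    qed
    have "\<phi> (cos ?c1) = \<phi> (cos ?c2)"
      using eq by (simp add: val[OF c(1) a(1)] val[OF c(2) a(2)] residue_class_def)
    then have "cos ?c1 = cos ?c2"
      using mult_Z[OF c(1) a(1)] mult_Z[OF c(2) a(2)]
      by (intro inj_onD[OF \<phi>(2)]) (auto simp: ext_carrier)
    moreover have "(\<lambda>x\<in>carrier (P 2). (\<lambda>x\<in>carrier (P 2). 0) x + ?c1 x) \<in> cos ?c1"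
      unfolding cos_def using zero_N by blast
    ultimately obtain n where n: "n \<in> ?N"
      and eq: "(\<lambda>x\<in>carrier (P 2). (\<lambda>x\<in>carrier (P 2). 0) x + ?c1 x) = (\<lambda>x\<in>carrier (P 2). n x + ?c2 x)"
      unfolding cos_def by blast
    obtain f where f: "f \<in> carrier (graded_dual type_ring gr (P 1) (Pg 1))"
        "n = compose (carrier (P 2)) f (\<delta> 1)"
      using n unfolding N by auto
    have "c1 x * a1 = f (\<delta> 1 x) + c2 x * a2" if "x \<in> carrier (P 2)" for x
      using fun_cong[OF eq, of x] that by (simp add: f(2) compose_def)
    moreover have "linear_map (P 1) (*) f" using f(1) by (rule P1.graded_dualE)
    ultimately show "\<exists>g. linear_map (P 1) (*) g \<and> (\<forall>x\<in>carrier (P 2). c1 x * a1 = g (\<delta> 1 x) + c2 x * a2)"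
      by (intro exI[of _ f]) simp
  qed
qed

text \<open>
  A graded projective resolution computes \<open>Ext\<^sup>2\<close> with its own terms. The comparison with \<open>F \<rightarrow> A\<close>
  turns this into a statement about maps \<open>K \<rightarrow> A\<close> modulo those that extend to \<open>F\<close>; for the cocycles
  to lie in the graded dual, the comparison map has to be homogeneous.
\<close>

locale graded_trivial_resolution = trivial_resolution scale gr B P \<delta> \<epsilon>
  for scale :: "'k::field \<Rightarrow> 'a::ring_1 \<Rightarrow> 'a" and gr B P \<delta> \<epsilon> +
  fixes Pg :: "nat \<Rightarrow> int \<Rightarrow> 'a list set set"
  assumes graded_P: "graded_module type_ring gr (P i) (Pg i)"
    and \<delta>_graded: "\<delta> i ` Pg (Suc i) n \<subseteq> Pg i n"
    and \<epsilon>_graded: "\<lbrakk>x \<in> Pg 0 n; n \<noteq> 0\<rbrakk> \<Longrightarrow> \<epsilon> x = 0"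
begin

lemma graded_left_module_P: "graded_left_module scale gr (P i) (Pg i)"
  by unfold_locales (rule graded_P)

lemma homogeneous_generators:
  obtains e p where "e \<in> carrier (P 0)" "\<epsilon> e = 1"
    "\<And>b. b \<in> B \<Longrightarrow> p b \<in> Pg 1 1" "\<And>b. b \<in> B \<Longrightarrow> \<delta> 0 (p b) = b \<odot>\<^bsub>P 0\<^esub> e"
proof -
  interpret P0: graded_left_module scale gr "P 0" "Pg 0" by (rule graded_left_module_P)
  interpret P1: graded_left_module scale gr "P 1" "Pg 1" by (rule graded_left_module_P)
  obtain x where x: "x \<in> carrier (P 0)" "\<epsilon> x = 1"
    using \<epsilon>_image one_gr by (metis imageE)
  define e where "e = P0.hcomp 0 x"
  have e: "e \<in> Pg 0 0" unfolding e_def by (rule P0.hcomp_Mg[OF x(1)])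
  let ?I = "insert 0 {n. P0.hcomp n x \<noteq> \<zero>\<^bsub>P 0\<^esub>}"
  have "\<epsilon> x = (\<Sum>n\<in>?I. \<epsilon> (P0.hcomp n x))"
    using P0.hcomp_finite[OF x(1)]
    by (intro P0.linear_map_hcomp[OF \<epsilon>_linear x(1), symmetric]) auto
  also have "\<dots> = (\<Sum>n\<in>{0}. \<epsilon> (P0.hcomp n x))"
    using P0.hcomp_finite[OF x(1)] \<epsilon>_graded[OF P0.hcomp_Mg[OF x(1)]]
    by (intro sum.mono_neutral_right) auto
  finally have \<epsilon>e: "\<epsilon> e = 1" using x(2) by (simp add: e_def)
  have "\<exists>p. p \<in> Pg 1 1 \<and> \<delta> 0 p = b \<odot>\<^bsub>P 0\<^esub> e" if b: "b \<in> B" for b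
  proof -
    obtain y where y: "y \<in> carrier (P 1)" "\<delta> 0 y = b \<odot>\<^bsub>P 0\<^esub> e"
      using generator_preimage[OF P0.Mg_sub[OF e] b] .
    have "b \<in> gr 1" using b B_gr by auto
    then have be: "b \<odot>\<^bsub>P 0\<^esub> e \<in> Pg 0 1" using P0.Mg_act[of b 1 e 0] e by simp
    have "\<delta> 0 (P1.hcomp 1 y) = P0.hcomp 1 (\<delta> 0 y)"
      using graded_hom_hcomp[OF graded_left_module_P graded_left_module_P, of "\<delta> 0" "Suc 0" 0 y 1]
        differential[of 0] \<delta>_graded[of 0] y(1) by simp
    also have "\<dots> = b \<odot>\<^bsub>P 0\<^esub> e" using P0.hcomp_homogeneous[OF be, of 1] by (simp add: y(2))
    finally show ?thesis using P1.hcomp_Mg[OF y(1)] by blast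
  qed
  then obtain p where "\<And>b. b \<in> B \<Longrightarrow> p b \<in> Pg 1 1 \<and> \<delta> 0 (p b) = b \<odot>\<^bsub>P 0\<^esub> e" by metis
  then show thesis using P0.Mg_sub[OF e] \<epsilon>e by (intro that[of e p]) auto
qed

text \<open>
  Replacing the comparison map by its component of degree zero makes it homogeneous, and then it
  sends the homogeneous preimages \<open>p b\<close> of the generators to the basis of \<open>F\<close>: two elements of degree one
  over the same element of \<open>A\<close> differ by a relation of degree one, hence agree. So the comparison maps
  compose to the identity of \<open>F\<close>.
\<close>

lemma homogeneous_chain_map:
  assumes e: "e \<in> carrier (P 0)" "\<epsilon> e = 1"
    and p: "\<And>b. b \<in> B \<Longrightarrow> p b \<in> Pg 1 1" "\<And>b. b \<in> B \<Longrightarrow> \<delta> 0 (p b) = b \<odot>\<^bsub>P 0\<^esub> e"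
  obtains \<alpha> where "linear_map (P 1) free_act \<alpha>" "\<And>x. x \<in> carrier (P 1) \<Longrightarrow> \<alpha> x \<in> F"
    "\<And>n x. x \<in> Pg 1 n \<Longrightarrow> fproj n (\<alpha> x) = \<alpha> x"
    "\<And>x. x \<in> carrier (P 1) \<Longrightarrow> \<delta> 0 x = \<zero>\<^bsub>P 0\<^esub> \<Longrightarrow> \<alpha> x \<in> K"
    "\<And>b. b \<in> B \<Longrightarrow> \<alpha> (p b) = Poly_Mapping.single b 1"
proof -
  interpret P0: graded_left_module scale gr "P 0" "Pg 0" by (rule graded_left_module_P)
  interpret P1: graded_left_module scale gr "P 1" "Pg 1" by (rule graded_left_module_P)
  obtain \<beta>0 \<beta>1 where \<beta>0: "linear_map (P 0) (*) \<beta>0" "\<And>x. x \<in> carrier (P 0) \<Longrightarrow> proj 0 (\<beta>0 x) = \<epsilon> x"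
    and \<beta>1: "linear_map (P 1) free_act \<beta>1" "\<And>x. x \<in> carrier (P 1) \<Longrightarrow> \<beta>1 x \<in> F"
      "\<And>x. x \<in> carrier (P 1) \<Longrightarrow> d (\<beta>1 x) = \<beta>0 (\<delta> 0 x)"
    using chain_map_to_free by metis
  let ?\<alpha> = "P1.hom_component fproj 0 \<beta>1"
  have act: "free_act (a + b) y = free_act a y + free_act b y"
      "free_act a (y + z) = free_act a y + free_act a z" for a b and y z :: "'a \<Rightarrow>\<^sub>0 'a"
    by (rule poly_mapping_eqI, simp add: lookup_add algebra_simps)+
  have comp_hom: "?\<alpha> x = fproj n (\<beta>1 x)" if "x \<in> Pg 1 n" for x n
    using P1.hom_component_homogeneous[OF \<beta>1(1) act fproj_add fproj_act that, of 0] by simp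
  have lin: "linear_map (P 1) free_act ?\<alpha>"
    by (rule P1.linear_map_hom_component[OF \<beta>1(1) act fproj_add fproj_act])
  have F_sum: "sum f I \<in> F" if "\<And>i. i \<in> I \<Longrightarrow> f i \<in> F" for f and I :: "int set"
    using that by (induction I rule: infinite_finite_induct) (auto simp: free.zero_mem free.add_mem)
  have inF: "?\<alpha> x \<in> F" if x: "x \<in> carrier (P 1)" for x
    unfolding P1.hom_component_def
    by (intro F_sum fproj_F \<beta>1(2) P1.hcomp_closed x)
  have homog: "fproj n (?\<alpha> x) = ?\<alpha> x" if "x \<in> Pg 1 n" for x n
    unfolding comp_hom[OF that] fproj_fproj by simp
  have cycle: "?\<alpha> x \<in> K" if x: "x \<in> carrier (P 1)" and dx: "\<delta> 0 x = \<zero>\<^bsub>P 0\<^esub>" for x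
  proof -
    have d_sum: "d (sum f I) = (\<Sum>i\<in>I. d (f i))" for f and I :: "int set"
      by (induction I rule: infinite_finite_induct) (auto simp: d_add)
    have "d (fproj n (\<beta>1 (P1.hcomp n x))) = 0" for n
    proof -
      have "\<delta> 0 (P1.hcomp n x) = P0.hcomp n (\<delta> 0 x)"
        using graded_hom_hcomp[OF graded_left_module_P graded_left_module_P, of "\<delta> 0" "Suc 0" 0 x n]
          differential[of 0] \<delta>_graded[of 0] x by simp
      also have "\<dots> = \<zero>\<^bsub>P 0\<^esub>" using P0.hcomp_homogeneous[OF P0.Mg_zero[of 0], of n] by (simp add: dx)
      finally have "d (\<beta>1 (P1.hcomp n x)) = 0"
        using \<beta>1(3)[OF P1.hcomp_closed[OF x]] linear_map_zero[OF abelian_group_P \<beta>0(1)] by simp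
      then show ?thesis using d_fproj[OF \<beta>1(2)[OF P1.hcomp_closed[OF x]]] by simp
    qed
    then have "d (?\<alpha> x) = 0"
      unfolding P1.hom_component_def d_sum add.right_neutral by (intro sum.neutral) blast
    then show ?thesis using inF[OF x] by (simp add: K_def)
  qed
  have gens: "?\<alpha> (p b) = Poly_Mapping.single b 1" if b: "b \<in> B" for b
  proof -
    have pb: "p b \<in> carrier (P 1)" by (rule P1.Mg_sub[OF p(1)[OF b]])
    have b1: "b \<in> gr 1" using b B_gr by auto
    have \<alpha>: "?\<alpha> (p b) = fproj 1 (\<beta>1 (p b))" by (rule comp_hom[OF p(1)[OF b]])
    have "d (?\<alpha> (p b)) = iproj 1 (b * \<beta>0 e)"
      using d_fproj[OF \<beta>1(2)[OF pb], of 1] \<beta>1(3)[OF pb] p(2)[OF b] linear_mapD(2)[OF \<beta>0(1) e(1), of b]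
      unfolding \<alpha> by simp
    also have "\<dots> = b" using iproj_mult_left[OF b1, of 1] \<beta>0(2)[OF e(1)] e(2) by (simp add: iproj_zero_degree)
    finally have "?\<alpha> (p b) - Poly_Mapping.single b 1 \<in> K"
      using F_diff[OF inF[OF pb] single_in_free_on[OF b]] by (simp add: K_def d_diff)
    moreover have "fproj 1 (Poly_Mapping.single b 1) = Poly_Mapping.single b 1"
      by (rule poly_mapping_eqI)
        (simp add: lookup_single when_def iproj_zero_degree proj_gr[OF one_gr])
    then have "fproj 1 (?\<alpha> (p b) - Poly_Mapping.single b 1) = ?\<alpha> (p b) - Poly_Mapping.single b 1"
      unfolding fproj_diff homog[OF p(1)[OF b]] by simp
    ultimately show ?thesis using K_fproj_small[of _ 1] by fastforce
  qed
  show thesis using lin inF homog cycle gens by (rule that)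
qed

text \<open>
  A map \<open>\<psi>\<close> on \<open>K\<close> gives the cocycle \<open>\<psi> \<circ> \<alpha> \<circ> \<delta> 1\<close> on \<open>P 2\<close>. A coboundary \<open>g \<circ> \<delta> 1\<close> restricts
  to \<open>k \<mapsto> \<Sum> k\<^sub>b g(p b)\<close> on relations, which is the restriction of a linear map on \<open>F\<close>.
\<close>

lemma relations_ext:
  assumes iso: "graded_isomorphic (opposite_ring type_ring) (ext_module type_ring gr P Pg \<delta> 2) Eg
      (trivial_module (opposite_ring type_ring) (positive_part scale gr)) Tg"
    and add1: "\<And>k l. k \<in> K \<Longrightarrow> l \<in> K \<Longrightarrow> \<psi>1 (k + l) = \<psi>1 k + \<psi>1 l"
    and act1: "\<And>a k. k \<in> K \<Longrightarrow> \<psi>1 (free_act a k) = a * \<psi>1 k"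
    and deg1: "\<And>n k. k \<in> Kg n \<Longrightarrow> iproj (n + s1) (\<psi>1 k) = \<psi>1 k"
    and add2: "\<And>k l. k \<in> K \<Longrightarrow> l \<in> K \<Longrightarrow> \<psi>2 (k + l) = \<psi>2 k + \<psi>2 l"
    and act2: "\<And>a k. k \<in> K \<Longrightarrow> \<psi>2 (free_act a k) = a * \<psi>2 k"
    and deg2: "\<And>n k. k \<in> Kg n \<Longrightarrow> iproj (n + s2) (\<psi>2 k) = \<psi>2 k"
  obtains \<Lambda>1 \<Lambda>2 where "\<And>a1 a2 j1 j2. \<lbrakk>a1 \<in> gr j1; a2 \<in> gr j2; proj 0 (\<Lambda>1 * a1) = proj 0 (\<Lambda>2 * a2)\<rbrakk>
    \<Longrightarrow> \<exists>G. \<forall>k\<in>K. \<psi>1 k * a1 = free_eval G k + \<psi>2 k * a2"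
proof -
  interpret P1: graded_left_module scale gr "P 1" "Pg 1" by (rule graded_left_module_P)
  interpret P2: graded_left_module scale gr "P 2" "Pg 2" by (rule graded_left_module_P)
  have h1: "\<delta> 1 \<in> hom_module type_ring (P 2) (P 1)"
    using differential[of 1] by (simp add: numeral_2_eq_2)
  have h2: "\<delta> 2 \<in> hom_module type_ring (P 3) (P 2)"
    using differential[of 2] by (simp add: numeral_2_eq_2 numeral_3_eq_3)
  obtain e p where e: "e \<in> carrier (P 0)" "\<epsilon> e = 1"
    and p: "\<And>b. b \<in> B \<Longrightarrow> p b \<in> Pg 1 1" "\<And>b. b \<in> B \<Longrightarrow> \<delta> 0 (p b) = b \<odot>\<^bsub>P 0\<^esub> e"
    by (rule homogeneous_generators) (rule that)
  obtain \<alpha> where \<alpha>: "linear_map (P 1) free_act \<alpha>" "\<And>x. x \<in> carrier (P 1) \<Longrightarrow> \<alpha> x \<in> F"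
    "\<And>n x. x \<in> Pg 1 n \<Longrightarrow> fproj n (\<alpha> x) = \<alpha> x"
    "\<And>x. x \<in> carrier (P 1) \<Longrightarrow> \<delta> 0 x = \<zero>\<^bsub>P 0\<^esub> \<Longrightarrow> \<alpha> x \<in> K"
    "\<And>b. b \<in> B \<Longrightarrow> \<alpha> (p b) = Poly_Mapping.single b 1"
    by (rule homogeneous_chain_map[OF e p]) (assumption, assumption, rule that)
  have pP: "p b \<in> carrier (P 1)" if "b \<in> B" for b by (rule P1.Mg_sub[OF p(1)[OF that]])
  have d1: "\<delta> 1 q \<in> carrier (P 1)" "\<delta> 0 (\<delta> 1 q) = \<zero>\<^bsub>P 0\<^esub>" if "q \<in> carrier (P 2)" for q
    using hom_moduleD(1)[OF h1 that] \<delta>_\<delta>[of q 0] that by (simp_all add: numeral_2_eq_2)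
  have \<alpha>K: "\<alpha> (\<delta> 1 q) \<in> K" if "q \<in> carrier (P 2)" for q
    by (rule \<alpha>(4)[OF d1[OF that]])
  define c where "c \<psi> = (\<lambda>q\<in>carrier (P 2). \<psi> (\<alpha> (\<delta> 1 q)) :: 'a)" for \<psi>
  have cocycle: "c \<psi> \<in> ext_cocycles type_ring gr P Pg \<delta> 2"
    if add: "\<And>k l. k \<in> K \<Longrightarrow> l \<in> K \<Longrightarrow> \<psi> (k + l) = \<psi> k + \<psi> l"
      and act: "\<And>a k. k \<in> K \<Longrightarrow> \<psi> (free_act a k) = a * \<psi> k"
      and deg: "\<And>n k. k \<in> Kg n \<Longrightarrow> iproj (n + s) (\<psi> k) = \<psi> k" for \<psi> s
  proof -
    have "linear_map (P 2) (*) (c \<psi>)"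
      unfolding linear_map_def
    proof (intro conjI ballI allI)
      fix x a assume x: "x \<in> carrier (P 2)"
      have "\<alpha> (\<delta> 1 (a \<odot>\<^bsub>P 2\<^esub> x)) = free_act a (\<alpha> (\<delta> 1 x))"
        using hom_moduleD(3)[OF h1 _ x, of a] linear_mapD(2)[OF \<alpha>(1) d1(1)[OF x], of a] by simp
      then show "c \<psi> (a \<odot>\<^bsub>P 2\<^esub> x) = a * c \<psi> x"
        using act[OF \<alpha>K[OF x]] P2.M.act_closed x by (simp add: c_def)
      fix y assume y: "y \<in> carrier (P 2)"
      have "\<alpha> (\<delta> 1 (x \<oplus>\<^bsub>P 2\<^esub> y)) = \<alpha> (\<delta> 1 x) + \<alpha> (\<delta> 1 y)"
        using hom_moduleD(2)[OF h1 x y] linear_mapD(1)[OF \<alpha>(1) d1(1)[OF x] d1(1)[OF y]] by simp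
      then show "c \<psi> (x \<oplus>\<^bsub>P 2\<^esub> y) = c \<psi> x + c \<psi> y"
        using add[OF \<alpha>K[OF x] \<alpha>K[OF y]] x y by (simp add: c_def)
    qed
    moreover have "iproj (m + s) (c \<psi> x) = c \<psi> x" if x: "x \<in> Pg 2 m" for x m
    proof -
      have x': "x \<in> carrier (P 2)" by (rule P2.Mg_sub[OF x])
      have "\<delta> 1 x \<in> Pg 1 m" using \<delta>_graded[of 1 m] x by (auto simp: numeral_2_eq_2)
      then have "\<alpha> (\<delta> 1 x) \<in> Kg m" using \<alpha>(3) \<alpha>K[OF x'] by (simp add: Kg_def)
      from deg[OF this] show ?thesis using x' by (simp add: c_def)
    qed
    moreover have "c \<psi> \<in> extensional (carrier (P 2))" by (simp add: c_def)
    ultimately have "c \<psi> \<in> hom_degree type_ring gr (P 2) (Pg 2) s"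
      by (simp add: P2.hom_degree_iff)
    then have "c \<psi> \<in> carrier (graded_dual type_ring gr (P 2) (Pg 2))"
      by (rule P2.graded_dual_degree)
    moreover have "c \<psi> (\<delta> 2 x) = 0" if x: "x \<in> carrier (P 3)" for x
    proof -
      have x2: "\<delta> 2 x \<in> carrier (P 2)" by (rule hom_moduleD(1)[OF h2 x])
      have "\<delta> 1 (\<delta> 2 x) = \<zero>\<^bsub>P 1\<^esub>" using \<delta>_\<delta>[of x 1] x by (simp add: numeral_2_eq_2 numeral_3_eq_3)
      then have "\<alpha> (\<delta> 1 (\<delta> 2 x)) = 0" using linear_map_zero[OF abelian_group_P \<alpha>(1)] by simp
      moreover have "\<psi> 0 = 0" using act[OF K.zero_mem, of 0] by simp
      ultimately show ?thesis using x2 by (simp add: c_def)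
    qed
    ultimately show ?thesis by (simp add: ext_cocycles_def numeral_2_eq_2 numeral_3_eq_3)
  qed
  obtain \<Lambda> where \<Lambda>: "\<And>c1 c2 a1 a2 j1 j2. \<lbrakk>c1 \<in> ext_cocycles type_ring gr P Pg \<delta> 2;
      c2 \<in> ext_cocycles type_ring gr P Pg \<delta> 2; a1 \<in> gr j1; a2 \<in> gr j2;
      proj 0 (\<Lambda> c1 * a1) = proj 0 (\<Lambda> c2 * a2)\<rbrakk> \<Longrightarrow>
    \<exists>g. linear_map (P 1) (*) g \<and> (\<forall>x\<in>carrier (P 2). c1 x * a1 = g (\<delta> 1 x) + c2 x * a2)"
    by (rule ext_two_cocycles[OF graded_left_module_P h1 h2 iso]) (rule that)
  show thesis
  proof (rule that)
    fix a1 a2 j1 j2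
    assume a: "a1 \<in> gr j1" "a2 \<in> gr j2" and eq: "proj 0 (\<Lambda> (c \<psi>1) * a1) = proj 0 (\<Lambda> (c \<psi>2) * a2)"
    obtain g where g: "linear_map (P 1) (*) g"
      "\<And>x. x \<in> carrier (P 2) \<Longrightarrow> c \<psi>1 x * a1 = g (\<delta> 1 x) + c \<psi>2 x * a2"
      using \<Lambda>[OF cocycle[OF add1 act1 deg1] cocycle[OF add2 act2 deg2] a eq]
      by blast
    have "\<psi>1 k * a1 = free_eval (\<lambda>b. g (p b)) k + \<psi>2 k * a2" if k: "k \<in> K" for k
    proof -
      have kF: "k \<in> F" using k by (simp add: K_def)
      obtain q where q: "q \<in> carrier (P 2)" "\<delta> 1 q = combination (P 1) p k"
        using combination_relation[OF e(1) pP p(2) k] .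
      have "\<alpha> (\<delta> 1 q) = (\<Sum>b\<in>keys k. free_act (lookup k b) (\<alpha> (p b)))"
        unfolding q(2) by (rule linear_map_combination[OF left_module_P pP \<alpha>(1) kF])
      also have "\<dots> = (\<Sum>b\<in>keys k. free_act (lookup k b) (Poly_Mapping.single b 1))"
        using kF \<alpha>(5) by (intro sum.cong) (auto simp: free_on_def)
      also have "\<dots> = k" by (rule free_sum_single[symmetric])
      finally have ck: "c \<psi> q = \<psi> k" for \<psi> using q(1) by (simp add: c_def)
      have "g (\<delta> 1 q) = (\<Sum>b\<in>keys k. lookup k b * g (p b))"
        unfolding q(2) by (rule linear_map_combination[OF left_module_P pP g(1) kF])
      then show ?thesis using g(2)[OF q(1)] by (simp add: ck free_eval_def)
    qed
    then show "\<exists>G. \<forall>k\<in>K. \<psi>1 k * a1 = free_eval G k + \<psi>2 k * a2" by blast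
  qed
qed

end

section \<open>Regularity in terms of the relations\<close>

context generated_algebra
begin

lemma trivial_resolutionI:
  assumes res: "projective_resolution type_ring M P \<delta> \<epsilon>"
    and \<theta>_image: "\<theta> ` carrier M = gr 0"
    and \<theta>_add: "\<And>x y. x \<in> carrier M \<Longrightarrow> y \<in> carrier M \<Longrightarrow> \<theta> (x \<oplus>\<^bsub>M\<^esub> y) = \<theta> x + \<theta> y"
    and \<theta>_act: "\<And>a x. x \<in> carrier M \<Longrightarrow> \<theta> (a \<odot>\<^bsub>M\<^esub> x) = proj 0 a * \<theta> x"
    and \<theta>_inj: "\<And>x. x \<in> carrier M \<Longrightarrow> \<theta> x = 0 \<Longrightarrow> x = \<zero>\<^bsub>M\<^esub>"
  shows "trivial_resolution scale gr B P \<delta> (\<lambda>x. \<theta> (\<epsilon> x))"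
proof unfold_locales
  have P: "projective_module type_ring (P i)" for i using res by (simp add: projective_resolution_def)
  have lM: "left_module type_ring M" using res by (simp add: projective_resolution_def)
  interpret M: left_module type_ring M by (rule lM)
  have \<epsilon>: "\<epsilon> \<in> hom_module type_ring (P 0) M" and im: "\<epsilon> ` carrier (P 0) = carrier M"
    using res by (simp_all add: projective_resolution_def)
  show "projective_module type_ring (P i)" "\<delta> i \<in> hom_module type_ring (P (Suc i)) (P i)"
    "hom_kernel (P (Suc i)) (P i) (\<delta> i) = \<delta> (Suc i) ` carrier (P (Suc (Suc i)))" for i
    using res by (simp_all add: projective_resolution_def)
  show "linear_map (P 0) trivial_act (\<lambda>x. \<theta> (\<epsilon> x))"
    using hom_moduleD[OF \<epsilon>] by (simp add: linear_map_def \<theta>_add \<theta>_act trivial_act_def)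
  show "(\<lambda>x. \<theta> (\<epsilon> x)) ` carrier (P 0) = gr 0"
  proof -
    have "(\<lambda>x. \<theta> (\<epsilon> x)) ` carrier (P 0) = \<theta> ` (\<epsilon> ` carrier (P 0))" by (rule image_image[symmetric])
    also have "\<dots> = gr 0" unfolding im by (rule \<theta>_image)
    finally show ?thesis .
  qed
  have ker: "hom_kernel (P 0) M \<epsilon> = \<delta> 0 ` carrier (P 1)"
    using res unfolding projective_resolution_def by (elim conjE)
  have "\<theta> \<zero>\<^bsub>M\<^esub> = 0" using \<theta>_add[of "\<zero>\<^bsub>M\<^esub>" "\<zero>\<^bsub>M\<^esub>"] by simp
  then have "hom_kernel (P 0) (type_module (gr 0) trivial_act) (\<lambda>x. \<theta> (\<epsilon> x)) = hom_kernel (P 0) M \<epsilon>"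
    using hom_moduleD(1)[OF \<epsilon>] \<theta>_inj by (auto simp: hom_kernel_def)
  then show "hom_kernel (P 0) (type_module (gr 0) trivial_act) (\<lambda>x. \<theta> (\<epsilon> x)) = \<delta> 0 ` carrier (P 1)"
    unfolding ker .
qed

lemma graded_trivial_resolutionI:
  assumes res: "graded_projective_resolution type_ring gr
      (trivial_module type_ring (positive_part scale gr))
      (concentrated_in_degree_zero (trivial_module type_ring (positive_part scale gr))) P Pg \<delta> \<epsilon>"
  obtains \<epsilon>' where "graded_trivial_resolution scale gr B P \<delta> \<epsilon>' Pg"
proof -
  let ?Ap = "positive_part scale gr"
  let ?T = "trivial_module type_ring ?Ap"
  note T = trivial_module_simps[OF disjI1[OF HOL.refl]]
  define \<theta> where "\<theta> C = the_elem (proj 0 ` C)" for C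
  have \<theta>: "\<theta> (residue_class l) = proj 0 l" for l
  proof -
    have "proj 0 ` residue_class l = {proj 0 l}" by (auto simp: residue_class_def)
    then show ?thesis by (simp add: \<theta>_def)
  qed
  have triv: "trivial_resolution scale gr B P \<delta> (\<lambda>x. \<theta> (\<epsilon> x))"
  proof (rule trivial_resolutionI[where \<theta> = \<theta> and \<epsilon> = \<epsilon> and M = ?T])
    show "projective_resolution type_ring ?T P \<delta> \<epsilon>"
      using res by (simp add: graded_projective_resolution_def)
    show "\<theta> ` carrier ?T = gr 0"
      unfolding T(1) image_image \<theta>
    proof (intro equalityI subsetI)
      fix c assume "c \<in> gr 0"
      then have "c = proj 0 c" using proj_gr[of c 0 0] by simp
      then show "c \<in> range (proj 0)" by (rule range_eqI)
    qed (auto simp: proj_in_gr)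
    fix x assume "x \<in> carrier ?T"
    then obtain l where l: "x = residue_class l" by (auto simp: T(1))
    show "\<theta> (a \<odot>\<^bsub>?T\<^esub> x) = proj 0 a * \<theta> x" for a
      by (simp add: l T(4) \<theta> proj_0_mult)
    show "x = \<zero>\<^bsub>?T\<^esub>" if "\<theta> x = 0"
      using that unfolding l \<theta> T(2) by (simp add: residue_class_def)
    fix y assume "y \<in> carrier ?T"
    then obtain m where m: "y = residue_class m" by (auto simp: T(1))
    show "\<theta> (x \<oplus>\<^bsub>?T\<^esub> y) = \<theta> x + \<theta> y"
      by (simp add: l m T(3) \<theta> proj_add)
  qed
  have "graded_trivial_resolution scale gr B P \<delta> (\<lambda>x. \<theta> (\<epsilon> x)) Pg"
  proof (rule graded_trivial_resolution.intro[OF triv], unfold_locales)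
    show "graded_module type_ring gr (P i) (Pg i)" "\<delta> i ` Pg (Suc i) n \<subseteq> Pg i n" for i n
      using res by (simp_all add: graded_projective_resolution_def)
    fix x n assume x: "x \<in> Pg 0 n" and n: "n \<noteq> (0::int)"
    have "\<epsilon> ` Pg 0 n \<subseteq> concentrated_in_degree_zero ?T n"
      using res by (simp add: graded_projective_resolution_def)
    then have "\<epsilon> x = residue_class 0" using x n T(2) by (auto simp: concentrated_in_degree_zero_def)
    then show "\<theta> (\<epsilon> x) = 0" by (simp add: \<theta>)
  qed
  then show thesis by (rule that)
qed

text \<open>
  The global dimension bounds the projective dimension of modules in the type of sets of lists, so
  the trivial module is transported there.
\<close>

lemma short_trivial_resolutionI:
  assumes "left_global_dim (type_ring :: 'a ring) \<le> enat 2"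
  obtains P \<delta> \<epsilon> where "short_trivial_resolution scale gr B P \<delta> \<epsilon>"
proof -
  let ?k = "type_module (gr 0) trivial_act"
  let ?M = "transport_module encode_elem ?k :: 'a small_module"
  have inj: "inj_on encode_elem (carrier ?k)" by (rule inj_on_subset[OF inj_encode_elem]) simp
  note simps = transport_module_simps[OF inj]
  have lk: "left_module type_ring ?k"
    by (rule type_action.left_module_type_module[OF type_action_trivial])
  have lM: "left_module type_ring ?M" by (rule left_module_transport[OF lk inj])
  define S where "S = {n. \<exists>P \<delta> \<epsilon>. projective_resolution type_ring ?M P \<delta> \<epsilon> \<and> (\<forall>i>n. is_zero_module (P i))}"
  have "proj_dim type_ring ?M \<le> left_global_dim (type_ring :: 'a ring)"
    unfolding left_global_dim_def using lM by (intro SUP_upper) simp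
  then have le: "proj_dim type_ring ?M \<le> enat 2" using assms by (rule order_trans)
  have "\<exists>n\<in>S. n \<le> 2"
  proof (rule ccontr)
    assume "\<not> ?thesis"
    then have "3 \<le> n" if "n \<in> S" for n using that by force
    then have "enat 3 \<le> proj_dim type_ring ?M"
      unfolding proj_dim_def S_def[symmetric] by (intro INF_greatest) simp
    with le have "enat 3 \<le> enat 2" by (rule order_trans[rotated])
    then show False by simp
  qed
  then obtain n P \<delta> \<epsilon> where n: "n \<le> 2" and res: "projective_resolution type_ring ?M P \<delta> \<epsilon>"
    and short: "\<forall>i>n. is_zero_module (P i)"
    unfolding S_def by blast
  define \<theta> where "\<theta> = inv_into (gr 0) (encode_elem :: 'a \<Rightarrow> 'a list set)"
  have \<theta>: "\<theta> (encode_elem x) = x" if "x \<in> gr 0" for x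
    using inj that by (simp add: \<theta>_def)
  interpret k: type_action "gr 0" trivial_act by (rule type_action_trivial)
  have "trivial_resolution scale gr B P \<delta> (\<lambda>x. \<theta> (\<epsilon> x))"
  proof (rule trivial_resolutionI[OF res, where \<theta> = \<theta>])
    show "\<theta> ` carrier ?M = gr 0" by (force simp: simps \<theta> image_iff)
    fix x assume "x \<in> carrier ?M"
    then obtain l where l: "x = encode_elem l" "l \<in> gr 0" by (auto simp: simps)
    show "\<theta> (a \<odot>\<^bsub>?M\<^esub> x) = proj 0 a * \<theta> x" for a
      using simps(4)[of l a] k.act_mem[OF l(2), of a] l by (simp add: \<theta> trivial_act_def)
    show "x = \<zero>\<^bsub>?M\<^esub>" if "\<theta> x = 0" using that l(2) unfolding l(1) \<theta>[OF l(2)] by (simp add: simps(2))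
    fix y assume "y \<in> carrier ?M"
    then obtain m where m: "y = encode_elem m" "m \<in> gr 0" by (auto simp: simps)
    show "\<theta> (x \<oplus>\<^bsub>?M\<^esub> y) = \<theta> x + \<theta> y"
      using simps(3)[of l m] k.add_mem[OF l(2) m(2)] l m by (simp add: \<theta>)
  qed
  moreover have "is_zero_module (P 3)" using short n by simp
  ultimately have "short_trivial_resolution scale gr B P \<delta> (\<lambda>x. \<theta> (\<epsilon> x))"
    by (simp add: short_trivial_resolution_def short_trivial_resolution_axioms_def)
  then show thesis by (rule that)
qed

definition relation_map :: "int \<Rightarrow> (('a \<Rightarrow>\<^sub>0 'a) \<Rightarrow> 'a) \<Rightarrow> bool" where
  "relation_map s \<psi> \<longleftrightarrow> (\<forall>k\<in>K. \<forall>l\<in>K. \<psi> (k + l) = \<psi> k + \<psi> l) \<and>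
     (\<forall>a. \<forall>k\<in>K. \<psi> (free_act a k) = a * \<psi> k) \<and>
     (\<forall>n. \<forall>k\<in>Kg n. iproj (n + s) (\<psi> k) = \<psi> k)"

end

text \<open>
  The conclusions drawn from the homological conditions: \<open>lift\<close> comes from global dimension two,
  and \<open>ext\<close> says that homogeneous maps \<open>K \<rightarrow> A\<close> modulo those extending to \<open>F\<close> form the trivial module.
\<close>

locale regular_relations = generated_algebra scale gr B
  for scale :: "'k::field \<Rightarrow> 'a::ring_1 \<Rightarrow> 'a" and gr B +
  assumes lift: "\<lbrakk>\<And>k l. k \<in> K \<Longrightarrow> l \<in> K \<Longrightarrow> \<phi> (k + l) = \<phi> k + \<phi> l;
      \<And>a k. k \<in> K \<Longrightarrow> \<phi> (free_act a k) = proj 0 a * \<phi> k; \<And>k. k \<in> K \<Longrightarrow> \<phi> k \<in> gr 0\<rbrakk> \<Longrightarrow>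
      \<exists>\<psi>. (\<forall>k\<in>K. \<forall>l\<in>K. \<psi> (k + l) = \<psi> k + \<psi> l) \<and> (\<forall>a. \<forall>k\<in>K. \<psi> (free_act a k) = a * \<psi> k) \<and>
        (\<forall>k\<in>K. proj 0 (\<psi> k) = \<phi> k)"
    and ext: "\<lbrakk>relation_map s1 \<psi>1; relation_map s2 \<psi>2\<rbrakk> \<Longrightarrow>
      \<exists>\<Lambda>1 \<Lambda>2. \<forall>a1 a2 j1 j2. a1 \<in> gr j1 \<longrightarrow> a2 \<in> gr j2 \<longrightarrow> proj 0 (\<Lambda>1 * a1) = proj 0 (\<Lambda>2 * a2) \<longrightarrow>
        (\<exists>G. \<forall>k\<in>K. \<psi>1 k * a1 = free_eval G k + \<psi>2 k * a2)"

lemma (in generated_algebra) regular_relationsI: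
  assumes "AS_regular scale gr 2"
  shows "regular_relations scale gr B"
proof
  have gd: "left_global_dim (type_ring :: 'a ring) = enat 2"
    and "\<exists>l. AS_ext_condition type_ring gr (positive_part scale gr) 2 l"
    using assms by (auto simp: AS_regular_def Let_def)
  then obtain l P Pg \<delta> \<epsilon> where res: "graded_projective_resolution type_ring gr
      (trivial_module type_ring (positive_part scale gr))
      (concentrated_in_degree_zero (trivial_module type_ring (positive_part scale gr))) P Pg \<delta> \<epsilon>"
    and iso: "graded_isomorphic (opposite_ring type_ring)
          (ext_module type_ring gr P Pg \<delta> 2) (ext_grading type_ring gr P Pg \<delta> 2)
          (trivial_module (opposite_ring type_ring) (positive_part scale gr))
          (shift l (concentrated_in_degree_zero (trivial_module (opposite_ring type_ring) (positive_part scale gr))))"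
    unfolding AS_ext_condition_def by blast
  obtain \<epsilon>' where "graded_trivial_resolution scale gr B P \<delta> \<epsilon>' Pg"
    using graded_trivial_resolutionI[OF res] .
  then interpret P: graded_trivial_resolution scale gr B P \<delta> \<epsilon>' Pg .
  show "\<exists>\<Lambda>1 \<Lambda>2. \<forall>a1 a2 j1 j2. a1 \<in> gr j1 \<longrightarrow> a2 \<in> gr j2 \<longrightarrow> proj 0 (\<Lambda>1 * a1) = proj 0 (\<Lambda>2 * a2) \<longrightarrow>
        (\<exists>G. \<forall>k\<in>K. \<psi>1 k * a1 = free_eval G k + \<psi>2 k * a2)"
    if maps: "relation_map s1 \<psi>1" "relation_map s2 \<psi>2" for s1 s2 \<psi>1 \<psi>2
  proof -
    obtain \<Lambda>1 \<Lambda>2 where "\<And>a1 a2 j1 j2. \<lbrakk>a1 \<in> gr j1; a2 \<in> gr j2; proj 0 (\<Lambda>1 * a1) = proj 0 (\<Lambda>2 * a2)\<rbrakk>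
        \<Longrightarrow> \<exists>G. \<forall>k\<in>K. \<psi>1 k * a1 = free_eval G k + \<psi>2 k * a2"
      by (rule P.relations_ext[OF iso, of \<psi>1 s1 \<psi>2 s2])
        (use maps in \<open>auto simp: relation_map_def\<close>)
    then show ?thesis by blast
  qed
  obtain Q \<delta>' \<eta> where "short_trivial_resolution scale gr B Q \<delta>' \<eta>"
    using short_trivial_resolutionI gd by auto
  then interpret Q: short_trivial_resolution scale gr B Q \<delta>' \<eta> .
  show "\<exists>\<psi>. (\<forall>k\<in>K. \<forall>l\<in>K. \<psi> (k + l) = \<psi> k + \<psi> l) \<and> (\<forall>a. \<forall>k\<in>K. \<psi> (free_act a k) = a * \<psi> k) \<and>
        (\<forall>k\<in>K. proj 0 (\<psi> k) = \<phi> k)"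
    if fnl: "\<And>k l. k \<in> K \<Longrightarrow> l \<in> K \<Longrightarrow> \<phi> (k + l) = \<phi> k + \<phi> l"
      "\<And>a k. k \<in> K \<Longrightarrow> \<phi> (free_act a k) = proj 0 a * \<phi> k" "\<And>k. k \<in> K \<Longrightarrow> \<phi> k \<in> gr 0" for \<phi>
  proof -
    obtain \<psi> where "\<And>k l. k \<in> K \<Longrightarrow> l \<in> K \<Longrightarrow> \<psi> (k + l) = \<psi> k + \<psi> l"
      "\<And>a k. k \<in> K \<Longrightarrow> \<psi> (free_act a k) = a * \<psi> k" "\<And>k. k \<in> K \<Longrightarrow> proj 0 (\<psi> k) = \<phi> k"
      by (rule Q.lift_relation_functional[OF fnl]) (assumption | rule that)+
    then show ?thesis by (intro exI[of _ \<psi>]) simp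
  qed
qed

section \<open>There is one relation, and it is nondegenerate\<close>

context generated_algebra
begin

lemma relation_mapD:
  assumes "relation_map s \<psi>"
  shows "k \<in> K \<Longrightarrow> l \<in> K \<Longrightarrow> \<psi> (k + l) = \<psi> k + \<psi> l" "k \<in> K \<Longrightarrow> \<psi> (free_act a k) = a * \<psi> k"
    "k \<in> Kg n \<Longrightarrow> iproj (n + s) (\<psi> k) = \<psi> k"
  using assms by (auto simp: relation_map_def)

lemma Kg_K: "k \<in> Kg n \<Longrightarrow> k \<in> K"
  by (simp add: Kg_def)

text \<open>
  A coordinate on \<open>A\<close> that picks out \<open>x\<close>.
\<close>

lemma linear_form:
  assumes "x \<noteq> 0"
  obtains g where "\<And>a b. g (a + b) = g a + g b" "\<And>c a. g (scale c a) = c * g a" "g x = 1"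
proof -
  interpret vs: vector_space_pair scale "(*) :: 'k \<Rightarrow> 'k \<Rightarrow> 'k"
    by unfold_locales (simp_all add: algebra_simps)
  have "independent {x}" using assms by simp
  then obtain g where "Vector_Spaces.linear scale (*) g" "\<forall>y\<in>{x}. g y = 1"
    using vs.linear_independent_extend[of "{x}" "\<lambda>_. 1"] by blast
  then show thesis
    using that[of g] by (simp add: Vector_Spaces.linear_iff)
qed

lemma K_sum: "(\<And>i. i \<in> I \<Longrightarrow> f i \<in> K) \<Longrightarrow> sum f I \<in> K"
  by (induction I rule: infinite_finite_induct) (auto simp: K.zero_mem K.add_mem)

text \<open>
  Below degree \<open>m\<close> there is nothing, so the component of degree \<open>m\<close> of \<open>a k\<close> depends only on the scalar
  part of \<open>a\<close>.
\<close>

lemma coefficient_functional: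
  assumes g: "\<And>a b. g (a + b) = g a + g b" "\<And>c a. g (scale c a) = c * g a"
    and k: "k \<in> K" "\<And>n. n < m \<Longrightarrow> fproj n k = 0"
  shows "scale (g (lookup (fproj m (free_act a k)) b)) 1 = proj 0 a * scale (g (lookup (fproj m k) b)) 1"
proof (induction a rule: graded_induct)
  case (add x y)
  have "lookup (fproj m (free_act (x + y) k)) b =
      lookup (fproj m (free_act x k)) b + lookup (fproj m (free_act y k)) b"
    by (simp add: distrib_right iproj_add)
  then show ?case using add by (simp add: g(1) scale_left_distrib proj_add distrib_right)
next
  case (homogeneous j a)
  have g0: "g 0 = 0" using g(2)[of 0 0] by simp
  show ?case
  proof (cases "j = 0")
    case True
    then obtain c where c: "a = scale c 1" using homogeneous by (auto simp: gr_0)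
    have "lookup (fproj m (free_act a k)) b = scale c (lookup (fproj m k) b)"
      unfolding fproj_act[OF homogeneous] using True by (simp add: c scale_mult_left)
    moreover have "proj 0 a = scale c 1" using proj_gr[OF homogeneous, of 0] True c by simp
    ultimately show ?thesis by (simp add: g(2) scale_mult_left)
  next
    case False
    have "lookup (fproj m (free_act a k)) b = 0"
      unfolding fproj_act[OF homogeneous] using k(2)[of "m - int j"] False by simp
    moreover have "proj 0 a = 0" using proj_gr[OF homogeneous, of 0] False by simp
    ultimately show ?thesis by (simp add: g0)
  qed
qed

end

context regular_relations
begin

text \<open>
  For a homogeneous projection \<open>T\<close> on \<open>K\<close>, an element \<open>r\<close> of minimal degree in its image generates a free
  direct summand: a linear form that is \<open>1\<close> on \<open>r\<close> gives a map from \<open>K\<close> to the trivial module, because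
  the degree of \<open>r\<close> is minimal. The component \<open>\<psi>\<close> of degree \<open>-m\<close> of a lift of this map to \<open>A\<close> satisfies
  \<open>\<psi> r = 1\<close>.
\<close>

lemma split_minimal_relation:
  assumes T_add: "\<And>k l. k \<in> K \<Longrightarrow> l \<in> K \<Longrightarrow> T (k + l) = T k + T l"
    and T_act: "\<And>a k. k \<in> K \<Longrightarrow> T (free_act a k) = free_act a (T k)"
    and T_deg: "\<And>n k. k \<in> Kg n \<Longrightarrow> T k \<in> Kg n"
    and T_idem: "\<And>k. k \<in> K \<Longrightarrow> T (T k) = T k"
    and nonzero: "k0 \<in> K" "T k0 \<noteq> 0"
  obtains m r \<psi> where "r \<in> Kg (int m)" "T r = r" "r \<noteq> 0" "relation_map (- int m) \<psi>" "\<psi> r = 1"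
    "\<And>n k. \<lbrakk>n < int m; k \<in> Kg n\<rbrakk> \<Longrightarrow> T k = 0"
    "\<And>n k. \<lbrakk>n \<le> int m; k \<in> Kg n; T k = 0\<rbrakk> \<Longrightarrow> \<psi> k = 0"
proof -
  have T0: "T 0 = 0" using T_act[OF K.zero_mem, of 0] by simp
  have T_sum: "T (sum f I) = (\<Sum>i\<in>I. T (f i))" if "\<And>i. i \<in> I \<Longrightarrow> f i \<in> K" for f and I :: "int set"
    using that by (induction I rule: infinite_finite_induct) (auto simp: T0 T_add K_sum)
  have T_K: "T k \<in> K" if k: "k \<in> K" for k
  proof -
    have "T k = T (\<Sum>n | fproj n k \<noteq> 0. fproj n k)" by (simp only: sum_fproj)
    also have "\<dots> = (\<Sum>n | fproj n k \<noteq> 0. T (fproj n k))" by (rule T_sum) (rule fproj_K[OF k])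
    also have "\<dots> \<in> K" by (rule K_sum) (rule Kg_K[OF T_deg[OF fproj_Kg[OF k]]])
    finally show ?thesis .
  qed
  have fproj_T: "fproj n (T k) = T (fproj n k)" if k: "k \<in> K" for n k
  proof -
    let ?I = "{n. fproj n k \<noteq> 0}"
    have "T k = T (\<Sum>n\<in>?I. fproj n k)" by (simp only: sum_fproj)
    also have "\<dots> = (\<Sum>n\<in>?I. T (fproj n k))" by (rule T_sum) (rule fproj_K[OF k])
    finally have "fproj n (T k) = (\<Sum>i\<in>?I. fproj n (T (fproj i k)))" by (simp add: fproj_sum)
    also have "\<dots> = (\<Sum>i\<in>?I. if n = i then T (fproj i k) else 0)"
    proof (rule sum.cong[OF HOL.refl])
      fix i
      have "fproj i (T (fproj i k)) = T (fproj i k)" using T_deg[OF fproj_Kg[OF k]] by (simp add: Kg_def)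
      then show "fproj n (T (fproj i k)) = (if n = i then T (fproj i k) else 0)"
        using fproj_fproj[of n i "T (fproj i k)"] by simp
    qed
    also have "\<dots> = T (fproj n k)" using fproj_finite[of k] by (auto simp: T0)
    finally show ?thesis .
  qed
  define N where "N = {n :: nat. \<exists>k\<in>Kg (int n). T k \<noteq> 0}"
  have "N \<noteq> {}"
  proof -
    have "T k0 = (\<Sum>n | fproj n (T k0) \<noteq> 0. fproj n (T k0))" by (rule sum_fproj[symmetric])
    then obtain n where n: "fproj n (T k0) \<noteq> 0"
      using nonzero(2) by (metis (mono_tags, lifting) sum.neutral)
    then have "\<not> n \<le> 1" using K_fproj_small[OF T_K[OF nonzero(1)]] by blast
    moreover have "T (fproj n k0) \<noteq> 0" using n fproj_T[OF nonzero(1)] by simp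
    ultimately have "nat n \<in> N" using fproj_Kg[OF nonzero(1), of n] unfolding N_def by auto
    then show ?thesis by blast
  qed
  define m where "m = (LEAST n. n \<in> N)"
  have "m \<in> N" unfolding m_def using \<open>N \<noteq> {}\<close> by (metis LeastI ex_in_conv)
  then obtain k1 where k1: "k1 \<in> Kg (int m)" "T k1 \<noteq> 0" unfolding N_def by blast
  have minimal: "T k = 0" if "n < int m" "k \<in> Kg n" for n k
  proof (cases "n < 0")
    case True
    then have "k = 0" using that(2) K_fproj_small[of k n] by (simp add: Kg_def)
    then show ?thesis by (simp add: T0)
  next
    case False
    then have "nat n < m" using that(1) by linarith
    then have "nat n \<notin> N" unfolding m_def by (rule not_less_Least)
    then show ?thesis using that(2) False unfolding N_def by auto
  qed
  define r where "r = T k1"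
  have r: "r \<in> Kg (int m)" "T r = r" "r \<noteq> 0"
    unfolding r_def using T_deg[OF k1(1)] T_idem[OF Kg_K[OF k1(1)]] k1(2) by auto
  obtain b where "lookup r b \<noteq> 0" using r(3) by (metis lookup_zero poly_mapping_eqI)
  then obtain g where g: "\<And>x y. g (x + y) = g x + g y" "\<And>c x. g (scale c x) = c * g x" "g (lookup r b) = 1"
    using linear_form by metis
  define \<phi> where "\<phi> k = scale (g (lookup (fproj (int m) (T k)) b)) 1" for k
  have small: "fproj n (T k) = 0" if "k \<in> K" "n < int m" for n k
    unfolding fproj_T[OF that(1)] by (rule minimal[OF that(2) fproj_Kg[OF that(1)]])
  have "\<exists>\<psi>. (\<forall>k\<in>K. \<forall>l\<in>K. \<psi> (k + l) = \<psi> k + \<psi> l) \<and> (\<forall>a. \<forall>k\<in>K. \<psi> (free_act a k) = a * \<psi> k) \<and>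
        (\<forall>k\<in>K. proj 0 (\<psi> k) = \<phi> k)"
  proof (rule lift)
    show "\<phi> (k + l) = \<phi> k + \<phi> l" if "k \<in> K" "l \<in> K" for k l
      by (simp add: \<phi>_def T_add[OF that] fproj_add lookup_add iproj_add g(1) scale_left_distrib del: lookup_fproj)
    show "\<phi> (free_act a k) = proj 0 a * \<phi> k" if "k \<in> K" for a k
      unfolding \<phi>_def T_act[OF that]
      by (rule coefficient_functional[OF g(1,2) T_K[OF that] small[OF that]])
    show "\<phi> k \<in> gr 0" for k by (auto simp: \<phi>_def gr_0)
  qed
  then obtain \<psi>0 where \<psi>0: "\<And>k l. k \<in> K \<Longrightarrow> l \<in> K \<Longrightarrow> \<psi>0 (k + l) = \<psi>0 k + \<psi>0 l"
      "\<And>a k. k \<in> K \<Longrightarrow> \<psi>0 (free_act a k) = a * \<psi>0 k" "\<And>k. k \<in> K \<Longrightarrow> proj 0 (\<psi>0 k) = \<phi> k"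
    by (elim exE conjE) (metis that)
  obtain \<psi> where \<psi>: "\<And>k l. k \<in> K \<Longrightarrow> l \<in> K \<Longrightarrow> \<psi> (k + l) = \<psi> k + \<psi> l"
      "\<And>a k. k \<in> K \<Longrightarrow> \<psi> (free_act a k) = a * \<psi> k"
      "\<And>n k. k \<in> Kg n \<Longrightarrow> \<psi> k = iproj (n - int m) (\<psi>0 k)"
    by (rule relation_hom_component[of \<psi>0 "- int m", OF \<psi>0(1,2)]) (assumption | simp | rule that)+
  have "relation_map (- int m) \<psi>"
    using \<psi> by (simp add: relation_map_def iproj_iproj)
  moreover have "\<psi> r = 1"
  proof -
    have "\<psi> r = \<phi> r" using \<psi>(3)[OF r(1)] \<psi>0(3)[OF Kg_K[OF r(1)]] by (simp add: iproj_zero_degree)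
    also have "\<dots> = 1" using r(1) by (simp add: \<phi>_def r(2) Kg_def g(3) del: lookup_fproj)
    finally show ?thesis .
  qed
  moreover have "\<psi> k = 0" if "n \<le> int m" "k \<in> Kg n" "T k = 0" for n k
  proof (cases "n = int m")
    case True
    have "g 0 = 0" using g(2)[of 0 0] by simp
    then have "\<phi> k = 0" by (simp add: \<phi>_def that(3))
    then show ?thesis using \<psi>(3)[OF that(2)] \<psi>0(3)[OF Kg_K[OF that(2)]] True by (simp add: iproj_zero_degree)
  next
    case False
    then show ?thesis using \<psi>(3)[OF that(2)] that(1) by (simp add: iproj_def)
  qed
  ultimately show thesis using that[OF r] minimal by blast
qed

text \<open>
  Maps that extend to \<open>F\<close> take \<open>K\<close> into \<open>A\<^sub>+\<close>, by minimality.
\<close>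

lemma relation_coefficients_evaluate: "k \<in> K \<Longrightarrow> proj 0 (free_eval G k) = 0"
  by (simp add: free_eval_def proj_sum proj_0_mult K_degree_zero_coefficients)

text \<open>
  Split off a first generator \<open>r\<close> with \<open>\<psi> r = 1\<close>; the complement is the kernel of \<open>\<psi>\<close>. A second
  generator \<open>r'\<close> in the complement would give \<open>\<psi>'\<close> with \<open>\<psi>' r' = 1\<close> and \<open>\<psi>' r = 0\<close>, and the classes of
  \<open>\<psi>\<close> and \<open>\<psi>'\<close> in \<open>Ext\<^sup>2\<close> would be independent: maps that extend to \<open>F\<close> take values in \<open>A\<^sub>+\<close>.
\<close>

lemma relations_cyclic:
  assumes "K \<noteq> {0}"
  obtains m r \<psi> where "r \<in> Kg (int m)" "r \<noteq> 0" "relation_map (- int m) \<psi>" "\<psi> r = 1"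
    "\<And>k. k \<in> K \<Longrightarrow> k = free_act (\<psi> k) r"
proof -
  obtain k0 where k0: "k0 \<in> K" "k0 \<noteq> 0" using assms K.zero_mem by blast
  obtain m r \<psi> where r: "r \<in> Kg (int m)" "r \<noteq> 0" and \<psi>: "relation_map (- int m) \<psi>" "\<psi> r = 1"
    and min: "\<And>n k. \<lbrakk>n < int m; k \<in> Kg n\<rbrakk> \<Longrightarrow> k = 0"
    by (rule split_minimal_relation[of "\<lambda>k. k" k0]) (use k0 in auto)
  note \<psi>D = relation_mapD[OF \<psi>(1)]
  have rK: "r \<in> K" by (rule Kg_K[OF r(1)])
  define T where "T k = k - free_act (\<psi> k) r" for k
  have T_K: "T k \<in> K" if "k \<in> K" for k
    unfolding T_def by (intro K_diff that K.act_mem rK)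
  have \<psi>T: "\<psi> (T k) = 0" if "k \<in> K" for k
    using \<psi>D(1)[OF T_K[OF that] K.act_mem[OF rK], of "\<psi> k"] \<psi>D(2)[OF rK, of "\<psi> k"] \<psi>(2)
    by (simp add: T_def)
  have T_add: "T (k + l) = T k + T l" if "k \<in> K" "l \<in> K" for k l
    by (rule poly_mapping_eqI)
      (simp add: T_def \<psi>D(1)[OF that] lookup_minus lookup_add algebra_simps)
  have T_act: "T (free_act a k) = free_act a (T k)" if "k \<in> K" for a k
    by (rule poly_mapping_eqI)
      (simp add: T_def \<psi>D(2)[OF that] lookup_minus algebra_simps)
  have T_deg: "T k \<in> Kg n" if k: "k \<in> Kg n" for n k
  proof -
    have "fproj n (free_act (\<psi> k) r) = free_act (\<psi> k) r"
    proof (cases "n < int m")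
      case True
      then have "\<psi> k = 0" using \<psi>D(3)[OF k] by (simp add: iproj_def)
      then show ?thesis by simp
    next
      case False
      then have "\<psi> k \<in> gr (nat (n - int m))" using \<psi>D(3)[OF k] by (simp add: gr_iff_iproj)
      from fproj_act[OF this, of n r] show ?thesis using False r(1) by (simp add: Kg_def)
    qed
    then show ?thesis using k T_K[OF Kg_K[OF k]] by (simp add: Kg_def T_def fproj_diff)
  qed
  have T_idem: "T (T k) = T k" if "k \<in> K" for k
    using \<psi>T[OF that] by (simp add: T_def[of "T k"])
  have "T k = 0" if "k \<in> K" for k
  proof (rule ccontr)
    assume "T k \<noteq> 0"
    obtain m' r' \<psi>' where r': "r' \<in> Kg (int m')" "T r' = r'" "r' \<noteq> 0"
      and \<psi>': "relation_map (- int m') \<psi>'" "\<psi>' r' = 1"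
      and van: "\<And>n k. \<lbrakk>n \<le> int m'; k \<in> Kg n; T k = 0\<rbrakk> \<Longrightarrow> \<psi>' k = 0"
      using split_minimal_relation[OF T_add T_act T_deg T_idem \<open>k \<in> K\<close> \<open>T k \<noteq> 0\<close>] by metis
    have r'K: "r' \<in> K" by (rule Kg_K[OF r'(1)])
    have "int m \<le> int m'" using min[OF _ r'(1)] r'(3) by fastforce
    moreover have "T r = 0" by (rule poly_mapping_eqI) (simp add: T_def \<psi>(2) lookup_minus)
    ultimately have \<psi>'r: "\<psi>' r = 0" using van[OF _ r(1)] by simp
    have \<psi>r': "\<psi> r' = 0" using \<psi>T[OF r'K] r'(2) by simp
    obtain \<Lambda>1 \<Lambda>2 where \<Lambda>: "\<And>a1 a2 j1 j2. \<lbrakk>a1 \<in> gr j1; a2 \<in> gr j2; proj 0 (\<Lambda>1 * a1) = proj 0 (\<Lambda>2 * a2)\<rbrakk>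
        \<Longrightarrow> \<exists>G. \<forall>k\<in>K. \<psi> k * a1 = free_eval G k + \<psi>' k * a2"
      using ext[OF \<psi>(1) \<psi>'(1)] by blast
    have \<Lambda>0: "proj 0 (\<psi> k) * proj 0 a1 = proj 0 (\<psi>' k) * proj 0 a2"
      if a: "a1 \<in> gr j1" "a2 \<in> gr j2" "proj 0 (\<Lambda>1 * a1) = proj 0 (\<Lambda>2 * a2)" and k: "k \<in> K" for a1 a2 j1 j2 k
    proof -
      obtain G where "\<psi> k * a1 = free_eval G k + \<psi>' k * a2" using \<Lambda>[OF a] k by blast
      then have "proj 0 (\<psi> k * a1) = proj 0 (free_eval G k + \<psi>' k * a2)" by simp
      then show ?thesis by (simp add: proj_add proj_0_mult relation_coefficients_evaluate[OF k])
    qed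
    have p1: "proj 0 1 = 1" using proj_gr[OF one_gr, of 0] by simp
    have pp: "proj 0 (proj 0 x) = proj 0 x" for x using proj_gr[OF proj_in_gr, of 0 0 x] by simp
    have comm: "proj 0 (\<Lambda>1 * proj 0 \<Lambda>2) = proj 0 (\<Lambda>2 * proj 0 \<Lambda>1)"
      using gr_0_commute[OF proj_in_gr[of 0 \<Lambda>1], of "proj 0 \<Lambda>2"] by (simp add: proj_0_mult pp)
    \<comment> \<open>the multipliers \<open>proj 0 \<Lambda>2\<close> and \<open>proj 0 \<Lambda>1\<close> equate the two coordinates; evaluation at \<open>r'\<close>
        shows that the second is zero, and then \<open>\<psi>\<close> itself extends to \<open>F\<close>\<close>
    have "proj 0 \<Lambda>1 = 0"
      using \<Lambda>0[OF proj_in_gr proj_in_gr comm r'K] by (simp add: \<psi>r' \<psi>'(2) p1 pp)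
    then have "proj 0 (\<Lambda>1 * 1) = proj 0 (\<Lambda>2 * 0)" by (simp add: proj_0_mult)
    from \<Lambda>0[OF one_gr subspace_0[OF gr_subspace] this rK] show False
      by (simp add: \<psi>(2) \<psi>'r p1)
  qed
  then have "k = free_act (\<psi> k) r" if "k \<in> K" for k using that by (simp add: T_def)
  from r \<psi> this show thesis by (rule that)
qed

text \<open>
  Since \<open>A\<^sub>+\<close> annihilates \<open>Ext\<^sup>2\<close>, every \<open>x\<close> of degree one is a combination
  \<open>\<Sum> r\<^sub>b G b\<close> of the coefficients of the relation \<open>r\<close>, so these have degree one and span.
\<close>

lemma relation_nondegenerate:
  assumes "K \<noteq> {0}" "B \<noteq> {}"
  obtains r where "r \<in> K" "\<And>k. k \<in> K \<Longrightarrow> \<exists>a. k = free_act a r"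
    "\<And>b. lookup r b \<in> gr 1" "gr 1 \<subseteq> span (lookup r ` keys r)" "\<And>a. free_act a r = 0 \<Longrightarrow> a = 0"
proof -
  obtain m r \<psi> where r: "r \<in> Kg (int m)" "r \<noteq> 0" and \<psi>: "relation_map (- int m) \<psi>" "\<psi> r = 1"
    and gen: "\<And>k. k \<in> K \<Longrightarrow> k = free_act (\<psi> k) r"
    by (rule relations_cyclic[OF assms(1)]) (rule that)
  have rK: "r \<in> K" by (rule Kg_K[OF r(1)])
  have fr: "fproj (int m) r = r" using r(1) by (simp add: Kg_def)
  have m: "m \<ge> 2" using K_fproj_small[OF rK, of "int m"] r(2) fr by fastforce
  have coeff: "lookup r b \<in> gr (m - 1)" for b
  proof -
    have "lookup (fproj (int m) r) b = lookup r b" by (simp only: fr)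
    then show ?thesis using m by (simp add: gr_iff_iproj of_nat_diff)
  qed
  have repr: "\<exists>G. x = free_eval G r" if x: "x \<in> gr 1" for x
  proof -
    obtain \<Lambda>1 \<Lambda>2 where \<Lambda>: "\<And>a1 a2 j1 j2. \<lbrakk>a1 \<in> gr j1; a2 \<in> gr j2; proj 0 (\<Lambda>1 * a1) = proj 0 (\<Lambda>2 * a2)\<rbrakk>
        \<Longrightarrow> \<exists>G. \<forall>k\<in>K. \<psi> k * a1 = free_eval G k + \<psi> k * a2"
      using ext[OF \<psi>(1) \<psi>(1)] by blast
    have "proj 0 (\<Lambda>1 * x) = proj 0 (\<Lambda>2 * 0)" using proj_gr[OF x, of 0] by (simp add: proj_0_mult)
    from \<Lambda>[OF x subspace_0[OF gr_subspace] this] obtain G where "\<psi> r * x = free_eval G r + \<psi> r * 0"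
      using rK by blast
    then show ?thesis using \<psi>(2) by auto
  qed
  have proj_eval: "proj 1 (free_eval G r) =
      (\<Sum>b\<in>keys r. if m - 1 \<le> 1 then lookup r b * proj (1 - (m - 1)) (G b) else 0)" for G
    unfolding free_eval_def proj_sum by (intro sum.cong HOL.refl proj_mult_left coeff)
  have m2: "m = 2"
  proof (rule ccontr)
    assume "m \<noteq> 2"
    obtain b where b: "b \<in> B" using assms(2) by blast
    then have b1: "b \<in> gr 1" using B_gr by blast
    obtain G where "b = free_eval G r" using repr[OF b1] by blast
    then have "proj 1 b = proj 1 (free_eval G r)" by simp
    moreover have "\<not> m - 1 \<le> 1" using m \<open>m \<noteq> 2\<close> by linarith
    then have "proj 1 (free_eval G r) = 0" unfolding proj_eval by simp
    ultimately have "b = 0" using proj_gr[OF b1, of 1] by simp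
    then have "dependent B" using b dependent_zero[of B] by simp
    then show False using independent_B by contradiction
  qed
  show thesis
  proof (rule that[OF rK])
    show "\<exists>a. k = free_act a r" if "k \<in> K" for k using gen[OF that] by blast
    show "lookup r b \<in> gr 1" for b using coeff[of b] by (simp add: m2)
    show "a = 0" if "free_act a r = 0" for a
    proof -
      have "\<psi> 0 = 0" using relation_mapD(2)[OF \<psi>(1) K.zero_mem, of 0] by simp
      then show ?thesis using relation_mapD(2)[OF \<psi>(1) rK, of a] that \<psi>(2) by simp
    qed
    show "gr 1 \<subseteq> span (lookup r ` keys r)"
    proof
      fix x assume x: "x \<in> gr 1"
      obtain G where "x = free_eval G r" using repr[OF x] by blast
      then have "x = proj 1 (free_eval G r)" using proj_gr[OF x, of 1] by simp
      also have "\<dots> = (\<Sum>b\<in>keys r. lookup r b * proj 0 (G b))" unfolding proj_eval by (simp add: m2)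
      also have "\<dots> \<in> span (lookup r ` keys r)"
      proof (rule span_sum)
        fix b assume b: "b \<in> keys r"
        obtain c where "proj 0 (G b) = scale c 1" using proj_in_gr[of 0 "G b"] by (auto simp: gr_0)
        then have "lookup r b * proj 0 (G b) = scale c (lookup r b)" by (simp add: scale_mult_right)
        then show "lookup r b * proj 0 (G b) \<in> span (lookup r ` keys r)"
          using b by (simp add: span_scale span_base)
      qed
      finally show "x \<in> span (lookup r ` keys r)" .
    qed
  qed
qed

end

section \<open>Commutativity and exponential growth\<close>

context generated_algebra
begin

lemma subalgebra_eq_UNIV:
  assumes "subspace S" "1 \<in> S" "gr 1 \<subseteq> S" "\<And>x y. x \<in> S \<Longrightarrow> y \<in> S \<Longrightarrow> x * y \<in> S"
  shows "x \<in> S"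
proof -
  have "prod_list xs \<in> S" if "set xs \<subseteq> gr 1" for xs
    using that assms(2-4) by (induction xs) (simp_all add: subset_iff)
  then have "{prod_list xs | xs. set xs \<subseteq> gr 1} \<subseteq> S" by auto
  then have "span {prod_list xs | xs. set xs \<subseteq> gr 1} \<subseteq> S" by (rule span_minimal) (fact assms(1))
  moreover have "x \<in> span {prod_list xs | xs. set xs \<subseteq> gr 1}"
    using generated unfolding generated_in_degree_one_def by simp
  ultimately show ?thesis by (rule subsetD)
qed

lemma centralizer_subspace: "subspace {x. \<forall>z\<in>Z. x * z = z * x}"
  by (rule subspaceI) (auto simp: distrib_left distrib_right scale_mult_left scale_mult_right)

text \<open>
  Centralizers are subalgebras, so it suffices that they contain the generators.
\<close>

lemma centralizer_eq_UNIV: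
  assumes "\<And>x z. x \<in> gr 1 \<Longrightarrow> z \<in> Z \<Longrightarrow> x * z = z * x"
  shows "z \<in> Z \<Longrightarrow> x * z = z * x"
proof -
  have "x \<in> {x. \<forall>z\<in>Z. x * z = z * x}"
  proof (rule subalgebra_eq_UNIV[OF centralizer_subspace])
    fix x y assume "x \<in> {x. \<forall>z\<in>Z. x * z = z * x}" "y \<in> {x. \<forall>z\<in>Z. x * z = z * x}"
    then show "x * y \<in> {x. \<forall>z\<in>Z. x * z = z * x}" by (simp add: mult.assoc) (metis mult.assoc)
  qed (use assms in auto)
  then show "z \<in> Z \<Longrightarrow> x * z = z * x" by simp
qed

lemma commutative_if_one_generator:
  assumes "B \<subseteq> {v}"
  shows "x * y = y * (x :: 'a)"
proof -
  have *: "z \<in> range (\<lambda>c. scale c v)" if "z \<in> gr 1" for z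
  proof -
    have "z \<in> span {v}" using that span_mono[OF assms] unfolding span_B by auto
    then show ?thesis by (simp add: span_singleton)
  qed
  have 1: "x * y = y * x" if xy: "x \<in> gr 1" "y \<in> gr 1" for x y
  proof -
    obtain c c' where "x = scale c v" "y = scale c' v" using *[OF xy(1)] *[OF xy(2)] by blast
    then show ?thesis by (simp add: scale_mult_left scale_mult_right mult.commute)
  qed
  have 2: "x * z = z * x" if "z \<in> gr 1" for x z
    by (rule centralizer_eq_UNIV[OF 1 that])
  show ?thesis by (rule centralizer_eq_UNIV[where Z = UNIV]) (simp_all add: 2)
qed

end

context k_algebra
begin

definition words_of_length :: "'a \<Rightarrow> 'a \<Rightarrow> nat \<Rightarrow> 'a set" where
  "words_of_length x y n = {prod_list xs | xs. set xs \<subseteq> {x, y} \<and> length xs = n}"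

text \<open>
  Under this assumption \<open>x\<close> and \<open>y\<close> generate a free subalgebra; the independent words are
  obtained by appending either letter to independent words.
\<close>

lemma free_pair_independent_words:
  fixes x y :: 'a
  assumes free: "\<And>a1 a2. a1 * x + a2 * y = 0 \<Longrightarrow> a1 = 0 \<and> a2 = 0"
  shows "\<exists>E. E \<subseteq> words_of_length x y n \<and> finite E \<and> independent E \<and> card E = 2 ^ n"
proof (induction n)
  case 0
  show ?case
  proof (intro exI[of _ "{1}"] conjI)
    show "{1} \<subseteq> words_of_length x y 0" by (auto simp: words_of_length_def)
  qed auto
next
  case (Suc n)
  then obtain E where E: "E \<subseteq> words_of_length x y n" "finite E" "independent E" "card E = 2 ^ n"
    by blast
  let ?X = "(\<lambda>e. e * x) ` E" and ?Y = "(\<lambda>e. e * y) ` E"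
  have injx: "inj_on (\<lambda>e. e * x) E" and injy: "inj_on (\<lambda>e. e * y) E"
  proof -
    show "inj_on (\<lambda>e. e * x) E"
    proof (rule inj_onI)
      fix e e' assume "e * x = e' * x"
      then have "(e - e') * x + 0 * y = 0" by (simp add: left_diff_distrib)
      from free[OF this] show "e = e'" by simp
    qed
    show "inj_on (\<lambda>e. e * y) E"
    proof (rule inj_onI)
      fix e e' assume "e * y = e' * y"
      then have "0 * x + (e - e') * y = 0" by (simp add: left_diff_distrib)
      from free[OF this] show "e = e'" by simp
    qed
  qed
  have disj: "?X \<inter> ?Y = {}"
  proof (rule ccontr)
    assume "?X \<inter> ?Y \<noteq> {}"
    then obtain e e' where e: "e \<in> E" "e' \<in> E" "e * x = e' * y" by auto
    then have "e * x + (- e') * y = 0" by simp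
    from free[OF this] have "e = 0" by simp
    then show False using e(1) E(3) dependent_zero[of E] by simp
  qed
  have indep: "independent (?X \<union> ?Y)"
  proof
    assume "dependent (?X \<union> ?Y)"
    then obtain u where u: "\<exists>v\<in>?X \<union> ?Y. u v \<noteq> 0" "(\<Sum>v\<in>?X \<union> ?Y. scale (u v) v) = 0"
      using E(2) by (auto simp: dependent_finite)
    let ?a = "\<Sum>e\<in>E. scale (u (e * x)) e" and ?b = "\<Sum>e\<in>E. scale (u (e * y)) e"
    have "0 = (\<Sum>v\<in>?X. scale (u v) v) + (\<Sum>v\<in>?Y. scale (u v) v)"
      using u(2) disj E(2) by (simp add: sum.union_disjoint)
    also have "\<dots> = ?a * x + ?b * y"
      by (simp add: sum.reindex[OF injx] sum.reindex[OF injy] sum_distrib_right scale_mult_left)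
    finally have "?a = 0 \<and> ?b = 0" by (intro free) simp
    then have "u (e * x) = 0" "u (e * y) = 0" if "e \<in> E" for e
      using independentD[OF E(3) E(2) subset_refl, of "\<lambda>e. u (e * x)" e]
        independentD[OF E(3) E(2) subset_refl, of "\<lambda>e. u (e * y)" e] that by simp_all
    with u(1) show False by blast
  qed
  have "(\<lambda>e. e * z) ` E \<subseteq> words_of_length x y (Suc n)" if "z \<in> {x, y}" for z
  proof
    fix w assume "w \<in> (\<lambda>e. e * z) ` E"
    then obtain xs where "w = prod_list xs * z" "set xs \<subseteq> {x, y}" "length xs = n"
      using E(1) by (auto simp: words_of_length_def)
    then show "w \<in> words_of_length x y (Suc n)"
      using that unfolding words_of_length_def by (intro CollectI exI[of _ "xs @ [z]"]) auto
  qed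
  then have "?X \<union> ?Y \<subseteq> words_of_length x y (Suc n)" by auto
  moreover have "card (?X \<union> ?Y) = 2 ^ Suc n"
    using E(2,4) disj by (simp add: card_Un_disjoint card_image[OF injx] card_image[OF injy])
  ultimately show ?case using indep E(2) by (intro exI[of _ "?X \<union> ?Y"]) simp
qed

text \<open>
  The dimension is the cardinality of a basis only in the finite-dimensional case, so a finite spanning
  set is needed.
\<close>

lemma powers_upto_span_pair:
  fixes x y :: 'a
  shows "powers_upto scale (span {x, y}) n \<subseteq> span {prod_list xs | xs. set xs \<subseteq> {x, y} \<and> length xs \<le> n}"
proof -
  let ?T = "\<lambda>n. {prod_list xs | xs. set xs \<subseteq> {x, y} \<and> length xs \<le> n}"
  have mult: "v * w \<in> span (?T (Suc n))" if "v \<in> span {x, y}" "w \<in> span (?T n)" for v w n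
    using that(2)
  proof (induction w rule: span_induct_alt)
    case base
    show ?case by (simp add: span_zero)
  next
    case (step c t w)
    have "v * t \<in> span (?T (Suc n))"
      using that(1)
    proof (induction v rule: span_induct_alt)
      case base
      show ?case by (simp add: span_zero)
    next
      case (step c' z v)
      obtain xs where "t = prod_list xs" "set xs \<subseteq> {x, y}" "length xs \<le> n"
        using \<open>t \<in> ?T n\<close> by auto
      then have "z * t \<in> ?T (Suc n)"
        using step.hyps by (intro CollectI exI[of _ "z # xs"]) auto
      then show ?case
        using step.IH by (simp add: distrib_right scale_mult_left span_add span_scale span_base)
    qed
    then show ?case using step.IH by (simp add: distrib_left scale_mult_right span_add span_scale)
  qed
  have mono: "span (?T m) \<subseteq> span (?T n)" if "m \<le> n" for m n
    using that by (intro span_mono) auto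
  have "prod_list xs \<in> span (?T (length xs))" if "set xs \<subseteq> span {x, y}" for xs
    using that
  proof (induction xs)
    case Nil
    show ?case by (intro span_base CollectI exI[of _ "[]"]) simp
  qed (use mult in auto)
  then have "{prod_list xs | xs. set xs \<subseteq> span {x, y} \<and> length xs \<le> n} \<subseteq> span (?T n)"
    using mono by blast
  then show ?thesis unfolding powers_upto_def by (rule span_minimal) (rule subspace_span)
qed

lemma free_pair_dim:
  fixes x y :: 'a
  assumes free: "\<And>a1 a2. a1 * x + a2 * y = 0 \<Longrightarrow> a1 = 0 \<and> a2 = 0"
  shows "2 ^ n \<le> dim (powers_upto scale (span {x, y}) n)"
proof -
  let ?V = "powers_upto scale (span {x, y}) n"
  let ?T = "{prod_list xs | xs. set xs \<subseteq> {x, y} \<and> length xs \<le> n}"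
  obtain E where E: "E \<subseteq> words_of_length x y n" "finite E" "independent E" "card E = 2 ^ n"
    using free_pair_independent_words[OF free] by blast
  have "finite {xs. set xs \<subseteq> {x, y} \<and> length xs \<le> n}" by (rule finite_lists_length_le) simp
  moreover have "?T = prod_list ` {xs. set xs \<subseteq> {x, y} \<and> length xs \<le> n}" by auto
  ultimately have "finite ?T" by simp
  obtain C where C: "C \<subseteq> ?V" "independent C" "?V \<subseteq> span C" "card C = dim ?V"
    by (rule basis_exists)
  have "finite C"
    using independent_span_bound[OF \<open>finite ?T\<close> C(2)] C(1) powers_upto_span_pair by blast
  moreover have "E \<subseteq> ?V"
  proof
    fix w assume "w \<in> E"
    then obtain xs where "w = prod_list xs" "set xs \<subseteq> {x, y}" "length xs = n"
      using E(1) by (auto simp: words_of_length_def)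
    then show "w \<in> ?V"
      unfolding powers_upto_def using span_superset[of "{x, y}"]
      by (intro span_base CollectI exI[of _ xs]) auto
  qed
  ultimately have "card E \<le> card C"
    using independent_span_bound[of C E] E(3) C(3) by blast
  then show ?thesis using E(4) C(4) by simp
qed

lemma free_pair_gk_dim:
  fixes x y :: 'a
  assumes free: "\<And>a1 a2. a1 * x + a2 * y = 0 \<Longrightarrow> a1 = 0 \<and> a2 = 0"
  shows "gk_dim scale = \<infinity>"
proof -
  let ?V = "span {x, y}"
  let ?f = "\<lambda>n. log (real n) (real (dim (powers_upto scale ?V n)))"
  have ge: "sqrt (real n) * (ln 2 / 2) \<le> ?f n" if n: "n \<ge> 2" for n
  proof -
    have pos: "ln (real n) > 0" using n by simp
    have dim: "(2::real) ^ n \<le> real (dim (powers_upto scale ?V n))"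
      using free_pair_dim[OF free, where n = n] by (metis of_nat_le_iff of_nat_numeral of_nat_power)
    \<comment> \<open>\<open>n ln 2 / ln n\<close> is at least a multiple of \<open>sqrt n\<close>, since \<open>ln n = 2 ln (sqrt n)\<close>\<close>
    have "ln (sqrt (real n)) \<le> sqrt (real n)"
      using ln_le_minus_one[of "sqrt (real n)"] n by simp
    then have le: "ln (real n) \<le> 2 * sqrt (real n)" using n by (simp add: ln_sqrt)
    have "sqrt (real n) * (ln 2 / 2) * ln (real n) \<le> sqrt (real n) * (ln 2 / 2) * (2 * sqrt (real n))"
      using le by (intro mult_left_mono) auto
    also have "\<dots> = ln (2 ^ n)" by (simp add: ln_realpow)
    finally have "sqrt (real n) * (ln 2 / 2) \<le> log (real n) (2 ^ n)"
      using pos by (simp add: log_def field_simps)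
    also have "\<dots> \<le> ?f n"
      using n dim by (subst log_le_cancel_iff) (auto intro: less_le_trans[of 0 "2 ^ n"])
    finally show ?thesis .
  qed
  have "filterlim (\<lambda>n. (ln 2 / 2) * sqrt (real n)) at_top sequentially"
    by (intro filterlim_tendsto_pos_mult_at_top[OF tendsto_const]
        filterlim_compose[OF sqrt_at_top filterlim_real_sequentially]) simp
  then have "filterlim ?f at_top sequentially"
    by (rule filterlim_at_top_mono)
      (use ge in \<open>auto simp: mult.commute eventually_sequentially intro!: exI[of _ 2]\<close>)
  then have "(\<lambda>n. ereal (?f n)) \<longlonglongrightarrow> \<infinity>"
    by (simp add: tendsto_PInfty_eq_at_top)
  then have "limsup (\<lambda>n. ereal (?f n)) = \<infinity>"
    by (rule lim_imp_Limsup[OF sequentially_bot])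
  moreover have "limsup (\<lambda>n. ereal (?f n)) \<le> gk_dim scale"
    unfolding gk_dim_def by (rule SUP_upper) blast
  ultimately show ?thesis by simp
qed

end

section \<open>The quadratic relation in two generators\<close>

locale noncommutative_regular = regular_relations scale gr B
  for scale :: "'k::field \<Rightarrow> 'a::ring_1 \<Rightarrow> 'a" and gr B +
  assumes finite_gk_dim: "gk_dim scale < \<infinity>" and noncommutative: "\<exists>x y :: 'a. x * y \<noteq> y * x"
begin

lemma no_free_pair: "\<exists>a1 a2. a1 * x + a2 * y = 0 \<and> \<not> (a1 = 0 \<and> a2 = (0 :: 'a))"
proof (rule ccontr)
  assume "\<not> ?thesis"
  then have "gk_dim scale = \<infinity>" by (intro free_pair_gk_dim[of x y]) blast
  then show False using finite_gk_dim by simp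
qed

lemma two_generators:
  obtains b1 b2 where "b1 \<in> B" "b2 \<in> B" "b1 \<noteq> b2"
proof -
  have not_sub: "\<not> B \<subseteq> {v}" for v
    using commutative_if_one_generator[of v] noncommutative by metis
  from not_sub[of 0] obtain b1 where b1: "b1 \<in> B" by blast
  from not_sub[of b1] obtain b2 where "b2 \<in> B" "b2 \<noteq> b1" by blast
  with b1 show thesis by (intro that[of b1 b2]) auto
qed

lemma pair_relation:
  assumes "b1 \<in> B" "b2 \<in> B" "b1 \<noteq> b2" "a1 * b1 + a2 * b2 = 0"
  shows "Poly_Mapping.single b1 a1 + Poly_Mapping.single b2 a2 \<in> K"
  using assms by (simp add: K_def d_add free.add_mem single_in_free_on)

text \<open>
  Without relations any two generators would generate a free subalgebra.
\<close>

lemma relations_nontrivial: "K \<noteq> {0}"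
proof
  assume K: "K = {0}"
  obtain b1 b2 where b: "b1 \<in> B" "b2 \<in> B" "b1 \<noteq> b2" by (rule two_generators)
  obtain a1 a2 where a: "a1 * b1 + a2 * b2 = 0" "\<not> (a1 = 0 \<and> a2 = 0)" using no_free_pair by blast
  from pair_relation[OF b a(1)] K
  have eq: "Poly_Mapping.single b1 a1 + Poly_Mapping.single b2 a2 = 0" by simp
  have "a1 = 0" using arg_cong[OF eq, of "\<lambda>k. lookup k b1"] b(3) by (simp add: lookup_add lookup_single when_def)
  moreover have "a2 = 0"
    using arg_cong[OF eq, of "\<lambda>k. lookup k b2"] b(3) by (simp add: lookup_add lookup_single when_def)
  ultimately show False using a(2) by simp
qed

text \<open>
  The coefficients of \<open>r\<close> span \<open>gr 1\<close>, and there are at most as many of them as elements of the basis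
  \<open>B\<close>; so \<open>B\<close> is finite and they are a basis too.
\<close>

lemma relation_basis:
  obtains r where "finite B" "r \<in> K" "\<And>k. k \<in> K \<Longrightarrow> \<exists>a. k = free_act a r" "\<And>b. lookup r b \<in> gr 1"
    "\<And>a. free_act a r = 0 \<Longrightarrow> a = 0"
    "\<And>c. (\<Sum>b\<in>B. scale (c b) (lookup r b)) = 0 \<Longrightarrow> \<forall>b\<in>B. c b = 0"
proof -
  have "B \<noteq> {}" using two_generators by blast
  then obtain r where r: "r \<in> K" "\<And>k. k \<in> K \<Longrightarrow> \<exists>a. k = free_act a r"
    "\<And>b. lookup r b \<in> gr 1" "gr 1 \<subseteq> span (lookup r ` keys r)" "\<And>a. free_act a r = 0 \<Longrightarrow> a = 0"
    by (rule relation_nondegenerate[OF relations_nontrivial]) (rule that)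
  let ?R = "lookup r ` keys r"
  have keys: "keys r \<subseteq> B" using r(1) by (simp add: K_def free_on_def)
  have small: "finite B \<and> card B \<le> card S" if "finite S" "gr 1 \<subseteq> span S" for S
    using independent_span_bound[OF that(1) independent_B] that(2) B_gr by blast
  have fin: "finite B" and "card B \<le> card ?R" using small[OF _ r(4)] by simp_all
  moreover have "card ?R \<le> card (keys r)" by (rule card_image_le) simp
  moreover have "card (keys r) \<le> card B" by (rule card_mono[OF fin keys])
  ultimately have card: "card ?R = card (keys r)" "card B = card (keys r)" by simp_all
  have keysB: "keys r = B" by (rule card_subset_eq[OF fin keys]) (simp add: card(2))
  have inj: "inj_on (lookup r) B"
    by (rule eq_card_imp_inj_on[OF fin]) (use card(1) in \<open>simp only: keysB\<close>)
  have "independent ?R"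
  proof
    assume "dependent ?R"
    then obtain v where v: "v \<in> ?R" "v \<in> span (?R - {v})" unfolding dependent_def by blast
    then have "span (?R - {v}) = span ?R" by (metis insert_Diff span_redundant)
    then have "card B \<le> card (?R - {v})" using small[of "?R - {v}"] r(4) by simp
    also have "\<dots> < card ?R" using v(1) by (intro psubset_card_mono) auto
    finally show False using card by simp
  qed
  have coeff: "\<forall>b\<in>B. c b = 0" if sum: "(\<Sum>b\<in>B. scale (c b) (lookup r b)) = 0" for c
  proof
    fix b assume b: "b \<in> B"
    let ?u = "\<lambda>v. c (inv_into B (lookup r) v)"
    have "(\<Sum>v\<in>lookup r ` B. scale (?u v) v) = (\<Sum>b\<in>B. scale (c b) (lookup r b))"
      by (subst sum.reindex[OF inj]) (simp add: inj)
    then have "?u (lookup r b) = 0"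
      using independentD[OF \<open>independent ?R\<close>, of "lookup r ` B" ?u "lookup r b"] sum fin b
      by (simp add: keysB)
    then show "c b = 0" using b inj by simp
  qed
  show thesis by (rule that[OF fin r(1,2,3,5) coeff])
qed

text \<open>
  Nonzero elements of degree one are right regular. If \<open>a v = 0\<close> with \<open>v = \<Sum> c\<^sub>b b\<close> then the
  coefficients \<open>c\<^sub>b a\<close> are a multiple \<open>a' r\<^sub>b\<close> of the relation, so \<open>a'\<close>, which has smaller degree,
  annihilates a nonzero combination of the \<open>r\<^sub>b\<close>.
\<close>

lemma right_regular_homogeneous:
  assumes "a \<in> gr n" "v \<in> gr 1" "v \<noteq> 0" "a * v = 0"
  shows "a = 0"
  using assms
proof (induction n arbitrary: a v)
  case 0
  then obtain c where "a = scale c 1" by (auto simp: gr_0)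
  then show ?case using "0.prems" by (auto simp: scale_mult_left)
next
  case (Suc n)
  obtain r where fin: "finite B" and r: "r \<in> K" "\<And>k. k \<in> K \<Longrightarrow> \<exists>a. k = free_act a r" "\<And>b. lookup r b \<in> gr 1"
    and nondeg: "\<And>c. (\<Sum>b\<in>B. scale (c b) (lookup r b)) = 0 \<Longrightarrow> \<forall>b\<in>B. c b = 0"
    by (rule relation_basis) (rule that)
  have "v \<in> span B" using Suc.prems(2) span_B by simp
  then obtain c where c: "v = (\<Sum>b\<in>B. scale (c b) b)" using fin by (auto simp: span_finite)
  define k where "k = (\<Sum>b\<in>B. Poly_Mapping.single b (scale (c b) a))"
  have lk: "lookup k b = scale (c b) a" if "b \<in> B" for b
    unfolding k_def lookup_sum using fin that by (simp add: lookup_single when_def)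
  have kF: "k \<in> F"
  proof (rule free_onI)
    fix b assume "b \<notin> B"
    then have "(\<Sum>x\<in>B. lookup (Poly_Mapping.single x (scale (c x) a)) b) = 0"
      by (intro sum.neutral) (auto simp: lookup_single when_def)
    then show "lookup k b = 0" by (simp add: k_def lookup_sum)
  qed
  have "d k = (\<Sum>b\<in>B. lookup k b * b)"
    unfolding d_def using kF fin by (intro free_eval_superset) (auto simp: free_on_def)
  also have "\<dots> = a * v"
    by (simp add: lk c sum_distrib_left scale_mult_left scale_mult_right)
  finally have "k \<in> K" using kF Suc.prems(4) by (simp add: K_def)
  then obtain a' where a': "k = free_act a' r" using r(2) by blast
  have eq: "scale (c b) a = proj n a' * lookup r b" if "b \<in> B" for b
  proof -
    have "scale (c b) a = a' * lookup r b" using lk[OF that] by (simp add: a')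
    then have "proj (Suc n) (scale (c b) a) = proj (Suc n) (a' * lookup r b)" by simp
    then show ?thesis
      using proj_gr[OF subspace_scale[OF gr_subspace Suc.prems(1)], of "Suc n" "c b"]
        proj_mult_right[OF r(3), of "Suc n" a' b] by simp
  qed
  obtain b1 b2 where b: "b1 \<in> B" "b2 \<in> B" "b1 \<noteq> b2" by (rule two_generators)
  \<comment> \<open>a nonzero linear form vanishing on the coordinates of \<open>v\<close>\<close>
  obtain l where l: "\<exists>b\<in>B. l b \<noteq> 0" "(\<Sum>b\<in>B. l b * c b) = 0"
  proof (cases "c b1 = 0")
    case True
    show thesis
      by (rule that[of "\<lambda>b. if b = b1 then 1 else 0"])
        (use b True fin in \<open>auto simp: if_distrib[of "\<lambda>x. x * _"] cong: if_cong\<close>)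
  next
    case False
    let ?l = "\<lambda>b. (if b = b1 then c b2 else 0) + (if b = b2 then - c b1 else 0)"
    have "(\<Sum>b\<in>B. ?l b * c b) = (\<Sum>b\<in>B. (if b = b1 then c b2 * c b1 else 0) + (if b = b2 then - c b1 * c b2 else 0))"
      by (intro sum.cong HOL.refl) (simp add: algebra_simps)
    also have "\<dots> = 0" using fin b by (simp add: sum.distrib)
    finally show thesis using False b by (intro that[of ?l]) auto
  qed
  define w where "w = (\<Sum>b\<in>B. scale (l b) (lookup r b))"
  have "w \<noteq> 0" using nondeg[of l] l(1) by (auto simp: w_def)
  moreover have "w \<in> gr 1"
    unfolding w_def by (intro subspace_sum[OF gr_subspace] subspace_scale[OF gr_subspace] r(3))
  moreover have "proj n a' * w = (\<Sum>b\<in>B. scale (l b) (scale (c b) a))"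
    by (simp add: w_def sum_distrib_left scale_mult_right eq)
  then have "proj n a' * w = scale (\<Sum>b\<in>B. l b * c b) a" by (simp add: scale_sum_left)
  then have "proj n a' * w = 0" by (simp add: l(2))
  ultimately have "proj n a' = 0" using Suc.IH[OF proj_in_gr] by blast
  then have "scale (c b) a = 0" if "b \<in> B" for b using eq[OF that] by simp
  moreover have "\<exists>b\<in>B. c b \<noteq> 0"
  proof (rule ccontr)
    assume "\<not> ?thesis"
    then have "v = 0" unfolding c by (intro sum.neutral) simp
    then show False using Suc.prems(3) by contradiction
  qed
  ultimately show ?case by auto
qed

lemma right_regular:
  assumes "v \<in> gr 1" "v \<noteq> 0" "a * v = 0"
  shows "a = 0"
proof -
  have "proj n a = 0" for n
  proof (rule right_regular_homogeneous[OF proj_in_gr assms(1,2)])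
    show "proj n a * v = 0"
      using proj_mult_right[OF assms(1), of "Suc n" a] by (simp add: assms(3))
  qed
  then show ?thesis using sum_proj[of a] by simp
qed

text \<open>
  If there were a third generator then its coefficient in the relation would show that two
  others generate a free algebra.
\<close>

lemma quadratic_relation:
  obtains x y p q where "B = {x, y}" "x \<noteq> y" "p \<in> gr 1" "q \<in> gr 1" "p * x + q * y = 0"
    "\<And>a1 a2. a1 * x + a2 * y = 0 \<Longrightarrow> \<exists>a. a1 = a * p \<and> a2 = a * q"
    "\<And>c1 c2. scale c1 p + scale c2 q = 0 \<Longrightarrow> c1 = 0 \<and> c2 = 0"
proof -
  obtain r where fin: "finite B" and r: "r \<in> K" "\<And>k. k \<in> K \<Longrightarrow> \<exists>a. k = free_act a r" "\<And>b. lookup r b \<in> gr 1"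
    and nondeg: "\<And>c. (\<Sum>b\<in>B. scale (c b) (lookup r b)) = 0 \<Longrightarrow> \<forall>b\<in>B. c b = 0"
    by (rule relation_basis) (rule that)
  obtain x y where xy: "x \<in> B" "y \<in> B" "x \<noteq> y" by (rule two_generators)
  have rel: "\<exists>a. a1 = a * lookup r x \<and> a2 = a * lookup r y \<and> (\<forall>b. b \<noteq> x \<longrightarrow> b \<noteq> y \<longrightarrow> a * lookup r b = 0)"
    if a: "a1 * x + a2 * y = 0" for a1 a2
  proof -
    obtain a where eq: "Poly_Mapping.single x a1 + Poly_Mapping.single y a2 = free_act a r"
      using r(2)[OF pair_relation[OF xy a]] by blast
    have "lookup (Poly_Mapping.single x a1 + Poly_Mapping.single y a2) b = a * lookup r b" for b
      by (simp add: eq)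
    note coeff = this[unfolded lookup_add lookup_single when_def]
    have "a1 = a * lookup r x" "a2 = a * lookup r y" using coeff[of x] coeff[of y] xy(3) by simp_all
    moreover have "a * lookup r b = 0" if "b \<noteq> x" "b \<noteq> y" for b using coeff[of b] that by simp
    ultimately show ?thesis by blast
  qed
  have BE: "B = {x, y}"
  proof (rule ccontr)
    assume "B \<noteq> {x, y}"
    then obtain b where b: "b \<in> B" "b \<noteq> x" "b \<noteq> y" using xy by blast
    have rb: "lookup r b \<noteq> 0"
    proof
      assume "lookup r b = 0"
      then have "(\<Sum>z\<in>B. scale (if z = b then 1 else 0) (lookup r z)) = 0"
        by (intro sum.neutral) auto
      from nondeg[OF this] b(1) show False by auto
    qed
    obtain a1 a2 where a12: "a1 * x + a2 * y = 0" "\<not> (a1 = 0 \<and> a2 = 0)" using no_free_pair by blast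
    obtain a where a: "a1 = a * lookup r x" "a2 = a * lookup r y" "a * lookup r b = 0"
      using rel[OF a12(1)] b(2,3) by blast
    have "a = 0" by (rule right_regular[OF r(3) rb a(3)])
    then show False using a(1,2) a12(2) by simp
  qed
  have "lookup r x * x + lookup r y * y = 0"
  proof -
    have "d r = 0" and "keys r \<subseteq> B" using r(1) by (simp_all add: K_def free_on_def)
    then have "d r = (\<Sum>b\<in>{x, y}. lookup r b * b)"
      unfolding d_def BE by (intro free_eval_superset) simp_all
    then show ?thesis using \<open>d r = 0\<close> xy(3) by simp
  qed
  moreover have "c1 = 0 \<and> c2 = 0" if "scale c1 (lookup r x) + scale c2 (lookup r y) = 0" for c1 c2
  proof -
    have "(\<Sum>b\<in>B. scale (if b = x then c1 else c2) (lookup r b)) = 0"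
      using that xy(3) by (simp add: BE)
    from nondeg[OF this] show ?thesis using xy(3) by (simp add: BE)
  qed
  moreover have "\<exists>a. a1 = a * lookup r x \<and> a2 = a * lookup r y" if "a1 * x + a2 * y = 0" for a1 a2
    using rel[OF that] by blast
  ultimately show thesis by (intro that[OF BE xy(3) r(3) r(3)])
qed

end

section \<open>The algebra \<open>k\<langle>u, v\<rangle>/\<langle>u\<^sup>2 - v\<^sup>2\<rangle>\<close>\<close>

definition convolve :: "('x list \<Rightarrow> 'k::field) \<Rightarrow> ('x list \<Rightarrow> 'k) \<Rightarrow> 'x list \<Rightarrow> 'k" where
  "convolve p q w = (\<Sum>i\<le>length w. p (take i w) * q (drop i w))"

lemma convolve_support:
  "{w. convolve p q w \<noteq> 0} \<subseteq> (\<lambda>(v, w). v @ w) ` ({w. p w \<noteq> 0} \<times> {w. q w \<noteq> 0})"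
proof
  fix w assume "w \<in> {w. convolve p q w \<noteq> 0}"
  then obtain i where "p (take i w) * q (drop i w) \<noteq> 0"
    unfolding convolve_def by (metis (mono_tags, lifting) mem_Collect_eq sum.neutral)
  then show "w \<in> (\<lambda>(v, w). v @ w) ` ({w. p w \<noteq> 0} \<times> {w. q w \<noteq> 0})"
    by (intro image_eqI[of _ _ "(take i w, drop i w)"]) auto
qed

lemma convolve_finite:
  assumes "finite {w. p w \<noteq> 0}" "finite {w. q w \<noteq> 0}"
  shows "finite {w. convolve p q w \<noteq> 0}"
  by (rule finite_subset[OF convolve_support]) (use assms in simp)

lemma convolve_assoc:
  fixes p q r :: "'x list \<Rightarrow> 'k::field"
  shows "convolve (convolve p q) r = convolve p (convolve q r)"
proof
  fix w :: "'x list"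
  let ?n = "length w"
  have "convolve (convolve p q) r w =
      (\<Sum>i\<le>?n. \<Sum>j\<le>i. p (take j w) * q (take (i - j) (drop j w)) * r (drop i w))"
    unfolding convolve_def
    by (intro sum.cong HOL.refl) (simp add: sum_distrib_right take_drop min_def)
  also have "\<dots> = (\<Sum>(i, j)\<in>(SIGMA i:{..?n}. {..i}).
      p (take j w) * q (take (i - j) (drop j w)) * r (drop i w))"
    by (simp add: sum.Sigma)
  also have "\<dots> = (\<Sum>(j, l)\<in>(SIGMA j:{..?n}. {..?n - j}).
      p (take j w) * q (take l (drop j w)) * r (drop l (drop j w)))"
    by (rule sum.reindex_bij_witness[of _ "\<lambda>(j, l). (j + l, j)" "\<lambda>(i, j). (j, i - j)"]) auto
  also have "\<dots> = (\<Sum>j\<le>?n. \<Sum>l\<le>?n - j. p (take j w) * q (take l (drop j w)) * r (drop l (drop j w)))"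
    by (simp add: sum.Sigma)
  also have "\<dots> = convolve p (convolve q r) w"
    unfolding convolve_def
    by (intro sum.cong HOL.refl) (simp add: sum_distrib_left mult.assoc)
  finally show "convolve (convolve p q) r w = convolve p (convolve q r) w" .
qed

lemma convolve_one_left: "convolve (\<lambda>w. if w = [] then 1 else 0) p = p"
proof
  fix w
  have "convolve (\<lambda>w. if w = [] then 1 else 0) p w =
      (\<Sum>i\<in>{0}. (if take i w = [] then 1 else 0) * p (drop i w))"
    unfolding convolve_def by (rule sum.mono_neutral_right) auto
  then show "convolve (\<lambda>w. if w = [] then 1 else 0) p w = p w" by simp
qed

lemma convolve_one_right: "convolve p (\<lambda>w. if w = [] then 1 else 0) = p"
proof
  fix w
  have "convolve p (\<lambda>w. if w = [] then 1 else 0) w =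
      (\<Sum>i\<in>{length w}. p (take i w) * (if drop i w = [] then 1 else 0))"
    unfolding convolve_def by (rule sum.mono_neutral_right) auto
  then show "convolve p (\<lambda>w. if w = [] then 1 else 0) w = p w" by simp
qed

text \<open>
  Multiplication by a letter appends it; this gives the decomposition of a polynomial by last letters.
\<close>

lemma convolve_var:
  fixes p :: "'x list \<Rightarrow> 'k::field"
  shows "convolve p (free_var x) w = (if w \<noteq> [] \<and> last w = x then p (butlast w) else 0)"
proof (cases w rule: rev_cases)
  case Nil
  then show ?thesis by (simp add: convolve_def free_var_def)
next
  case (snoc v y)
  have "convolve p (free_var x) w = (\<Sum>i\<in>{length v}. p (take i w) * free_var x (drop i w))"
    unfolding convolve_def
  proof (rule sum.mono_neutral_right)
    show "\<forall>i\<in>{..length w} - {length v}. p (take i w) * free_var x (drop i w) = 0"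
    proof
      fix i assume i: "i \<in> {..length w} - {length v}"
      then have "length (drop i w) \<noteq> 1" by (auto simp: snoc)
      then have "drop i w \<noteq> [x]" by (metis One_nat_def length_Cons list.size(3))
      then have "free_var x (drop i w) = (0 :: 'k)" by (simp add: free_var_def)
      then show "p (take i w) * free_var x (drop i w) = 0" by simp
    qed
  qed (auto simp: snoc)
  then show ?thesis by (simp add: snoc free_var_def)
qed

abbreviation FA :: "('k::field, letter list \<Rightarrow> 'k) module" where
  "FA \<equiv> free_algebra"

lemma FA_simps [simp]:
  "carrier (FA :: ('k::field, _) module) = {p. finite {w. p w \<noteq> 0}}"
  "\<zero>\<^bsub>FA\<^esub> = (\<lambda>w. 0 :: 'k)"
  "\<one>\<^bsub>FA\<^esub> = (\<lambda>w. if w = [] then 1 else 0 :: 'k)"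
  "p \<oplus>\<^bsub>FA\<^esub> q = (\<lambda>w. p w + q w :: 'k)"
  "p \<otimes>\<^bsub>FA\<^esub> q = (convolve p q :: _ \<Rightarrow> 'k)"
  "c \<odot>\<^bsub>FA\<^esub> p = (\<lambda>w. c * p w :: 'k)"
  by (simp_all add: free_algebra_def convolve_def fun_eq_iff)

lemma support_add: 
  "finite {w. p w \<noteq> 0} \<Longrightarrow> finite {w. q w \<noteq> 0} \<Longrightarrow> finite {w. p w + q w \<noteq> (0 :: 'k::field)}"
  by (rule finite_subset[of _ "{w. p w \<noteq> 0} \<union> {w. q w \<noteq> 0}"]) auto

lemma ring_FA: "ring (FA :: ('k::field, _) module)"
proof (rule ringI)
  show "abelian_group (FA :: ('k, _) module)"
  proof (rule abelian_groupI)
    show "\<exists>q\<in>carrier FA. q \<oplus>\<^bsub>FA\<^esub> p = \<zero>\<^bsub>FA\<^esub>" if "p \<in> carrier FA" for p :: "letter list \<Rightarrow> 'k"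
      using that by (intro bexI[of _ "\<lambda>w. - p w"]) auto
  qed (auto simp: support_add fun_eq_iff algebra_simps)
  show "Group.monoid (FA :: ('k, _) module)"
    by (rule Group.monoid.intro)
      (auto simp: convolve_finite convolve_assoc convolve_one_left convolve_one_right)
qed (auto simp: convolve_def fun_eq_iff algebra_simps sum.distrib)

lemma support_diff:
  "finite {w. p w \<noteq> 0} \<Longrightarrow> finite {w. q w \<noteq> 0} \<Longrightarrow> finite {w. p w - q w \<noteq> (0 :: 'k::field)}"
  by (rule finite_subset[of _ "{w. p w \<noteq> 0} \<union> {w. q w \<noteq> 0}"]) auto

lemma var_finite: "finite {w. free_var l w \<noteq> (0 :: 'k::field)}"
  by (simp add: free_var_def)

definition relator :: "letter list \<Rightarrow> 'k::field" where
  "relator = (\<lambda>w. convolve (free_var L1) (free_var L1) w - convolve (free_var L2) (free_var L2) w)"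

lemma relator_finite: "finite {w. relator w \<noteq> (0 :: 'k::field)}"
  unfolding relator_def by (intro support_diff convolve_finite var_finite)

lemma relation_ideal_eq: "(relation_ideal :: (letter list \<Rightarrow> 'k::field) set) = Idl\<^bsub>FA\<^esub> {relator}"
proof -
  interpret ring "FA :: ('k, _) module" by (rule ring_FA)
  let ?f = "convolve (free_var L2) (free_var L2) :: letter list \<Rightarrow> 'k"
  have "\<ominus>\<^bsub>FA\<^esub> ?f = (\<lambda>w. - ?f w)"
  proof (rule minus_equality)
    show "?f \<in> carrier FA" "(\<lambda>w. - ?f w) \<in> carrier FA"
      using convolve_finite[OF var_finite var_finite, of L2 L2] by simp_all
  qed simp
  then show ?thesis by (simp add: relation_ideal_def relator_def a_minus_def)
qed

lemma ideal_relation_ideal: "ideal (relation_ideal :: (letter list \<Rightarrow> 'k::field) set) FA"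
  unfolding relation_ideal_eq
  by (rule ring.genideal_ideal[OF ring_FA]) (simp add: relator_finite)

lemma relator_in_relation_ideal: "(relator :: letter list \<Rightarrow> 'k::field) \<in> relation_ideal"
  unfolding relation_ideal_eq
  by (rule ring.genideal_self'[OF ring_FA]) (simp add: relator_finite)

text \<open>
  Exactness of \<open>A \<rightarrow> A\<^sup>2 \<rightarrow> A\<^sub>+ \<rightarrow> 0\<close> with maps \<open>a \<mapsto> (a u, - a v)\<close> and \<open>(a\<^sub>1, a\<^sub>2) \<mapsto> a\<^sub>1 u + a\<^sub>2 v\<close>. This
  characterises \<open>k\<langle>u, v\<rangle>/\<langle>u\<^sup>2 - v\<^sup>2\<rangle>\<close> among connected graded algebras.
\<close>

locale uv_relations = connected_graded_algebra scale gr
  for scale :: "'k::field \<Rightarrow> 'a::ring_1 \<Rightarrow> 'a" and gr +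
  fixes u v :: 'a
  assumes u_gr: "u \<in> gr 1" and v_gr: "v \<in> gr 1" and square_eq: "u * u = v * v"
    and exact: "a1 * u + a2 * v = 0 \<Longrightarrow> \<exists>a. a1 = a * u \<and> a2 = - (a * v)"
    and decompose: "x \<in> gr (Suc n) \<Longrightarrow> \<exists>a1\<in>gr n. \<exists>a2\<in>gr n. x = a1 * u + a2 * v"
begin

text \<open>
  Evaluation of noncommutative polynomials at \<open>u\<close> and \<open>v\<close>.
\<close>

definition mon :: "letter list \<Rightarrow> 'a" where
  "mon w = prod_list (map (case_letter u v) w)"

lemma mon_append: "mon (w @ w') = mon w * mon w'"
  by (simp add: mon_def)

lemma mon_gr: "mon w \<in> gr (length w)"
proof (induction w)
  case Nil
  show ?case using one_gr by (simp add: mon_def)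
next
  case (Cons l w)
  have "case_letter u v l \<in> gr 1" using u_gr v_gr by (cases l) simp_all
  from gr_mult[OF this Cons] show ?case by (simp add: mon_def)
qed

definition ev :: "(letter list \<Rightarrow> 'k) \<Rightarrow> 'a" where
  "ev p = (\<Sum>w | p w \<noteq> 0. scale (p w) (mon w))"

lemma ev_superset: "finite S \<Longrightarrow> {w. p w \<noteq> 0} \<subseteq> S \<Longrightarrow> ev p = (\<Sum>w\<in>S. scale (p w) (mon w))"
  unfolding ev_def by (rule sum.mono_neutral_left) auto

lemma ev_add:
  assumes "finite {w. p w \<noteq> 0}" "finite {w. q w \<noteq> 0}"
  shows "ev (\<lambda>w. p w + q w) = ev p + ev q"
proof -
  let ?S = "{w. p w \<noteq> 0} \<union> {w. q w \<noteq> 0}"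
  have S: "finite ?S" using assms by simp
  have "ev (\<lambda>w. p w + q w) = (\<Sum>w\<in>?S. scale (p w + q w) (mon w))" by (rule ev_superset[OF S]) auto
  also have "\<dots> = (\<Sum>w\<in>?S. scale (p w) (mon w)) + (\<Sum>w\<in>?S. scale (q w) (mon w))"
    by (simp add: scale_left_distrib sum.distrib)
  also have "\<dots> = ev p + ev q" using ev_superset[OF S, of p] ev_superset[OF S, of q] by auto
  finally show ?thesis .
qed

lemma ev_scale: 
  assumes "finite {w. p w \<noteq> 0}"
  shows "ev (\<lambda>w. c * p w) = scale c (ev p)"
proof -
  have "ev (\<lambda>w. c * p w) = (\<Sum>w | p w \<noteq> 0. scale (c * p w) (mon w))"
    by (rule ev_superset[OF assms]) auto
  then show ?thesis by (simp add: ev_def scale_sum_right)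
qed

lemma ev_zero: "ev (\<lambda>w. 0) = 0"
  by (simp add: ev_def)

lemma ev_one: "ev (\<lambda>w. if w = [] then 1 else 0) = 1"
  using ev_superset[of "{[]}" "\<lambda>w. if w = [] then 1 else 0"] by (simp add: mon_def)

lemma ev_var: "ev (free_var l) = case_letter u v l"
  using ev_superset[of "{[l]}" "free_var l"] by (auto simp: mon_def free_var_def)

lemma ev_convolve:
  assumes p: "finite {w. p w \<noteq> 0}" and q: "finite {w. q w \<noteq> 0}"
  shows "ev (convolve p q) = ev p * ev q"
proof -
  let ?P = "{w. p w \<noteq> 0}" and ?Q = "{w. q w \<noteq> 0}"
  let ?W = "(\<lambda>(v, w). v @ w) ` (?P \<times> ?Q)"
  let ?t = "\<lambda>(v, w). scale (p v * q w) (mon (v @ w))"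
  have fin: "finite (?P \<times> ?Q)" "finite ?W" using p q by simp_all
  have fibre: "(\<Sum>vw\<in>{vw \<in> ?P \<times> ?Q. (\<lambda>(v, w). v @ w) vw = w}. ?t vw) = scale (convolve p q w) (mon w)" for w
  proof -
    let ?f = "\<lambda>i. (take i w, drop i w)"
    have inj: "inj_on ?f {..length w}"
    proof (rule inj_onI)
      fix i j assume "i \<in> {..length w}" "j \<in> {..length w}" "?f i = ?f j"
      then have "length (take i w) = length (take j w)" by simp
      then show "i = j" using \<open>i \<in> _\<close> \<open>j \<in> _\<close> by simp
    qed
    have fibre: "{vw \<in> ?P \<times> ?Q. (\<lambda>(v, w). v @ w) vw = w} \<subseteq> ?f ` {..length w}"
    proof
      fix vw assume "vw \<in> {vw \<in> ?P \<times> ?Q. (\<lambda>(v, w). v @ w) vw = w}"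
      then obtain v v' where "vw = (v, v')" "v @ v' = w" by auto
      then show "vw \<in> ?f ` {..length w}" by (intro image_eqI[of _ _ "length v"]) auto
    qed
    have "(\<Sum>vw\<in>{vw \<in> ?P \<times> ?Q. (\<lambda>(v, w). v @ w) vw = w}. ?t vw) = (\<Sum>vw\<in>?f ` {..length w}. ?t vw)"
      by (rule sum.mono_neutral_left[OF _ fibre]) auto
    also have "\<dots> = (\<Sum>i\<le>length w. scale (p (take i w) * q (drop i w)) (mon w))"
      by (simp add: sum.reindex[OF inj])
    finally show ?thesis by (simp add: convolve_def scale_sum_left)
  qed
  have "ev p * ev q = (\<Sum>v\<in>?P. \<Sum>w\<in>?Q. scale (p v * q w) (mon (v @ w)))"
    unfolding ev_def
    by (simp add: sum_product scale_mult_left scale_mult_right mon_append mult.commute)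
  also have "\<dots> = (\<Sum>vw\<in>?P \<times> ?Q. ?t vw)"
    by (simp add: sum.cartesian_product)
  also have "\<dots> = (\<Sum>w\<in>?W. \<Sum>vw\<in>{vw \<in> ?P \<times> ?Q. (\<lambda>(v, w). v @ w) vw = w}. ?t vw)"
    by (rule sum.group[OF fin subset_refl, symmetric])
  also have "\<dots> = (\<Sum>w\<in>?W. scale (convolve p q w) (mon w))"
    by (simp only: fibre)
  also have "\<dots> = ev (convolve p q)"
    by (rule ev_superset[OF fin(2) convolve_support, symmetric])
  finally show ?thesis by simp
qed

lemma ev_hom: "ring_hom_ring FA type_ring ev"
proof (rule ring_hom_ringI2[OF ring_FA ring_type_ring])
  show "ev \<in> ring_hom FA type_ring"
    by (rule ring_hom_memI) (simp_all add: ev_add ev_convolve ev_one)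
qed

lemma ev_gr: "(\<And>w. p w \<noteq> 0 \<Longrightarrow> length w = n) \<Longrightarrow> ev p \<in> gr n"
  unfolding ev_def using mon_gr by (intro subspace_sum[OF gr_subspace] subspace_scale[OF gr_subspace]) auto

text \<open>
  Homogeneous preimages are built along the decomposition \<open>gr (n + 1) = gr n u + gr n v\<close>.
\<close>

lemma ev_surj_gr: "a \<in> gr n \<Longrightarrow> \<exists>q. finite {w. q w \<noteq> 0} \<and> (\<forall>w. q w \<noteq> 0 \<longrightarrow> length w = n) \<and> ev q = a"
proof (induction n arbitrary: a)
  case 0
  then obtain c where a: "a = scale c 1" by (auto simp: gr_0)
  have fin: "finite {w :: letter list. (if w = [] then 1 else 0 :: 'k) \<noteq> 0}" by simp
  show ?case
    using ev_scale[OF fin, of c] ev_one a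
    by (intro exI[of _ "\<lambda>w. c * (if w = [] then 1 else 0)"]) (auto split: if_splits)
next
  case (Suc n)
  obtain a1 a2 where a: "a1 \<in> gr n" "a2 \<in> gr n" "a = a1 * u + a2 * v" using decompose[OF Suc.prems] by blast
  obtain q1 q2 where q1: "finite {w. q1 w \<noteq> 0}" "\<forall>w. q1 w \<noteq> 0 \<longrightarrow> length w = n" "ev q1 = a1"
    and q2: "finite {w. q2 w \<noteq> 0}" "\<forall>w. q2 w \<noteq> 0 \<longrightarrow> length w = n" "ev q2 = a2"
    using Suc.IH[OF a(1)] Suc.IH[OF a(2)] by blast
  let ?q = "\<lambda>w. convolve q1 (free_var L1) w + convolve q2 (free_var L2) w"
  have "ev ?q = a"
    by (simp add: ev_add ev_convolve convolve_finite q1 q2 var_finite ev_var a(3))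
  moreover have "length w = Suc n" if "?q w \<noteq> 0" for w
  proof -
    have "w \<noteq> []" "length (butlast w) = n"
      using that q1(2) q2(2) by (auto simp: convolve_var split: if_splits)
    then show ?thesis by (metis length_append_singleton append_butlast_last_id)
  qed
  moreover have "finite {w. ?q w \<noteq> 0}"
    by (intro support_add convolve_finite q1(1) q2(1) var_finite)
  ultimately show ?case by (intro exI[of _ ?q] conjI allI impI)
qed

lemma ev_surj: "\<exists>p. finite {w. p w \<noteq> 0} \<and> ev p = a"
proof (induction a rule: graded_induct)
  case (add x y)
  obtain p q where p: "finite {w. p w \<noteq> 0}" "ev p = x" and q: "finite {w. q w \<noteq> 0}" "ev q = y"
    using add by (elim exE conjE)
  then show ?case
    by (intro exI[of _ "\<lambda>w. p w + q w"] conjI support_add) (simp_all add: ev_add)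
next
  case (homogeneous n x)
  from ev_surj_gr[OF this] obtain q where "finite {w. q w \<noteq> 0}" "ev q = x" by (elim exE conjE)
  then show ?case by (intro exI[of _ q] conjI)
qed

text \<open>
  An element of the kernel of length \<open>n + 1\<close> is \<open>p\<^sub>1 u + p\<^sub>2 v\<close> where, by exactness, \<open>p\<^sub>1\<close> and \<open>p\<^sub>2\<close> are
  congruent to \<open>q u\<close> and \<open>- q v\<close> modulo elements of the kernel of length \<open>n\<close>.
\<close>

lemma kernel_homogeneous:
  assumes "finite {w. p w \<noteq> 0}" "\<And>w. p w \<noteq> 0 \<Longrightarrow> length w = n" "ev p = 0"
  shows "p \<in> relation_ideal"
  using assms
proof (induction n arbitrary: p)
  case 0
  have p: "p w = 0" if "w \<noteq> []" for w using "0.prems"(2)[of w] that by auto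
  have "ev p = (\<Sum>w\<in>{[]}. scale (p w) (mon w))" using p by (intro ev_superset) auto
  then have "p [] = 0" using "0.prems"(3) by (simp add: mon_def)
  then have "p w = 0" for w using p[of w] by (cases w) auto
  then have "p = \<zero>\<^bsub>FA\<^esub>" by (simp add: fun_eq_iff)
  then show ?case
    using additive_subgroup.zero_closed[OF ideal.axioms(1)[OF ideal_relation_ideal]] by simp
next
  case (Suc n)
  have ideal_mult: "convolve p q \<in> relation_ideal"
    if "p \<in> relation_ideal" "finite {w. q w \<noteq> 0}" for p q :: "letter list \<Rightarrow> 'k"
    using ideal.I_r_closed[OF ideal_relation_ideal that(1), of q] that(2) by simp
  have ideal_mult_left: "convolve q p \<in> relation_ideal"
    if "p \<in> relation_ideal" "finite {w. q w \<noteq> 0}" for p q :: "letter list \<Rightarrow> 'k"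
    using ideal.I_l_closed[OF ideal_relation_ideal that(1), of q] that(2) by simp
  have ideal_add: "(\<lambda>w. p w + q w) \<in> relation_ideal"
    if "p \<in> relation_ideal" "q \<in> relation_ideal" for p q :: "letter list \<Rightarrow> 'k"
    using additive_subgroup.a_closed[OF ideal.axioms(1)[OF ideal_relation_ideal] that] by simp
  define P where "P l w = p (w @ [l])" for l w
  have P_fin: "finite {w. P l w \<noteq> 0}" for l
  proof (rule finite_subset)
    show "{w. P l w \<noteq> 0} \<subseteq> butlast ` {w. p w \<noteq> 0}" by (force simp: P_def image_iff)
  qed (simp add: Suc.prems(1))
  have P_len: "length w = n" if "P l w \<noteq> 0" for l w using Suc.prems(2)[of "w @ [l]"] that by (simp add: P_def)
  have p_eq: "p = (\<lambda>w. convolve (P L1) (free_var L1) w + convolve (P L2) (free_var L2) w)"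
  proof
    fix w
    show "p w = convolve (P L1) (free_var L1) w + convolve (P L2) (free_var L2) w"
    proof (cases w rule: rev_cases)
      case Nil
      then show ?thesis using Suc.prems(2)[of "[]"] by (auto simp: convolve_var)
    next
      case (snoc w' l)
      then show ?thesis by (cases l) (simp_all add: convolve_var P_def)
    qed
  qed
  have "ev p = ev (P L1) * u + ev (P L2) * v"
    by (subst p_eq) (simp add: ev_add convolve_finite P_fin var_finite ev_convolve ev_var)
  then obtain a where a: "ev (P L1) = a * u" "ev (P L2) = - (a * v)"
    using exact[of "ev (P L1)" "ev (P L2)"] Suc.prems(3) by auto
  \<comment> \<open>the component of \<open>a\<close> of degree \<open>n - 1\<close>\<close>
  have "\<exists>q. finite {w. q w \<noteq> 0} \<and> (\<forall>w. q w \<noteq> 0 \<longrightarrow> Suc (length w) = n) \<and>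
      ev (P L1) = ev q * u \<and> ev (P L2) = - (ev q * v)"
  proof (cases n)
    case 0
    have z: "proj 0 (ev (P l)) = ev (P l)" for l
      using proj_gr[OF ev_gr[of "P l" n], of 0] P_len 0 by simp
    have "proj 0 (ev (P L1)) = 0" "proj 0 (ev (P L2)) = 0"
      unfolding a using proj_mult_right[OF u_gr, of 0 a] proj_mult_right[OF v_gr, of 0 a]
      by (simp_all add: proj_uminus)
    then have "ev (P L1) = 0" "ev (P L2) = 0" unfolding z .
    then show ?thesis by (intro exI[of _ "\<lambda>w. 0"]) (simp add: ev_zero)
  next
    case (Suc m)
    obtain q where q: "finite {w. q w \<noteq> 0}" "\<forall>w. q w \<noteq> 0 \<longrightarrow> length w = m" "ev q = proj m a"
      using ev_surj_gr[OF proj_in_gr[of m a]] by blast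
    have z: "proj (Suc m) (ev (P l)) = ev (P l)" for l
      using proj_gr[OF ev_gr[of "P l" n], of "Suc m"] P_len Suc by simp
    have "proj (Suc m) (ev (P L1)) = ev q * u" "proj (Suc m) (ev (P L2)) = - (ev q * v)"
      unfolding a using proj_mult_right[OF u_gr, of "Suc m" a] proj_mult_right[OF v_gr, of "Suc m" a]
      by (simp_all add: proj_uminus q(3))
    then have "ev (P L1) = ev q * u" "ev (P L2) = - (ev q * v)" unfolding z .
    then show ?thesis using q Suc by blast
  qed
  then obtain q where q: "finite {w. q w \<noteq> 0}" "\<And>w. q w \<noteq> 0 \<Longrightarrow> Suc (length w) = n"
    "ev (P L1) = ev q * u" "ev (P L2) = - (ev q * v)" by blast
  let ?p1 = "\<lambda>w. P L1 w - convolve q (free_var L1) w" and ?p2 = "\<lambda>w. P L2 w + convolve q (free_var L2) w"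
  have q_len: "length w = n" if "convolve q (free_var l) w \<noteq> 0" for l w
  proof (cases w rule: rev_cases)
    case Nil
    then show ?thesis using that by (simp add: convolve_var)
  next
    case (snoc w' l')
    then have "q w' \<noteq> 0" using that by (simp add: convolve_var split: if_splits)
    then show ?thesis using q(2)[of w'] snoc by simp
  qed
  have qv: "finite {w. convolve q (free_var l) w \<noteq> 0}" for l
    by (intro convolve_finite q(1) var_finite)
  have "ev (\<lambda>w. ?p1 w + convolve q (free_var L1) w) = ev ?p1 + ev (convolve q (free_var L1))"
    by (intro ev_add support_diff P_fin qv)
  then have "ev ?p1 = 0" by (simp add: ev_convolve q(1,3) var_finite ev_var)
  moreover have "length w = n" if "?p1 w \<noteq> 0" for w using that P_len[of L1 w] q_len[of L1 w] by (cases "P L1 w = 0") auto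
  ultimately have p1: "?p1 \<in> relation_ideal" by (intro Suc.IH support_diff P_fin qv)
  have "ev ?p2 = ev (P L2) + ev (convolve q (free_var L2))" by (intro ev_add P_fin qv)
  then have "ev ?p2 = 0" by (simp add: ev_convolve q(1,4) var_finite ev_var)
  moreover have "length w = n" if "?p2 w \<noteq> 0" for w using that P_len[of L2 w] q_len[of L2 w] by (cases "P L2 w = 0") auto
  ultimately have p2: "?p2 \<in> relation_ideal" by (intro Suc.IH support_add P_fin qv)
  have "p = (\<lambda>w. (convolve ?p1 (free_var L1) w + convolve ?p2 (free_var L2) w) + convolve q relator w)"
  proof
    fix w
    have split: "convolve (\<lambda>w. f w - g w) h w = convolve f h w - convolve g h w"
      "convolve (\<lambda>w. f w + g w) h w = convolve f h w + convolve g h w" for f g h :: "letter list \<Rightarrow> 'k"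
      by (simp_all add: convolve_def algebra_simps sum_subtractf sum.distrib)
    have "convolve q relator w = convolve q (convolve (free_var L1) (free_var L1)) w -
        convolve q (convolve (free_var L2) (free_var L2)) w"
      unfolding relator_def
      by (simp add: convolve_def[of q] algebra_simps sum_subtractf)
    then show "p w = (convolve ?p1 (free_var L1) w + convolve ?p2 (free_var L2) w) + convolve q relator w"
      by (subst p_eq) (simp add: split convolve_assoc)
  qed
  also have "\<dots> \<in> relation_ideal"
    by (intro ideal_add ideal_mult[OF p1 var_finite] ideal_mult[OF p2 var_finite]
        ideal_mult_left[OF relator_in_relation_ideal q(1)])
  finally show ?case .
qed

text \<open>
  The homogeneous components of an element of the kernel lie in the kernel, since \<open>A\<close> is graded.
\<close>

lemma kernel_subset:
  assumes "finite {w. p w \<noteq> 0}" "ev p = 0"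
  shows "p \<in> relation_ideal"
proof -
  have "p \<in> relation_ideal" if "\<And>w. p w \<noteq> 0 \<Longrightarrow> length w < N" for N
    using that assms
  proof (induction N arbitrary: p)
    case 0
    then have "p = \<zero>\<^bsub>FA\<^esub>" by (auto simp: fun_eq_iff)
    then show ?case
      using additive_subgroup.zero_closed[OF ideal.axioms(1)[OF ideal_relation_ideal]] by simp
  next
    case (Suc N)
    let ?top = "\<lambda>w. if length w = N then p w else 0" and ?rest = "\<lambda>w. if length w = N then 0 else p w"
    have fin: "finite {w. ?top w \<noteq> 0}" "finite {w. ?rest w \<noteq> 0}"
      by (rule finite_subset[OF _ Suc.prems(2)], auto)+
    have p: "p = (\<lambda>w. ?top w + ?rest w)" by auto
    have sum0: "ev ?top + ev ?rest = 0" using ev_add[OF fin] Suc.prems(3) by (simp only: p[symmetric])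
    have len: "length w < N" if "?rest w \<noteq> 0" for w
      using Suc.prems(1)[of w] that by (auto split: if_splits)
    have "proj N (ev ?rest) = (\<Sum>w | ?rest w \<noteq> 0. proj N (scale (?rest w) (mon w)))"
      unfolding ev_def by (rule proj_sum)
    also have "\<dots> = 0"
    proof (rule sum.neutral, rule ballI)
      fix w assume "w \<in> {w. ?rest w \<noteq> 0}"
      then have "length w \<noteq> N" using len by fastforce
      then show "proj N (scale (?rest w) (mon w)) = 0"
        using proj_gr[OF subspace_scale[OF gr_subspace mon_gr], of N] by simp
    qed
    finally have "proj N (ev ?rest) = 0" .
    moreover have "ev ?top \<in> gr N" by (rule ev_gr) (auto split: if_splits)
    ultimately have top0: "ev ?top = 0"
      using proj_add[of N "ev ?top" "ev ?rest"] proj_gr[of "ev ?top" N N] sum0 by simp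
    then have "ev ?rest = 0" using sum0 by simp
    then have "?rest \<in> relation_ideal" using Suc.IH[of ?rest] len fin(2) by blast
    moreover have "?top \<in> relation_ideal"
      by (rule kernel_homogeneous[OF fin(1) _ top0, where n = N]) (simp split: if_splits)
    ultimately have "(\<lambda>w. ?top w + ?rest w) \<in> relation_ideal"
      using additive_subgroup.a_closed[OF ideal.axioms(1)[OF ideal_relation_ideal]] by simp
    then show ?case by (simp only: p[symmetric])
  qed
  moreover obtain N where "\<And>w. p w \<noteq> 0 \<Longrightarrow> length w < N"
  proof -
    have "length w < Suc (Max (length ` {w. p w \<noteq> 0}))" if "p w \<noteq> 0" for w
      using assms(1) that by (intro le_imp_less_Suc Max_ge) auto
    then show thesis by (rule that)
  qed
  ultimately show ?thesis by blast
qed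

lemma relation_ideal_eq_kernel: "relation_ideal = a_kernel FA type_ring ev"
proof
  have "relator \<in> a_kernel FA type_ring ev"
  proof -
    have "ev (\<lambda>w. relator w + convolve (free_var L2) (free_var L2) w) =
        ev relator + ev (convolve (free_var L2) (free_var L2))"
      by (intro ev_add relator_finite convolve_finite var_finite)
    moreover have "(\<lambda>w. relator w + convolve (free_var L2) (free_var L2) w) =
        (convolve (free_var L1) (free_var L1) :: letter list \<Rightarrow> 'k)" by (simp add: relator_def)
    ultimately have "ev (convolve (free_var L1) (free_var L1)) =
        ev relator + ev (convolve (free_var L2) (free_var L2))" by simp
    then have "ev relator = 0" by (simp add: ev_convolve var_finite ev_var square_eq)
    then show ?thesis by (simp add: a_kernel_def' relator_finite)
  qed
  then show "relation_ideal \<subseteq> a_kernel FA type_ring ev"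
    unfolding relation_ideal_eq
    by (intro ring.genideal_minimal[OF ring_FA] ring_hom_ring.kernel_is_ideal[OF ev_hom]) simp
  show "a_kernel FA type_ring ev \<subseteq> relation_ideal"
    using kernel_subset by (auto simp: a_kernel_def')
qed

lemma uv_algebra_iso:
  obtains \<phi> where "\<phi> \<in> algebra_iso uv_algebra scale" "\<phi> u_class = u" "\<phi> v_class = v"
proof -
  let ?I = "relation_ideal :: (letter list \<Rightarrow> 'k) set"
  let ?h = "\<lambda>C. the_elem (ev ` C)"
  have coset_ev: "ev ` (?I +>\<^bsub>FA\<^esub> p) = {ev p}" if p: "finite {w. p w \<noteq> 0}" for p
  proof -
    have I: "finite {w. i w \<noteq> 0} \<and> ev i = 0" if "i \<in> ?I" for i
      using that unfolding relation_ideal_eq_kernel by (simp add: a_kernel_def')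
    have "ev ` (?I +>\<^bsub>FA\<^esub> p) = (\<lambda>i. ev (\<lambda>w. i w + p w)) ` ?I"
      by (auto simp: a_r_coset_def')
    also have "\<dots> = (\<lambda>i. ev p) ` ?I"
      using I p by (intro image_cong HOL.refl) (simp add: ev_add)
    also have "\<dots> = {ev p}" using relator_in_relation_ideal by auto
    finally show ?thesis .
  qed
  have \<phi>: "?h (?I +>\<^bsub>FA\<^esub> p) = ev p" if "finite {w. p w \<noteq> 0}" for p
    using coset_ev[OF that] by simp
  have "ev ` carrier FA = carrier type_ring"
    using ev_surj by (auto simp: image_iff) (metis)
  from ring_hom_ring.FactRing_iso_set[OF ev_hom this]
  have "?h \<in> ring_iso (FA Quot ?I) type_ring" unfolding relation_ideal_eq_kernel .
  then have "?h \<in> ring_iso uv_algebra type_ring"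
    by (simp add: ring_iso_def ring_hom_def uv_algebra_def quotient_module_def FactRing_def)
  moreover have "?h (c \<odot>\<^bsub>uv_algebra\<^esub> C) = scale c (?h C)" if C: "C \<in> carrier uv_algebra" for c C
  proof -
    obtain p where p: "finite {w. p w \<noteq> 0}" "C = ?I +>\<^bsub>FA\<^esub> p"
      using C by (auto simp: uv_algebra_def quotient_module_def A_RCOSETS_def')
    have fin: "finite {w. x w \<noteq> 0}" if x: "x \<in> C" for x
    proof -
      obtain i where i: "i \<in> ?I" "x = (\<lambda>w. i w + p w)" using x p(2) by (auto simp: a_r_coset_def')
      have "finite {w. i w \<noteq> 0}" using ideal.Icarr[OF ideal_relation_ideal i(1)] by simp
      then show ?thesis unfolding i(2) using p(1) by (rule support_add)
    qed
    have finc: "finite {w. c * x w \<noteq> 0}" if "x \<in> C" for x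
      by (rule finite_subset[OF _ fin[OF that]]) auto
    have "ev ` (c \<odot>\<^bsub>uv_algebra\<^esub> C) = (\<Union>x\<in>C. ev ` (?I +>\<^bsub>FA\<^esub> (\<lambda>w. c * x w)))"
      by (auto simp: uv_algebra_def quotient_module_def)
    also have "\<dots> = (\<Union>x\<in>C. {scale c (ev x)})"
      using fin finc by (intro SUP_cong HOL.refl) (simp add: coset_ev ev_scale)
    also have "\<dots> = scale c ` (ev ` C)" by auto
    also have "\<dots> = {scale c (ev p)}" unfolding p(2) coset_ev[OF p(1)] by simp
    finally show ?thesis by (simp add: p(2) coset_ev[OF p(1)])
  qed
  ultimately have "?h \<in> algebra_iso uv_algebra scale" by (simp add: algebra_iso_def)
  moreover have "?h u_class = u" "?h v_class = v"
    by (simp_all add: u_class_def v_class_def \<phi> var_finite ev_var)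
  ultimately show thesis by (rule that)
qed

end

section \<open>Generators, presentations and Hopf ideals for a group\<close>

lemma (in Group.group) commutant_subgroup:
  assumes "S \<subseteq> carrier G"
  shows "subgroup {g \<in> carrier G. \<forall>s\<in>S. g \<otimes> s = s \<otimes> g} G"
proof (rule subgroupI)
  show "{g \<in> carrier G. \<forall>s\<in>S. g \<otimes> s = s \<otimes> g} \<noteq> {}"
    using assms by (auto intro!: exI[of _ \<one>])
  fix g assume g: "g \<in> {g \<in> carrier G. \<forall>s\<in>S. g \<otimes> s = s \<otimes> g}"
  have "inv g \<otimes> s = s \<otimes> inv g" if s: "s \<in> S" for s
  proof -
    have sG: "s \<in> carrier G" and gG: "g \<in> carrier G" and eq: "g \<otimes> s = s \<otimes> g" using s g assms by auto
    have "inv g \<otimes> s = inv g \<otimes> (s \<otimes> g) \<otimes> inv g"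
      using sG gG by (simp add: m_assoc)
    also have "\<dots> = inv g \<otimes> (g \<otimes> s) \<otimes> inv g" by (simp only: eq)
    also have "\<dots> = s \<otimes> inv g" using sG gG by (simp add: m_assoc[symmetric])
    finally show ?thesis .
  qed
  then show "inv g \<in> {g \<in> carrier G. \<forall>s\<in>S. g \<otimes> s = s \<otimes> g}" using g by simp
  fix h assume h: "h \<in> {g \<in> carrier G. \<forall>s\<in>S. g \<otimes> s = s \<otimes> g}"
  have "g \<otimes> h \<otimes> s = s \<otimes> (g \<otimes> h)" if s: "s \<in> S" for s
  proof -
    have c: "s \<in> carrier G" "g \<in> carrier G" "h \<in> carrier G" and eq: "g \<otimes> s = s \<otimes> g" "h \<otimes> s = s \<otimes> h"
      using s g h assms by auto
    have "g \<otimes> h \<otimes> s = g \<otimes> (s \<otimes> h)" using c by (simp add: m_assoc eq(2))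
    also have "\<dots> = s \<otimes> g \<otimes> h" using c by (simp add: m_assoc[symmetric] eq(1))
    finally show ?thesis using c by (simp add: m_assoc)
  qed
  then show "g \<otimes> h \<in> {g \<in> carrier G. \<forall>s\<in>S. g \<otimes> s = s \<otimes> g}" using g h by simp
qed auto

text \<open>
  The commutant of the generators is a subgroup containing them, hence everything; so each element
  commutes with the generators, whose commutant argument applies once more.
\<close>

lemma (in Group.group) generators_commute_imp_comm_group:
  assumes gen: "generate G S = carrier G" and S: "S \<subseteq> carrier G"
    and comm: "\<And>s t. s \<in> S \<Longrightarrow> t \<in> S \<Longrightarrow> s \<otimes> t = t \<otimes> s"
  shows "comm_group G"
proof (rule group_comm_groupI)
  have 1: "g \<otimes> s = s \<otimes> g" if "g \<in> carrier G" "s \<in> S" for g s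
  proof -
    have "generate G S \<subseteq> {g \<in> carrier G. \<forall>s\<in>S. g \<otimes> s = s \<otimes> g}"
      using S comm by (intro generate_subgroup_incl commutant_subgroup) auto
    then show ?thesis using that gen by blast
  qed
  fix x y assume x: "x \<in> carrier G" and y: "y \<in> carrier G"
  have "generate G S \<subseteq> {g \<in> carrier G. \<forall>s\<in>{x}. g \<otimes> s = s \<otimes> g}"
    using S x by (intro generate_subgroup_incl commutant_subgroup) (auto simp: 1)
  then show "x \<otimes> y = y \<otimes> x" using gen y by force
qed

context Group.group
begin

text \<open>
  For a subgroup \<open>H\<close> this is the kernel of the restriction of functions from \<open>G\<close> to \<open>H\<close>, which is a
  homomorphism of Hopf algebras.
\<close>

definition vanishing :: "'a set \<Rightarrow> ('a \<Rightarrow> 'k::field) set" where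
  "vanishing H = {f. (\<forall>x. x \<notin> carrier G \<longrightarrow> f x = 0) \<and> (\<forall>h\<in>H. f h = 0)}"

lemma ring_dual_group_algebra: "ring (dual_group_algebra G :: ('k::field, 'a \<Rightarrow> 'k) module)"
proof (rule ringI)
  show "abelian_group (dual_group_algebra G :: ('k, 'a \<Rightarrow> 'k) module)"
  proof (rule abelian_groupI)
    show "\<exists>y\<in>carrier (dual_group_algebra G). y \<oplus>\<^bsub>dual_group_algebra G\<^esub> x = \<zero>\<^bsub>dual_group_algebra G\<^esub>"
      if "x \<in> carrier (dual_group_algebra G)" for x :: "'a \<Rightarrow> 'k"
      using that by (intro bexI[of _ "\<lambda>g. - x g"]) (auto simp: dual_group_algebra_def)
  qed (auto simp: dual_group_algebra_def algebra_simps)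
  show "Group.monoid (dual_group_algebra G :: ('k, 'a \<Rightarrow> 'k) module)"
    by (rule Group.monoid.intro) (auto simp: dual_group_algebra_def mult.assoc fun_eq_iff)
qed (auto simp: dual_group_algebra_def algebra_simps)

text \<open>
  For \<open>f\<close> vanishing on a subgroup \<open>H\<close> write \<open>\<Delta> f = \<Sum>\<^sub>x \<phi>\<^sub>x \<otimes> f(x -)\<close>; if \<open>x\<close> lies in \<open>H\<close> then
  \<open>f(x -)\<close> vanishes on \<open>H\<close>, and otherwise \<open>\<phi>\<^sub>x\<close> does.
\<close>

lemma hopf_ideal_vanishing:
  assumes fin: "finite (carrier G)" and H: "subgroup H G"
  shows "hopf_ideal G (vanishing H :: ('a \<Rightarrow> 'k::field) set)"
  unfolding hopf_ideal_def
proof (intro conjI allI ballI subsetI)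
  interpret R: ring "dual_group_algebra G :: ('k, 'a \<Rightarrow> 'k) module" by (rule ring_dual_group_algebra)
  interpret H: subgroup H G by (rule H)
  show "ideal (vanishing H :: ('a \<Rightarrow> 'k) set) (dual_group_algebra G)"
  proof (rule idealI[OF ring_dual_group_algebra])
    show "subgroup (vanishing H :: ('a \<Rightarrow> 'k) set) (add_monoid (dual_group_algebra G))"
    proof (rule R.add.subgroupI)
      show "(vanishing H :: ('a \<Rightarrow> 'k) set) \<noteq> {}"
        by (auto simp: vanishing_def intro!: exI[of _ "\<lambda>_. 0"])
      fix f :: "'a \<Rightarrow> 'k" assume f: "f \<in> vanishing H"
      have "\<ominus>\<^bsub>dual_group_algebra G\<^esub> f = (\<lambda>x. - f x)"
        by (rule R.minus_equality) (use f in \<open>auto simp: vanishing_def dual_group_algebra_def\<close>)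
      then show "\<ominus>\<^bsub>dual_group_algebra G\<^esub> f \<in> vanishing H" using f by (simp add: vanishing_def)
    qed (auto simp: vanishing_def dual_group_algebra_def)
  qed (auto simp: vanishing_def dual_group_algebra_def)
next
  fix c and f :: "'a \<Rightarrow> 'k" assume f: "f \<in> vanishing H"
  show "c \<odot>\<^bsub>dual_group_algebra G\<^esub> f \<in> vanishing H"
    using f by (simp add: vanishing_def dual_group_algebra_def)
next
  fix f :: "'a \<Rightarrow> 'k" assume f: "f \<in> vanishing H"
  show "dga_counit G f = 0" using f subgroup.one_closed[OF H] by (simp add: vanishing_def dga_counit_def)
next
  fix g :: "'a \<Rightarrow> 'k" assume "g \<in> dga_antipode G ` vanishing H"
  then show "g \<in> vanishing H"
    using subgroup.m_inv_closed[OF H] subgroup.mem_carrier[OF H]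
    by (auto simp: vanishing_def dga_antipode_def)
next
  fix F :: "'a \<times> 'a \<Rightarrow> 'k" assume "F \<in> dga_comult G ` vanishing H"
  then obtain f where f: "f \<in> vanishing H" and F: "F = dga_comult G f" by auto
  obtain e where e: "bij_betw e {..<card (carrier G)} (carrier G)"
    using ex_bij_betw_nat_finite[OF fin] by (auto simp: atLeast0LessThan)
  let ?n = "card (carrier G)"
  let ?\<phi> = "\<lambda>i x. if x = e i then 1 else 0 :: 'k"
  let ?h = "\<lambda>i y. if y \<in> carrier G then f (e i \<otimes> y) else 0"
  have eG: "e i \<in> carrier G" if "i < ?n" for i using e that by (auto simp: bij_betw_def)
  have "dga_comult G f (x, y) = (\<Sum>i<?n. ?\<phi> i x * ?h i y)" for x y
  proof -
    have "(\<Sum>i<?n. ?\<phi> i x * ?h i y) =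
        (\<Sum>g\<in>carrier G. (if x = g then 1 else 0) * (if y \<in> carrier G then f (g \<otimes> y) else 0))"
      by (rule sum.reindex_bij_betw[OF e])
    also have "\<dots> = (\<Sum>g\<in>carrier G. if g = x then (if y \<in> carrier G then f (x \<otimes> y) else 0) else 0)"
      by (rule sum.cong) auto
    also have "\<dots> = dga_comult G f (x, y)" using fin by (auto simp: dga_comult_def)
    finally show ?thesis by simp
  qed
  then have eq: "F = (\<lambda>(x, y). \<Sum>i<?n. ?\<phi> i x * ?h i y)" unfolding F by auto
  have "?\<phi> i \<in> vanishing H \<and> ?h i \<in> carrier (dual_group_algebra G) \<or>
      ?\<phi> i \<in> carrier (dual_group_algebra G) \<and> ?h i \<in> vanishing H" if "i < ?n" for i
  proof (cases "e i \<in> H")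
    case True
    then have "?h i \<in> vanishing H"
      using f subgroup.m_closed[OF H True] by (simp add: vanishing_def)
    then show ?thesis using eG[OF that] by (auto simp: dual_group_algebra_def)
  next
    case False
    then have "?\<phi> i \<in> vanishing H" using eG[OF that] by (auto simp: vanishing_def)
    then show ?thesis by (simp add: dual_group_algebra_def)
  qed
  then show "F \<in> dga_tensor_ideal G (vanishing H)"
    unfolding dga_tensor_ideal_def eq
    by (intro CollectI exI[of _ ?n] exI[of _ ?\<phi>] exI[of _ ?h] conjI HOL.refl) simp
qed

text \<open>
  The Hopf ideal of a subgroup that contains the support of the grading annihilates \<open>A\<close>.
\<close>

lemma inner_faithful_support:
  fixes scale :: "'k::field \<Rightarrow> 'r::ring_1 \<Rightarrow> 'r"
  assumes fin: "finite (carrier G)" and H: "subgroup H G"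
    and faithful: "inner_faithful scale G D" and scale0: "\<And>x. scale 0 x = 0" "\<And>c. scale c 0 = 0"
    and supp: "\<And>g x. g \<in> carrier G - H \<Longrightarrow> component (carrier G) D g x = 0"
  shows "carrier G \<subseteq> H"
proof (rule ccontr)
  assume "\<not> carrier G \<subseteq> H"
  then obtain g where g: "g \<in> carrier G" "g \<notin> H" by blast
  let ?I = "vanishing H :: ('a \<Rightarrow> 'k) set"
  have "(\<lambda>x. if x = g then 1 else 0) \<in> ?I" using g by (auto simp: vanishing_def)
  moreover have "(\<lambda>x. if x = g then 1 else 0) \<noteq> (\<lambda>x. 0 :: 'k)" by (metis zero_neq_one)
  ultimately have "?I \<noteq> {\<zero>\<^bsub>dual_group_algebra G\<^esub>}" by (auto simp: dual_group_algebra_def)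
  then obtain f x where f: "f \<in> ?I" "dga_action scale G D f x \<noteq> 0"
    using faithful hopf_ideal_vanishing[OF fin H] unfolding inner_faithful_def by blast
  have "dga_action scale G D f x = 0"
    unfolding dga_action_def
  proof (rule sum.neutral, rule ballI)
    fix y assume "y \<in> carrier G"
    then show "scale (f y) (component (carrier G) D y x) = 0"
      using f(1) supp[of y x] by (cases "y \<in> H") (auto simp: vanishing_def scale0)
  qed
  then show False using f(2) by contradiction
qed

end

context Group.group
begin

text \<open>
  The presentation takes all relations that hold in \<open>G\<close>, so two words are equivalent if and only if
  they have the same value.
\<close>

definition letter_value :: "('x \<Rightarrow> 'a) \<Rightarrow> 'x \<times> bool \<Rightarrow> 'a" where
  "letter_value gens l = (if snd l then gens (fst l) else inv (gens (fst l)))"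

definition word_value :: "('x \<Rightarrow> 'a) \<Rightarrow> 'x word \<Rightarrow> 'a" where
  "word_value gens w = foldr (\<lambda>l g. letter_value gens l \<otimes> g) w \<one>"

context
  fixes gens :: "'x \<Rightarrow> 'a" and \<R> :: "('x word \<times> 'x word) set"
  assumes gens: "range gens \<subseteq> carrier G"
  defines "\<R> \<equiv> {(r, s). word_value gens r = word_value gens s}"
begin

lemma letter_value_closed: "letter_value gens l \<in> carrier G"
  using gens by (auto simp: letter_value_def)

lemma word_value_closed: "word_value gens w \<in> carrier G"
  by (induction w) (simp_all add: word_value_def letter_value_closed)

lemma word_value_append: "word_value gens (v @ w) = word_value gens v \<otimes> word_value gens w"
proof (induction v)
  case Nil
  show ?case using word_value_closed[of w] by (simp add: word_value_def)
next
  case (Cons l v)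
  then show ?case
    using letter_value_closed[of l] word_value_closed[of v] word_value_closed[of w]
    by (simp add: word_value_def m_assoc)
qed

lemma word_value_cancel: "word_value gens [(x, e), (x, \<not> e)] = \<one>"
  using gens by (cases e) (auto simp: word_value_def letter_value_def image_subset_iff)

lemma word_equiv_iff: "word_equiv \<R> v w \<longleftrightarrow> word_value gens v = word_value gens w"
proof
  assume "word_equiv \<R> v w"
  then show "word_value gens v = word_value gens w"
  proof (induction rule: word_equiv.induct)
    case (cancel p x e q)
    have "word_value gens (p @ [(x, e), (x, \<not> e)] @ q) =
        word_value gens p \<otimes> (word_value gens [(x, e), (x, \<not> e)] \<otimes> word_value gens q)"
      by (simp only: word_value_append)
    then show ?case
      using word_value_closed[of q] by (simp add: word_value_cancel word_value_append)
  next
    case (relation r s p q)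
    then show ?case by (simp add: \<R>_def word_value_append)
  qed simp_all
next
  assume "word_value gens v = word_value gens w"
  then show "word_equiv \<R> v w" using word_equiv.relation[of v w \<R> "[]" "[]"] by (simp add: \<R>_def)
qed

lemma word_class_eq: "word_class \<R> w = {v. word_value gens w = word_value gens v}"
  by (simp add: word_class_def word_equiv_iff)

lemma has_presentation_all_relations:
  assumes gen: "generate G (range gens) = carrier G"
  shows "has_presentation G gens \<R>"
proof -
  let ?\<psi> = "\<lambda>C. the_elem (word_value gens ` C)"
  have \<psi>: "?\<psi> (word_class \<R> w) = word_value gens w" for w
  proof -
    have "word_value gens ` word_class \<R> w = {word_value gens w}" by (auto simp: word_class_eq)
    then show ?thesis by simp
  qed
  have mult: "word_class \<R> v \<otimes>\<^bsub>presented_group \<R>\<^esub> word_class \<R> w = word_class \<R> (v @ w)" for v w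
    by (auto simp: presented_group_def word_class_eq word_value_append)
  have carrier: "carrier (presented_group \<R>) = range (word_class \<R>)" by (simp add: presented_group_def)
  have "g \<in> range (word_value gens)" if "g \<in> generate G (range gens)" for g
    using that
  proof (induction rule: generate.induct)
    case one
    show ?case by (rule range_eqI[of _ _ "[]"]) (simp add: word_value_def)
  next
    case (incl g)
    then obtain x where "g = gens x" by auto
    then show ?case using gens
      by (intro range_eqI[of _ _ "[(x, True)]"]) (auto simp: word_value_def letter_value_def image_subset_iff)
  next
    case (inv g)
    then obtain x where "g = gens x" by auto
    then show ?case using gens
      by (intro range_eqI[of _ _ "[(x, False)]"]) (auto simp: word_value_def letter_value_def image_subset_iff)
  next
    case (eng g h)
    then obtain v w where "g = word_value gens v" "h = word_value gens w" by blast
    then show ?case by (intro range_eqI[of _ _ "v @ w"]) (simp add: word_value_append)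
  qed
  then have surj: "range (word_value gens) = carrier G" using gen word_value_closed by blast
  have "?\<psi> \<in> hom (presented_group \<R>) G"
  proof (rule homI)
    fix C C' assume "C \<in> carrier (presented_group \<R>)" "C' \<in> carrier (presented_group \<R>)"
    then obtain v w where "C = word_class \<R> v" "C' = word_class \<R> w" by (auto simp: carrier)
    then show "?\<psi> (C \<otimes>\<^bsub>presented_group \<R>\<^esub> C') = ?\<psi> C \<otimes> ?\<psi> C'"
      by (simp only: mult \<psi> word_value_append)
  next
    fix C assume "C \<in> carrier (presented_group \<R>)"
    then obtain v where "C = word_class \<R> v" by (auto simp: carrier)
    then show "?\<psi> C \<in> carrier G" by (simp only: \<psi> word_value_closed)
  qed
  moreover have "bij_betw ?\<psi> (carrier (presented_group \<R>)) (carrier G)"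
    unfolding bij_betw_def
  proof
    show "inj_on ?\<psi> (carrier (presented_group \<R>))"
    proof (rule inj_onI)
      fix C C' assume "C \<in> carrier (presented_group \<R>)" "C' \<in> carrier (presented_group \<R>)" "?\<psi> C = ?\<psi> C'"
      moreover from this obtain v w where "C = word_class \<R> v" "C' = word_class \<R> w" by (auto simp: carrier)
      ultimately show "C = C'" by (simp only: \<psi>) (simp add: word_class_eq)
    qed
    show "?\<psi> ` carrier (presented_group \<R>) = carrier G"
      unfolding carrier image_image \<psi> by (rule surj)
  qed
  moreover have "?\<psi> (word_class \<R> [(x, True)]) = gens x" for x
    unfolding \<psi> using gens by (auto simp: word_value_def letter_value_def image_subset_iff)
  ultimately show ?thesis
    unfolding has_presentation_def iso_def by (intro bexI[of _ ?\<psi>]) simp_all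
qed

end

end

section \<open>Group gradings of graded algebras\<close>

locale group_graded_algebra =
  connected_graded_algebra scale gr + Group.group G
  for scale :: "'k::field \<Rightarrow> 'a::ring_1 \<Rightarrow> 'a" and gr and G :: "('g, 'c) monoid_scheme" (structure) +
  fixes D :: "'g \<Rightarrow> 'a set"
  assumes group_grading: "group_grading scale G D"
    and compatible: "compatible_gradings scale gr G D"

sublocale group_graded_algebra \<subseteq> D: direct_sum scale "carrier G" D
  using group_grading by unfold_locales (simp add: group_grading_def)

context group_graded_algebra
begin

lemma D_mult: "\<lbrakk>g \<in> carrier G; h \<in> carrier G; x \<in> D g; y \<in> D h\<rbrakk> \<Longrightarrow> x * y \<in> D (g \<otimes> h)"
  using group_grading by (simp add: group_grading_def)

lemma homogeneous_decomposition:
  assumes "x \<in> gr n"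
  obtains f where "\<And>g. f g \<noteq> 0 \<Longrightarrow> g \<in> carrier G \<and> f g \<in> gr n \<inter> D g"
    "x = (\<Sum>g | f g \<noteq> 0. f g)"
proof -
  have "\<exists>!f. decomposes_as (carrier G) (\<lambda>g. gr n \<inter> D g) x f"
    using compatible assms by (simp add: compatible_gradings_def is_direct_sum_def)
  then obtain f where f: "decomposes_as (carrier G) (\<lambda>g. gr n \<inter> D g) x f" by (elim ex1E)
  show thesis
  proof (rule that[of f])
    show "g \<in> carrier G \<and> f g \<in> gr n \<inter> D g" if "f g \<noteq> 0" for g
      using f that unfolding decomposes_as_def by blast
  qed (use f in \<open>simp_all add: decomposes_as_def\<close>)
qed

text \<open>
  By compatibility the homogeneous elements of \<open>gr 1\<close> span it, and a spanning set contains a basis.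
\<close>

lemma homogeneous_basis:
  obtains B where "B \<subseteq> gr 1" "\<And>b. b \<in> B \<Longrightarrow> \<exists>g\<in>carrier G. b \<in> D g" "independent B" "span B = gr 1"
proof -
  let ?S = "\<Union>g\<in>carrier G. gr 1 \<inter> D g"
  obtain B where B: "B \<subseteq> ?S" "independent B" "?S \<subseteq> span B" by (rule basis_exists)
  have "B \<subseteq> gr 1" using B(1) by blast
  moreover have "gr 1 \<subseteq> span B"
  proof
    fix x assume "x \<in> gr 1"
    from homogeneous_decomposition[OF this]
    obtain f where f: "\<And>g. f g \<noteq> 0 \<Longrightarrow> g \<in> carrier G \<and> f g \<in> gr 1 \<inter> D g"
      and x: "x = (\<Sum>g | f g \<noteq> 0. f g)"
      by metis
    have "f g \<in> span B" if "f g \<noteq> 0" for g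
      by (rule subsetD[OF B(3)]) (use f[OF that] in blast)
    then show "x \<in> span B" unfolding x by (intro span_sum) simp
  qed
  ultimately have "span B = gr 1" using span_minimal[OF _ gr_subspace[of 1], of B] by blast
  moreover have "\<exists>g\<in>carrier G. b \<in> D g" if "b \<in> B" for b using B(1) that by blast
  ultimately show thesis using \<open>B \<subseteq> gr 1\<close> B(2) by (intro that[of B])
qed

text \<open>
  Since \<open>gr 0\<close> is spanned by \<open>1\<close>, compatibility makes \<open>1\<close> homogeneous; its degree is idempotent.
\<close>

lemma one_degree: "1 \<in> D \<one>"
proof -
  obtain f where f: "\<And>g. f g \<noteq> 0 \<Longrightarrow> g \<in> carrier G \<and> f g \<in> gr 0 \<inter> D g"
    and x: "1 = (\<Sum>g | f g \<noteq> 0. f g)"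
    by (rule homogeneous_decomposition[OF one_gr]) (rule that)
  have "\<exists>g. f g \<noteq> 0"
  proof (rule ccontr)
    assume "\<not> ?thesis"
    then have "1 = (0 :: 'a)" unfolding x by (intro sum.neutral) simp
    then show False by simp
  qed
  then obtain g where g: "f g \<noteq> 0" "g \<in> carrier G" "f g \<in> gr 0" "f g \<in> D g" using f by blast
  then obtain c where c: "f g = scale c 1" by (auto simp: gr_0)
  have "scale (inverse c) (f g) \<in> D g" by (rule subspace_scale[OF D.subspace_D[OF g(2)] g(4)])
  moreover have "c \<noteq> 0" using g(1) c by auto
  ultimately have 1: "1 \<in> D g" by (simp add: c)
  then have "1 \<in> D (g \<otimes> g)" using D_mult[OF g(2) g(2) 1 1] by simp
  then have "D.part g 1 = (if g = g \<otimes> g then 1 else 0)" using g(2) by (intro D.part_homogeneous) simp_all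
  then have "g = g \<otimes> g" using D.part_homogeneous[OF g(2) 1, of g] by (auto split: if_splits)
  then have "g = \<one>" using g(2) by (metis r_cancel_one')
  then show ?thesis using 1 by simp
qed

text \<open>
  The elements supported on \<open>H\<close> form a subalgebra, which contains the generators.
\<close>

lemma support_in_subgroup:
  assumes B: "generated_algebra scale gr B" and H: "subgroup H G"
    and deg: "\<And>b. b \<in> B \<Longrightarrow> \<exists>h\<in>H. b \<in> D h" and g: "g \<in> carrier G - H"
  shows "D.part g x = 0"
proof -
  interpret generated_algebra scale gr B by (rule B)
  interpret H: subgroup H G by (rule H)
  let ?S = "{x. \<forall>g\<in>carrier G - H. D.part g x = 0}"
  have sub: "subspace ?S"
    by (rule subspaceI) (auto simp: D.part_add D.part_scale D.part_zero)
  have homog: "x \<in> ?S" if "h \<in> H" "x \<in> D h" for h x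
  proof -
    have "h \<in> carrier G" using that(1) by (rule H.mem_carrier)
    from D.part_homogeneous[OF this that(2)] show ?thesis using that(1) by auto
  qed
  have "x \<in> ?S"
  proof (rule subalgebra_eq_UNIV[OF sub])
    show "1 \<in> ?S" by (rule homog[OF H.one_closed one_degree])
    have "B \<subseteq> ?S" using deg homog by blast
    then show "gr 1 \<subseteq> ?S" unfolding span_B[symmetric] by (rule span_minimal[OF _ sub])
    fix x y assume x: "x \<in> ?S" and y: "y \<in> ?S"
    let ?I = "\<lambda>x. {g. D.part g x \<noteq> 0}"
    have IH: "g \<in> H" if "z \<in> ?S" "g \<in> ?I z" for g z
      using that D.part_outside[of g z] by auto
    have "x * y = (\<Sum>g\<in>?I x. D.part g x) * (\<Sum>h\<in>?I y. D.part h y)"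
      by (simp add: D.sum_part D.finite_part)
    also have "\<dots> = (\<Sum>g\<in>?I x. \<Sum>h\<in>?I y. D.part g x * D.part h y)" by (rule sum_product)
    also have "\<dots> \<in> ?S"
    proof (intro subspace_sum[OF sub])
      fix g h assume "g \<in> ?I x" "h \<in> ?I y"
      then have gh: "g \<in> H" "h \<in> H" using IH x y by blast+
      then have "D.part g x * D.part h y \<in> D (g \<otimes> h)"
        by (intro D_mult D.part_in H.mem_carrier)
      then show "D.part g x * D.part h y \<in> ?S" using gh by (intro homog[of "g \<otimes> h"]) simp_all
    qed
    finally show "x * y \<in> ?S" .
  qed
  then show ?thesis using g by blast
qed

end

theorem theorem1p1:
  fixes scale :: "'k::{alg_closed_field, field_char_0} \<Rightarrow> 'a::ring_1 \<Rightarrow> 'a"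
    and gr :: "nat \<Rightarrow> 'a set"
    and G :: "('g, 'c) monoid_scheme"
    and D :: "'g \<Rightarrow> 'a set"
  assumes "AS_regular scale gr 2"
    and "generated_in_degree_one scale gr"
    and "\<exists>x y :: 'a. x * y \<noteq> y * x"
    and "group G" and "finite (carrier G)" and "\<not> comm_group G"
    and "group_grading scale G D"
    and "compatible_gradings scale gr G D"
    and "inner_faithful scale G D"
  shows "\<exists>\<phi> \<in> algebra_iso uv_algebra scale.
         \<exists>a \<in> carrier G. \<exists>b \<in> carrier G.
         \<exists>\<R> :: (letter word \<times> letter word) set.
           ([(L1, True), (L1, True)], [(L2, True), (L2, True)]) \<in> \<R> \<and>
           has_presentation G (case_letter a b) \<R> \<and>
           has_degree D (\<phi> u_class) a \<and> has_degree D (\<phi> v_class) b"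
proof -
  have cg: "connected_graded scale gr" and gk: "gk_dim scale < \<infinity>"
    using assms(1) by (auto simp: AS_regular_def Let_def)
  interpret connected_graded_algebra scale gr by unfold_locales (rule cg)
  interpret G: Group.group G by fact
  interpret GA: group_graded_algebra scale gr G D by unfold_locales (fact assms)+
  obtain B where B: "B \<subseteq> gr 1" "\<And>b. b \<in> B \<Longrightarrow> \<exists>g\<in>carrier G. b \<in> D g" "independent B" "span B = gr 1"
    by (rule GA.homogeneous_basis) (rule that)
  interpret generated_algebra scale gr B by unfold_locales (fact B assms)+
  interpret regular_relations scale gr B by (rule regular_relationsI[OF assms(1)])
  interpret noncommutative_regular scale gr B by unfold_locales (fact gk assms)+
  obtain x y p q where xy: "B = {x, y}" "x \<noteq> y" and pq: "p \<in> gr 1" "q \<in> gr 1" "p * x + q * y = 0"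
    and exact: "\<And>a1 a2. a1 * x + a2 * y = 0 \<Longrightarrow> \<exists>a. a1 = a * p \<and> a2 = a * q"
    and indep: "\<And>c1 c2. scale c1 p + scale c2 q = 0 \<Longrightarrow> c1 = 0 \<and> c2 = 0"
    by (rule quadratic_relation) (rule that)
  have x: "x \<in> gr 1" "x \<noteq> 0" and y: "y \<in> gr 1" "y \<noteq> 0"
    using B(1,3) xy(1) dependent_zero[of B] by auto
  obtain a b where a: "a \<in> carrier G" "x \<in> D a" and b: "b \<in> carrier G" "y \<in> D b"
    using B(2)[of x] B(2)[of y] xy(1) by blast
  have ab: "{a, b} \<subseteq> carrier G" using a b by simp
  have sub: "subgroup (generate G {a, b}) G" by (rule G.generate_is_subgroup[OF ab])
  have deg: "\<exists>h\<in>generate G {a, b}. z \<in> D h" if "z \<in> B" for z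
    using that a b xy(1) by (auto intro: generate.incl)
  have "carrier G \<subseteq> generate G {a, b}"
    by (rule G.inner_faithful_support[OF assms(5) sub assms(9) scale_zero_left scale_zero_right
          GA.support_in_subgroup[OF generated_algebra_axioms sub deg]])
  then have gen: "generate G {a, b} = carrier G" using G.generate_incl[OF ab] by blast
  have nc: "a \<otimes>\<^bsub>G\<^esub> b \<noteq> b \<otimes>\<^bsub>G\<^esub> a"
  proof
    assume "a \<otimes>\<^bsub>G\<^esub> b = b \<otimes>\<^bsub>G\<^esub> a"
    then have "comm_group G"
      using ab by (intro G.generators_commute_imp_comm_group[OF gen]) auto
    with assms(6) show False by contradiction
  qed
  then have "a \<noteq> b" by blast
  have lin: "\<exists>c1 c2. z = scale c1 x + scale c2 y" if "z \<in> gr 1" for z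
  proof -
    have "z \<in> span {x, y}" using that B(4) xy(1) by simp
    then obtain c1 where "z - scale c1 x \<in> span {y}" by (auto simp: span_insert)
    then obtain c2 where "z - scale c1 x = scale c2 y" by (auto simp: span_singleton)
    then have "z = scale c1 x + scale c2 y" by (simp add: algebra_simps)
    then show ?thesis by blast
  qed
  obtain p1 p2 q1 q2 where p: "p = scale p1 x + scale p2 y" and q: "q = scale q1 x + scale q2 y"
    using lin[OF pq(1)] lin[OF pq(2)] by blast
  \<comment> \<open>the four products have degrees \<open>a\<^sup>2\<close>, \<open>b a\<close>, \<open>a b\<close> and \<open>b\<^sup>2\<close>; those of \<open>y x\<close> and \<open>x y\<close> differ from
      all the others\<close>
  have rel: "scale p1 (x * x) + scale p2 (y * x) + scale q1 (x * y) + scale q2 (y * y) = 0"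
    using pq(3) by (simp add: p q distrib_right scale_mult_left algebra_simps)
  have part2: "GA.D.part g (z * w) = (if g = s \<otimes>\<^bsub>G\<^esub> t then z * w else 0)"
    if "s \<in> carrier G" "z \<in> D s" "t \<in> carrier G" "w \<in> D t" for g s t z w
    using that by (intro GA.D.part_homogeneous GA.D_mult G.m_closed)
  have part: "GA.D.part g (x * x) = (if g = a \<otimes>\<^bsub>G\<^esub> a then x * x else 0)"
    "GA.D.part g (y * x) = (if g = b \<otimes>\<^bsub>G\<^esub> a then y * x else 0)"
    "GA.D.part g (x * y) = (if g = a \<otimes>\<^bsub>G\<^esub> b then x * y else 0)"
    "GA.D.part g (y * y) = (if g = b \<otimes>\<^bsub>G\<^esub> b then y * y else 0)" for g
    using part2 a b by blast+
  have comp: "scale p1 (if g = a \<otimes>\<^bsub>G\<^esub> a then x * x else 0) + scale p2 (if g = b \<otimes>\<^bsub>G\<^esub> a then y * x else 0) +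
      scale q1 (if g = a \<otimes>\<^bsub>G\<^esub> b then x * y else 0) + scale q2 (if g = b \<otimes>\<^bsub>G\<^esub> b then y * y else 0) = 0" for g
    using arg_cong[OF rel, of "GA.D.part g"]
    by (simp only: GA.D.part_add GA.D.part_scale GA.D.part_zero part)
  have neq: "b \<otimes>\<^bsub>G\<^esub> a \<noteq> a \<otimes>\<^bsub>G\<^esub> a" "b \<otimes>\<^bsub>G\<^esub> a \<noteq> b \<otimes>\<^bsub>G\<^esub> b" "a \<otimes>\<^bsub>G\<^esub> b \<noteq> a \<otimes>\<^bsub>G\<^esub> a" "a \<otimes>\<^bsub>G\<^esub> b \<noteq> b \<otimes>\<^bsub>G\<^esub> b"
    using \<open>a \<noteq> b\<close> a(1) b(1) by auto
  have nz: "x * x \<noteq> 0" "y * x \<noteq> 0" "x * y \<noteq> 0" "y * y \<noteq> 0"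
    using right_regular[of x] right_regular[of y] x y by blast+
  have p2: "p2 = 0" using comp[of "b \<otimes>\<^bsub>G\<^esub> a"] neq nc nz by simp
  have q1: "q1 = 0" using comp[of "a \<otimes>\<^bsub>G\<^esub> b"] neq nc nz by simp
  have p1: "p1 \<noteq> 0" using indep[of 1 0] by (auto simp: p p2)
  have q2: "q2 \<noteq> 0" using indep[of 0 1] by (auto simp: q q1)
  have squares: "a \<otimes>\<^bsub>G\<^esub> a = b \<otimes>\<^bsub>G\<^esub> b"
  proof (rule ccontr)
    assume "a \<otimes>\<^bsub>G\<^esub> a \<noteq> b \<otimes>\<^bsub>G\<^esub> b"
    then show False using comp[of "a \<otimes>\<^bsub>G\<^esub> a"] neq p1 nz(1) p2 q1 by simp
  qed
  \<comment> \<open>rescaling \<open>y\<close> by \<open>c\<close> turns \<open>p1 x\<^sup>2 + q2 y\<^sup>2 = 0\<close> into \<open>x\<^sup>2 = (c y)\<^sup>2\<close>\<close>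
  obtain c where c: "c ^ 2 = - q2 / p1" using nth_root_exists[of 2 "- q2 / p1"] by auto
  have c0: "c \<noteq> 0" using c q2 p1 by auto
  let ?v = "scale c y"
  have q2_eq: "q2 = - (p1 * c * c)" using c p1 by (simp add: power2_eq_square field_simps)
  interpret uv: uv_relations scale gr x ?v
  proof
    show "x \<in> gr 1" by (rule x(1))
    show "?v \<in> gr 1" by (rule subspace_scale[OF gr_subspace y(1)])
    have "scale p1 (x * x) = scale p1 (?v * ?v)"
      using rel by (simp add: p2 q1 q2_eq scale_mult_left scale_mult_right mult.assoc)
    then show "x * x = ?v * ?v" using p1 by simp
  next
    fix a1 a2 assume "a1 * x + a2 * ?v = 0"
    then have "a1 * x + scale c a2 * y = 0" by (simp add: scale_mult_left scale_mult_right)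
    then obtain e where e: "a1 = e * p" "scale c a2 = e * q" using exact by blast
    have "scale c a2 = scale c (- (scale p1 e * ?v))"
      using e(2) by (simp add: q q1 q2_eq scale_mult_left scale_mult_right mult_ac)
    then have "a2 = - (scale p1 e * ?v)" using c0 by (simp only: scale_cancel_left) simp
    moreover have "a1 = scale p1 e * x" using e(1) by (simp add: p p2 scale_mult_left scale_mult_right)
    ultimately show "\<exists>a. a1 = a * x \<and> a2 = - (a * ?v)" by blast
  next
    fix z n assume z: "z \<in> gr (Suc n)"
    obtain k where k: "k \<in> F" "d k = z" using augmentation_ideal_eq[of z] proj_gr[OF z, of 0] by auto
    have "d k = (\<Sum>b\<in>{x, y}. lookup k b * b)"
      unfolding d_def by (rule free_eval_superset) (use k(1) xy(1) in \<open>simp_all add: free_on_def\<close>)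
    then have "z = lookup k x * x + lookup k y * y" using k(2) xy(2) by simp
    then have "proj (Suc n) z = proj n (lookup k x) * x + proj n (lookup k y) * y"
      using proj_mult_right[OF x(1), of "Suc n"] proj_mult_right[OF y(1), of "Suc n"]
      by (simp add: proj_add)
    also have "\<dots> = proj n (lookup k x) * x + scale (inverse c) (proj n (lookup k y)) * ?v"
      using c0 by (simp add: scale_mult_left scale_mult_right)
    finally have "z = proj n (lookup k x) * x + scale (inverse c) (proj n (lookup k y)) * ?v"
      using proj_gr[OF z, of "Suc n"] by simp
    then show "\<exists>a1\<in>gr n. \<exists>a2\<in>gr n. z = a1 * x + a2 * ?v"
      using proj_in_gr subspace_scale[OF gr_subspace proj_in_gr] by blast
  qed
  obtain \<phi> where \<phi>: "\<phi> \<in> algebra_iso uv_algebra scale" "\<phi> u_class = x" "\<phi> v_class = ?v"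
    by (rule uv.uv_algebra_iso)
  let ?gens = "case_letter a b"
  let ?R = "{(r, s). G.word_value ?gens r = G.word_value ?gens s}"
  have range: "range ?gens = {a, b}"
  proof
    show "{a, b} \<subseteq> range ?gens" using range_eqI[of a ?gens L1] range_eqI[of b ?gens L2] by simp
    show "range ?gens \<subseteq> {a, b}" by (auto split: letter.splits)
  qed
  have "has_presentation G ?gens ?R"
    by (rule G.has_presentation_all_relations) (simp_all only: range ab gen)
  moreover have "([(L1, True), (L1, True)], [(L2, True), (L2, True)]) \<in> ?R"
    using a(1) b(1) squares by (simp add: G.word_value_def G.letter_value_def)
  moreover have "has_degree D x a" using a x by (simp add: has_degree_def)
  moreover have "has_degree D ?v b"
    using y(2) c0 subspace_scale[OF GA.D.subspace_D[OF b(1)] b(2)] by (simp add: has_degree_def)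
  ultimately show ?thesis
    using \<phi> a(1) b(1) by (intro bexI[of _ \<phi>] bexI[of _ a] bexI[of _ b] exI[of _ ?R]) simp_all
qed

end
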